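(* Let $(\mathfrak k,\mathfrak g,\pi,\cdot)$ be a crossed module of Leibniz algebras over a field $\Bbbk$. Consider the tensor product $\otimes$ on $\mathcal{YD}_{\mathfrak g^+}^{\mathfrak k^+}$ described in the context and, for $M,M',M''\in\mathcal{YD}_{\mathfrak g^+}^{\mathfrak k^+}$, the maps $$\alpha_{M,M',M''}\colon(M\otimes M')\otimes M''\to M\otimes(M'\otimes M''),\qquad (m\otimes m')\otimes m''\mapsto \bigl(m\ast\pi(m''_{(1)})\bigr)\otimes(m'\otimes m''_{(0)}).$$ (1) These data satisfy all the pre-tensor structure axioms except for the invertibility of $\alpha$. (2) The Yetter-Drinfel'd module $(\Bbbk,\varepsilon,\nu)$, with $\mathfrak g^+$-action given by $\varepsilon\colon\mathfrak g^+\to\Bbbk$ and $\mathfrak k^+$-coaction given by $\nu(1)=1\in\mathfrak k^+$, is a strict right unit for this structure. (3) Restricted to the representation category $\mathcal M(\mathfrak k,\mathfrak g)$, this yields a genuine pre-tensor structure with a right unit.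
   Context: A (right) Leibniz algebra is a vector space with a bilinear bracket with $[v,[w,u]]=[[v,w],u]-[[v,u],w]$. An action of $\mathfrak g$ on a vector space $M$ is a bilinear map $(m,g)\mapsto m\ast g$ with $m\ast[g,g']=(m\ast g)\ast g'-(m\ast g')\ast g$. A crossed module of Leibniz algebras $(\mathfrak k,\mathfrak g,\pi,\cdot)$ is a Leibniz algebra morphism $\pi\colon\mathfrak k\to\mathfrak g$ and an action $\cdot$ of $\mathfrak g$ on $\mathfrak k$ by derivations with $k\cdot\pi(k')=[k,k']_{\mathfrak k}$ and $\pi(k\cdot g)=[\pi(k),g]_{\mathfrak g}$. Unitarization: $\mathfrak k^+=\mathfrak k\oplus\Bbbk1$ (similarly $\mathfrak g^+$), with the bracket extended by zero when one argument is $1$, and with the coalgebra structure $\Delta(k)=k\otimes1+1\otimes k$, $\varepsilon(k)=0$ for $k\in\mathfrak k$, $\Delta(1)=1\otimes1$, $\varepsilon(1)=1$; write $\Delta(g)=g_{(1)}\otimes g_{(2)}$. The map $\pi$ is extended to $\mathfrak k^+\to\mathfrak g^+$ by $\pi(1)=1$. The symbol $\cdot$ also denotes the bilinear unitarized actions of $\mathfrak k^+$ on $\mathfrak k^+$, of $\mathfrak g^+$ on $\mathfrak g^+$ (both extending the adjoint action $x\cdot y=[x,y]$) and of $\mathfrak g^+$ on $\mathfrak k^+$ (extending the given action), with $x\cdot1=x$ and $1\cdot y=\varepsilon(y)1$. $\mathcal{YD}_{\mathfrak g^+}^{\mathfrak k^+}$: an object is a vector space $M$ with linear maps $\ast\colon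 M\otimes\mathfrak g^+\to M$ and $\delta\colon M\to M\otimes\mathfrak k^+$, $\delta(m)=m_{(0)}\otimes m_{(1)}$, such that $(m\ast g')\ast g=(m\ast g_{(1)})\ast(g'\cdot g_{(2)})$; $(\delta\otimes\mathrm{Id})\delta=(\mathrm{Id}_M\otimes\sigma)(\delta\otimes\mathrm{Id})\delta$ with $\sigma(k\otimes k')=\varepsilon(k)\Delta(k')$; and $\delta(m\ast g)=m_{(0)}\ast g_{(1)}\otimes m_{(1)}\cdot g_{(2)}$. Morphisms are linear maps commuting with actions and coactions. (These are the Yetter-Drinfel'd modules over the braided system $(\mathfrak k^+,\mathfrak g^+)$ attached to the crossed module.) Tensor product of $(M,\ast,\delta)$ and $(M',\ast',\delta')$: the vector space $M\otimes M'$, on which $1\in\mathfrak g^+$ acts by the identity and elements $g\in\mathfrak g$ act by the Leibniz rule $(m\otimes m')\ast_\otimes g=m\otimes m'\ast'g+m\ast g\otimes m'$, with coaction $\delta_\otimes(m\otimes m')=m_{(0)}\otimes m'_{(0)}\otimes m_{(1)}\cdot m'_{(1)}$, where $\cdot$ is the unitarized adjoint action of $\mathfrak k^+$ on itself; on morphisms $\varphi\otimes\psi$. A representation of $(\mathfrak k,\mathfrak g,\pi,\cdot)$ is a vector space $M$ with a $\mathfrak g$-action $\ast$ and a linear map $\delta_0\colon M\to M\otimes\mathfrak k$ with $(\delta_0\otimes\mathrm{Id})\delta_0=0$ and $\delta_0(m\ast g)=\delta_0(m)\ast g$, where $(m\otimes k)\ast g=m\otimes k\cdot g+m\ast g\otimes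 k$. With the obvious morphisms these form $\mathcal M(\mathfrak k,\mathfrak g)$, included in $\mathcal{YD}_{\mathfrak g^+}^{\mathfrak k^+}$ via $m\ast1=m$ and $\delta(m)=\delta_0(m)+m\otimes1$. A pre-tensor category is a category with a bifunctor $\otimes$ and natural isomorphisms $\alpha_{U,V,W}\colon(U\otimes V)\otimes W\to U\otimes(V\otimes W)$ satisfying the pentagon axiom $(U\otimes\alpha_{V,W,X})\circ\alpha_{U,V\otimes W,X}\circ(\alpha_{U,V,W}\otimes X)=\alpha_{U,V,W\otimes X}\circ\alpha_{U\otimes V,W,X}$ (no unit is required).
   Formalization: The objects of the Yetter-Drinfel'd category are additionally required to satisfy m∗1 = m for 1 in 𝔤⁺; without this the tensor product of two objects need not be an object, and M⊗𝕜 ≅ M fails for every other M. *)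

theory Defs
  imports "HOL-Algebra.Module" "HOL-Library.FuncSet"
begin

section \<open>Vector spaces inside a universe closed under tensor products\<close>

text \<open>
  A category needs a single type of objects, so all vector spaces have their carriers in one
  type \<open>('a, 'k) univ\<close>. It contains an arbitrary type of atoms \<open>'a\<close>, the scalars, the elements
  \<open>x + c1\<close> of a unitarization, and formal finite sums of pairs, which represent tensors.
  A vector space over a field \<open>K\<close> is a HOL-Algebra module over \<open>K\<close>; the ring multiplication and
  unit that the module record inherits are irrelevant and left undefined below.
\<close>

datatype ('a, 'k) univ =
    Atom 'a
  | Scalar (scalar_of: 'k)
  | Unitar (alg_part: "('a, 'k) univ") (unit_part: 'k)
  | Formal (terms_of: "(('a, 'k) univ \<times> ('a, 'k) univ) list")

type_synonym ('a, 'k) vect = "('k, ('a, 'k) univ) module"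
type_synonym ('a, 'k) endo = "('a, 'k) univ \<Rightarrow> ('a, 'k) univ"
type_synonym ('a, 'k) binop = "('a, 'k) univ \<Rightarrow> ('a, 'k) univ \<Rightarrow> ('a, 'k) univ"

definition linear_map :: "'k ring \<Rightarrow> ('a, 'k) vect \<Rightarrow> ('a, 'k) vect \<Rightarrow> ('a, 'k) endo \<Rightarrow> bool" where
  "linear_map K V W f \<longleftrightarrow>
     f \<in> carrier V \<rightarrow> carrier W \<and>
     (\<forall>x\<in>carrier V. \<forall>y\<in>carrier V. f (x \<oplus>\<^bsub>V\<^esub> y) = f x \<oplus>\<^bsub>W\<^esub> f y) \<and>
     (\<forall>a\<in>carrier K. \<forall>x\<in>carrier V. f (a \<odot>\<^bsub>V\<^esub> x) = a \<odot>\<^bsub>W\<^esub> f x)"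

definition bilinear_map ::
    "'k ring \<Rightarrow> ('a, 'k) vect \<Rightarrow> ('a, 'k) vect \<Rightarrow> ('a, 'k) vect \<Rightarrow> ('a, 'k) binop \<Rightarrow> bool" where
  "bilinear_map K V W Z b \<longleftrightarrow>
     (\<forall>x\<in>carrier V. linear_map K W Z (b x)) \<and>
     (\<forall>y\<in>carrier W. linear_map K V Z (\<lambda>x. b x y))"

definition scalar_space :: "'k ring \<Rightarrow> ('a, 'k) vect" where
  "scalar_space K =
     \<lparr>carrier = Scalar ` carrier K, mult = undefined, one = undefined,
      zero = Scalar \<zero>\<^bsub>K\<^esub>,
      add = (\<lambda>x y. Scalar (scalar_of x \<oplus>\<^bsub>K\<^esub> scalar_of y)),
      smult = (\<lambda>a x. Scalar (a \<otimes>\<^bsub>K\<^esub> scalar_of x))\<rparr>"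

text \<open>
  The tensor product is the free commutative monoid on pairs modulo biadditivity and balancedness.
  Formal sums are lists of pairs. Coefficients are not needed, since a scalar can be absorbed
  into the left factor.
\<close>

inductive tensor_eq ::
    "'k ring \<Rightarrow> ('a, 'k) vect \<Rightarrow> ('a, 'k) vect \<Rightarrow>
     (('a, 'k) univ \<times> ('a, 'k) univ) list \<Rightarrow> (('a, 'k) univ \<times> ('a, 'k) univ) list \<Rightarrow> bool"
  for K V W where
  refl: "set r \<subseteq> carrier V \<times> carrier W \<Longrightarrow> tensor_eq K V W r r"
| sym: "tensor_eq K V W r s \<Longrightarrow> tensor_eq K V W s r"
| trans: "tensor_eq K V W r s \<Longrightarrow> tensor_eq K V W s t \<Longrightarrow> tensor_eq K V W r t"
| cong: "tensor_eq K V W r s \<Longrightarrow> set t \<subseteq> carrier V \<times> carrier W \<Longrightarrow>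
    tensor_eq K V W (r @ t) (s @ t)"
| comm: "set r \<subseteq> carrier V \<times> carrier W \<Longrightarrow> set s \<subseteq> carrier V \<times> carrier W \<Longrightarrow>
    tensor_eq K V W (r @ s) (s @ r)"
| zero: "y \<in> carrier W \<Longrightarrow> tensor_eq K V W [(\<zero>\<^bsub>V\<^esub>, y)] []"
| add_left: "x \<in> carrier V \<Longrightarrow> x' \<in> carrier V \<Longrightarrow> y \<in> carrier W \<Longrightarrow>
    tensor_eq K V W [(x \<oplus>\<^bsub>V\<^esub> x', y)] [(x, y), (x', y)]"
| add_right: "x \<in> carrier V \<Longrightarrow> y \<in> carrier W \<Longrightarrow> y' \<in> carrier W \<Longrightarrow>
    tensor_eq K V W [(x, y \<oplus>\<^bsub>W\<^esub> y')] [(x, y), (x, y')]"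
| balanced: "a \<in> carrier K \<Longrightarrow> x \<in> carrier V \<Longrightarrow> y \<in> carrier W \<Longrightarrow>
    tensor_eq K V W [(a \<odot>\<^bsub>V\<^esub> x, y)] [(x, a \<odot>\<^bsub>W\<^esub> y)]"

text \<open>
  An equivalence class is represented by a chosen member of it, which depends only on the class itself.
\<close>

definition tensor_class ::
    "'k ring \<Rightarrow> ('a, 'k) vect \<Rightarrow> ('a, 'k) vect \<Rightarrow>
     (('a, 'k) univ \<times> ('a, 'k) univ) list \<Rightarrow> ('a, 'k) univ" where
  "tensor_class K V W r = Formal (SOME s. tensor_eq K V W r s)"

definition tensor_space :: "'k ring \<Rightarrow> ('a, 'k) vect \<Rightarrow> ('a, 'k) vect \<Rightarrow> ('a, 'k) vect" where
  "tensor_space K V W =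
     \<lparr>carrier = tensor_class K V W ` lists (carrier V \<times> carrier W),
      mult = undefined, one = undefined,
      zero = tensor_class K V W [],
      add = (\<lambda>s t. tensor_class K V W (terms_of s @ terms_of t)),
      smult = (\<lambda>a t. tensor_class K V W (map (\<lambda>(x, y). (a \<odot>\<^bsub>V\<^esub> x, y)) (terms_of t)))\<rparr>"

definition pure_tensor ::
    "'k ring \<Rightarrow> ('a, 'k) vect \<Rightarrow> ('a, 'k) vect \<Rightarrow> ('a, 'k) binop" where
  "pure_tensor K V W x y = tensor_class K V W [(x, y)]"

text \<open>
  \<open>sweedler Z t b\<close> is the value at \<open>t\<close> of the linear map into \<open>Z\<close> induced by the bilinear map \<open>b\<close>.
  Thus \<open>sweedler Z (\<delta> m) (\<lambda>m0 m1. b m0 m1)\<close> renders the Sweedler expression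
  \<open>b m\<^sub>(\<^sub>0\<^sub>) m\<^sub>(\<^sub>1\<^sub>)\<close>.
\<close>

definition sweedler ::
    "('a, 'k) vect \<Rightarrow> ('a, 'k) univ \<Rightarrow> ('a, 'k) binop \<Rightarrow> ('a, 'k) univ" where
  "sweedler Z t b = foldr (\<lambda>(x, y) s. b x y \<oplus>\<^bsub>Z\<^esub> s) (terms_of t) \<zero>\<^bsub>Z\<^esub>"

definition tensor_map ::
    "'k ring \<Rightarrow> ('a, 'k) vect \<Rightarrow> ('a, 'k) vect \<Rightarrow> ('a, 'k) endo \<Rightarrow> ('a, 'k) endo \<Rightarrow> ('a, 'k) endo" where
  "tensor_map K V' W' f g t =
     sweedler (tensor_space K V' W') t (\<lambda>x y. pure_tensor K V' W' (f x) (g y))"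

definition vect_assoc ::
    "'k ring \<Rightarrow> ('a, 'k) vect \<Rightarrow> ('a, 'k) vect \<Rightarrow> ('a, 'k) vect \<Rightarrow> ('a, 'k) endo" where
  "vect_assoc K U V W t =
     (let T = tensor_space K U (tensor_space K V W) in
      sweedler T t (\<lambda>s z. sweedler T s (\<lambda>x y.
        pure_tensor K U (tensor_space K V W) x (pure_tensor K V W y z))))"

section \<open>Crossed modules of Leibniz algebras\<close>

record ('a, 'k) leibniz =
  space :: "('a, 'k) vect"
  bracket :: "('a, 'k) binop"

definition leibniz_algebra :: "'k ring \<Rightarrow> ('a, 'k) leibniz \<Rightarrow> bool" where
  "leibniz_algebra K L \<longleftrightarrow>
     module K (space L) \<and>
     bilinear_map K (space L) (space L) (space L) (bracket L) \<and>
     (\<forall>v\<in>carrier (space L). \<forall>w\<in>carrier (space L). \<forall>u\<in>carrier (space L).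
        bracket L v (bracket L w u) =
        bracket L (bracket L v w) u \<ominus>\<^bsub>space L\<^esub> bracket L (bracket L v u) w)"

definition leibniz_action ::
    "'k ring \<Rightarrow> ('a, 'k) leibniz \<Rightarrow> ('a, 'k) vect \<Rightarrow> ('a, 'k) binop \<Rightarrow> bool" where
  "leibniz_action K L M act \<longleftrightarrow>
     bilinear_map K M (space L) M act \<and>
     (\<forall>m\<in>carrier M. \<forall>g\<in>carrier (space L). \<forall>g'\<in>carrier (space L).
        act m (bracket L g g') = act (act m g) g' \<ominus>\<^bsub>M\<^esub> act (act m g') g)"

record ('a, 'k) xmod =
  ground :: "'k ring"
  kk :: "('a, 'k) leibniz"
  gg :: "('a, 'k) leibniz"
  pi_map :: "('a, 'k) endo"
  xact :: "('a, 'k) binop"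

definition leibniz_crossed_module :: "('a, 'k) xmod \<Rightarrow> bool" where
  "leibniz_crossed_module X \<longleftrightarrow>
     (let K = ground X; k = carrier (space (kk X)); g = carrier (space (gg X)) in
      field K \<and> leibniz_algebra K (kk X) \<and> leibniz_algebra K (gg X) \<and>
      linear_map K (space (kk X)) (space (gg X)) (pi_map X) \<and>
      (\<forall>x\<in>k. \<forall>y\<in>k. pi_map X (bracket (kk X) x y) = bracket (gg X) (pi_map X x) (pi_map X y)) \<and>
      leibniz_action K (gg X) (space (kk X)) (xact X) \<and>
      (\<forall>x\<in>k. \<forall>y\<in>k. \<forall>u\<in>g.
         xact X (bracket (kk X) x y) u =
         bracket (kk X) (xact X x u) y \<oplus>\<^bsub>space (kk X)\<^esub> bracket (kk X) x (xact X y u)) \<and>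
      (\<forall>x\<in>k. \<forall>y\<in>k. xact X x (pi_map X y) = bracket (kk X) x y) \<and>
      (\<forall>x\<in>k. \<forall>u\<in>g. pi_map X (xact X x u) = bracket (gg X) (pi_map X x) u))"

section \<open>Unitarization\<close>

text \<open>\<open>Unitar x c\<close> stands for \<open>x + c1\<close>; its second component is the value of the counit.\<close>

definition plus_space :: "'k ring \<Rightarrow> ('a, 'k) vect \<Rightarrow> ('a, 'k) vect" where
  "plus_space K V =
     \<lparr>carrier = {Unitar x c | x c. x \<in> carrier V \<and> c \<in> carrier K},
      mult = undefined, one = undefined,
      zero = Unitar \<zero>\<^bsub>V\<^esub> \<zero>\<^bsub>K\<^esub>,
      add = (\<lambda>p q. Unitar (alg_part p \<oplus>\<^bsub>V\<^esub> alg_part q) (unit_part p \<oplus>\<^bsub>K\<^esub> unit_part q)),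
      smult = (\<lambda>a p. Unitar (a \<odot>\<^bsub>V\<^esub> alg_part p) (a \<otimes>\<^bsub>K\<^esub> unit_part p))\<rparr>"

definition plus_embed :: "'k ring \<Rightarrow> ('a, 'k) endo" where
  "plus_embed K x = Unitar x \<zero>\<^bsub>K\<^esub>"

definition plus_one :: "'k ring \<Rightarrow> ('a, 'k) vect \<Rightarrow> ('a, 'k) univ" where
  "plus_one K V = Unitar \<zero>\<^bsub>V\<^esub> \<one>\<^bsub>K\<^esub>"

definition plus_counit :: "('a, 'k) univ \<Rightarrow> 'k" where
  "plus_counit p = unit_part p"

definition plus_comult :: "'k ring \<Rightarrow> ('a, 'k) vect \<Rightarrow> ('a, 'k) endo" where
  "plus_comult K V p =
     (let P = plus_space K V; T = tensor_space K P P;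
          x = plus_embed K (alg_part p); e = plus_one K V in
      (pure_tensor K P P x e \<oplus>\<^bsub>T\<^esub> pure_tensor K P P e x)
        \<oplus>\<^bsub>T\<^esub> (unit_part p \<odot>\<^bsub>T\<^esub> pure_tensor K P P e e))"

text \<open>
  The bilinear extension of \<open>act\<close> with \<open>x \<cdot> 1 = x\<close> and \<open>1 \<cdot> y = \<epsilon>(y)1\<close>:
  \<open>(x + a1) \<cdot> (y + b1) = (x \<cdot> y + b x) + (a b)1\<close>.
\<close>

definition plus_act :: "'k ring \<Rightarrow> ('a, 'k) vect \<Rightarrow> ('a, 'k) binop \<Rightarrow> ('a, 'k) binop" where
  "plus_act K V act p q =
     Unitar (act (alg_part p) (alg_part q) \<oplus>\<^bsub>V\<^esub> (unit_part q \<odot>\<^bsub>V\<^esub> alg_part p))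
            (unit_part p \<otimes>\<^bsub>K\<^esub> unit_part q)"

definition kplus :: "('a, 'k) xmod \<Rightarrow> ('a, 'k) vect" where
  "kplus X = plus_space (ground X) (space (kk X))"

definition gplus :: "('a, 'k) xmod \<Rightarrow> ('a, 'k) vect" where
  "gplus X = plus_space (ground X) (space (gg X))"

definition kone :: "('a, 'k) xmod \<Rightarrow> ('a, 'k) univ" where
  "kone X = plus_one (ground X) (space (kk X))"

definition gone :: "('a, 'k) xmod \<Rightarrow> ('a, 'k) univ" where
  "gone X = plus_one (ground X) (space (gg X))"

definition kcomult :: "('a, 'k) xmod \<Rightarrow> ('a, 'k) endo" where
  "kcomult X = plus_comult (ground X) (space (kk X))"

definition gcomult :: "('a, 'k) xmod \<Rightarrow> ('a, 'k) endo" where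
  "gcomult X = plus_comult (ground X) (space (gg X))"

definition kk_act :: "('a, 'k) xmod \<Rightarrow> ('a, 'k) binop" where
  "kk_act X = plus_act (ground X) (space (kk X)) (bracket (kk X))"

definition gg_act :: "('a, 'k) xmod \<Rightarrow> ('a, 'k) binop" where
  "gg_act X = plus_act (ground X) (space (gg X)) (bracket (gg X))"

definition kg_act :: "('a, 'k) xmod \<Rightarrow> ('a, 'k) binop" where
  "kg_act X = plus_act (ground X) (space (kk X)) (xact X)"

definition pi_plus :: "('a, 'k) xmod \<Rightarrow> ('a, 'k) endo" where
  "pi_plus X p = Unitar (pi_map X (alg_part p)) (unit_part p)"

section \<open>Yetter-Drinfel'd modules\<close>

record ('a, 'k) yd =
  yspace :: "('a, 'k) vect"
  yact :: "('a, 'k) binop"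
  ycoact :: "('a, 'k) endo"

definition yd_action_axiom :: "('a, 'k) xmod \<Rightarrow> ('a, 'k) yd \<Rightarrow> bool" where
  "yd_action_axiom X M \<longleftrightarrow>
     (\<forall>m\<in>carrier (yspace M). \<forall>g\<in>carrier (gplus X). \<forall>g'\<in>carrier (gplus X).
        yact M (yact M m g') g =
        sweedler (yspace M) (gcomult X g) (\<lambda>g1 g2. yact M (yact M m g1) (gg_act X g' g2)))"

definition sigma :: "('a, 'k) xmod \<Rightarrow> ('a, 'k) endo" where
  "sigma X t =
     (let T = tensor_space (ground X) (kplus X) (kplus X) in
      sweedler T t (\<lambda>k k'. plus_counit k \<odot>\<^bsub>T\<^esub> kcomult X k'))"

text \<open>
  Both sides live in \<open>M \<otimes> (k\<^sup>+ \<otimes> k\<^sup>+)\<close>, with the usual identification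
  \<open>(M \<otimes> k\<^sup>+) \<otimes> k\<^sup>+ = M \<otimes> (k\<^sup>+ \<otimes> k\<^sup>+)\<close> made explicit.
\<close>

definition yd_coaction_axiom :: "('a, 'k) xmod \<Rightarrow> ('a, 'k) yd \<Rightarrow> bool" where
  "yd_coaction_axiom X M \<longleftrightarrow>
     (let K = ground X; V = yspace M; P = kplus X; PP = tensor_space K P P;
          twice = (\<lambda>m. vect_assoc K V P P
                    (tensor_map K (tensor_space K V P) P (ycoact M) id (ycoact M m))) in
      \<forall>m\<in>carrier V. twice m = tensor_map K V PP id (sigma X) (twice m))"

definition yd_compatibility :: "('a, 'k) xmod \<Rightarrow> ('a, 'k) yd \<Rightarrow> bool" where
  "yd_compatibility X M \<longleftrightarrow>
     (let K = ground X; V = yspace M; P = kplus X; T = tensor_space K V P in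
      \<forall>m\<in>carrier V. \<forall>g\<in>carrier (gplus X).
        ycoact M (yact M m g) =
        sweedler T (ycoact M m) (\<lambda>m0 m1. sweedler T (gcomult X g) (\<lambda>g1 g2.
          pure_tensor K V P (yact M m0 g1) (kg_act X m1 g2))))"

definition yd_module :: "('a, 'k) xmod \<Rightarrow> ('a, 'k) yd \<Rightarrow> bool" where
  "yd_module X M \<longleftrightarrow>
     module (ground X) (yspace M) \<and>
     bilinear_map (ground X) (yspace M) (gplus X) (yspace M) (yact M) \<and>
     linear_map (ground X) (yspace M) (tensor_space (ground X) (yspace M) (kplus X)) (ycoact M) \<and>
     yd_action_axiom X M \<and> yd_coaction_axiom X M \<and> yd_compatibility X M"

text \<open>
  The objects of the category are the modules on which \<open>1\<close> acts by the identity. This convention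
  is forced by the tensor product: \<open>1\<close> acts by the identity on \<open>M \<otimes> \<k>\<close>, so that
  \<open>M \<otimes> \<k> \<cong> M\<close> fails for every other \<open>M\<close>. No counit condition is put on the coaction.
\<close>

definition unital_action :: "('a, 'k) xmod \<Rightarrow> ('a, 'k) yd \<Rightarrow> bool" where
  "unital_action X M \<longleftrightarrow> (\<forall>m\<in>carrier (yspace M). yact M m (gone X) = m)"

definition yd_hom ::
    "('a, 'k) xmod \<Rightarrow> ('a, 'k) yd \<Rightarrow> ('a, 'k) yd \<Rightarrow> ('a, 'k) endo \<Rightarrow> bool" where
  "yd_hom X M N f \<longleftrightarrow>
     linear_map (ground X) (yspace M) (yspace N) f \<and>
     f \<in> extensional (carrier (yspace M)) \<and>
     (\<forall>m\<in>carrier (yspace M). \<forall>g\<in>carrier (gplus X). f (yact M m g) = yact N (f m) g) \<and>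
     (\<forall>m\<in>carrier (yspace M).
        ycoact N (f m) = tensor_map (ground X) (yspace N) (kplus X) f id (ycoact M m))"

section \<open>Categories and pre-tensor structures\<close>

record ('o, 'm) category =
  obj :: "'o set"
  arr :: "'m set"
  src :: "'m \<Rightarrow> 'o"
  tgt :: "'m \<Rightarrow> 'o"
  ident :: "'o \<Rightarrow> 'm"
  comp :: "'m \<Rightarrow> 'm \<Rightarrow> 'm"

definition homset :: "('o, 'm) category \<Rightarrow> 'o \<Rightarrow> 'o \<Rightarrow> 'm set" where
  "homset C A B = {f \<in> arr C. src C f = A \<and> tgt C f = B}"

definition iso_arrow :: "('o, 'm) category \<Rightarrow> 'm \<Rightarrow> bool" where
  "iso_arrow C f \<longleftrightarrow> f \<in> arr C \<and>
     (\<exists>h\<in>homset C (tgt C f) (src C f).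
        comp C h f = ident C (src C f) \<and> comp C f h = ident C (tgt C f))"

locale category =
  fixes C :: "('o, 'm) category"
  assumes src_obj: "f \<in> arr C \<Longrightarrow> src C f \<in> obj C"
    and tgt_obj: "f \<in> arr C \<Longrightarrow> tgt C f \<in> obj C"
    and ident_hom: "A \<in> obj C \<Longrightarrow> ident C A \<in> homset C A A"
    and comp_hom: "f \<in> homset C A B \<Longrightarrow> g \<in> homset C B D \<Longrightarrow> comp C g f \<in> homset C A D"
    and comp_ident_left: "f \<in> homset C A B \<Longrightarrow> comp C (ident C B) f = f"
    and comp_ident_right: "f \<in> homset C A B \<Longrightarrow> comp C f (ident C A) = f"
    and comp_assoc: "f \<in> homset C A B \<Longrightarrow> g \<in> homset C B D \<Longrightarrow> h \<in> homset C D E \<Longrightarrow>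
      comp C h (comp C g f) = comp C (comp C h g) f"

locale almost_pre_tensor_category = category C
  for C :: "('o, 'm) category" +
  fixes tob :: "'o \<Rightarrow> 'o \<Rightarrow> 'o"
    and tar :: "'m \<Rightarrow> 'm \<Rightarrow> 'm"
    and \<alpha> :: "'o \<Rightarrow> 'o \<Rightarrow> 'o \<Rightarrow> 'm"
  assumes tensor_obj: "U \<in> obj C \<Longrightarrow> V \<in> obj C \<Longrightarrow> tob U V \<in> obj C"
    and tensor_hom: "f \<in> homset C U U' \<Longrightarrow> g \<in> homset C V V' \<Longrightarrow>
      tar f g \<in> homset C (tob U V) (tob U' V')"
    and tensor_ident: "U \<in> obj C \<Longrightarrow> V \<in> obj C \<Longrightarrow>
      tar (ident C U) (ident C V) = ident C (tob U V)"
    and tensor_comp: "f \<in> homset C U U' \<Longrightarrow> f' \<in> homset C U' U'' \<Longrightarrow>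
      g \<in> homset C V V' \<Longrightarrow> g' \<in> homset C V' V'' \<Longrightarrow>
      tar (comp C f' f) (comp C g' g) = comp C (tar f' g') (tar f g)"
    and assoc_hom: "U \<in> obj C \<Longrightarrow> V \<in> obj C \<Longrightarrow> W \<in> obj C \<Longrightarrow>
      \<alpha> U V W \<in> homset C (tob (tob U V) W) (tob U (tob V W))"
    and assoc_natural: "f \<in> homset C U U' \<Longrightarrow> g \<in> homset C V V' \<Longrightarrow> h \<in> homset C W W' \<Longrightarrow>
      comp C (\<alpha> U' V' W') (tar (tar f g) h) = comp C (tar f (tar g h)) (\<alpha> U V W)"
    and pentagon: "U \<in> obj C \<Longrightarrow> V \<in> obj C \<Longrightarrow> W \<in> obj C \<Longrightarrow> Y \<in> obj C \<Longrightarrow>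
      comp C (tar (ident C U) (\<alpha> V W Y))
        (comp C (\<alpha> U (tob V W) Y) (tar (\<alpha> U V W) (ident C Y))) =
      comp C (\<alpha> U V (tob W Y)) (\<alpha> (tob U V) W Y)"

locale pre_tensor_category = almost_pre_tensor_category C tob tar \<alpha>
  for C :: "('o, 'm) category" and tob tar \<alpha> +
  assumes assoc_iso: "U \<in> obj C \<Longrightarrow> V \<in> obj C \<Longrightarrow> W \<in> obj C \<Longrightarrow> iso_arrow C (\<alpha> U V W)"

locale right_unit = almost_pre_tensor_category C tob tar \<alpha>
  for C :: "('o, 'm) category" and tob tar \<alpha> +
  fixes I :: 'o and \<rho> :: "'o \<Rightarrow> 'm"
  assumes unit_obj: "I \<in> obj C"
    and unitor_hom: "U \<in> obj C \<Longrightarrow> \<rho> U \<in> homset C (tob U I) U"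
    and unitor_iso: "U \<in> obj C \<Longrightarrow> iso_arrow C (\<rho> U)"
    and unitor_natural: "f \<in> homset C U V \<Longrightarrow>
      comp C (\<rho> V) (tar f (ident C I)) = comp C f (\<rho> U)"
    and unitor_coherence: "U \<in> obj C \<Longrightarrow> V \<in> obj C \<Longrightarrow>
      comp C (tar (ident C U) (\<rho> V)) (\<alpha> U V I) = \<rho> (tob U V)"

definition subcategory :: "('o, 'm) category \<Rightarrow> ('o, 'm) category \<Rightarrow> bool" where
  "subcategory D C \<longleftrightarrow>
     category D \<and> category C \<and> obj D \<subseteq> obj C \<and> arr D \<subseteq> arr C \<and>
     (\<forall>f\<in>arr D. src D f = src C f \<and> tgt D f = tgt C f) \<and>
     (\<forall>A\<in>obj D. ident D A = ident C A) \<and>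
     (\<forall>f\<in>arr D. \<forall>g\<in>arr D. tgt D f = src D g \<longrightarrow> comp D g f = comp C g f)"

section \<open>The category of Yetter-Drinfel'd modules and its tensor product\<close>

datatype ('a, 'k) arrow =
  Arrow (dom_of: "('a, 'k) yd") (cod_of: "('a, 'k) yd") (fun_of: "('a, 'k) endo")

definition yd_ident :: "('a, 'k) yd \<Rightarrow> ('a, 'k) arrow" where
  "yd_ident M = Arrow M M (\<lambda>m\<in>carrier (yspace M). m)"

definition yd_comp :: "('a, 'k) arrow \<Rightarrow> ('a, 'k) arrow \<Rightarrow> ('a, 'k) arrow" where
  "yd_comp g f =
     Arrow (dom_of f) (cod_of g) (compose (carrier (yspace (dom_of f))) (fun_of g) (fun_of f))"

definition yd_category :: "('a, 'k) xmod \<Rightarrow> (('a, 'k) yd, ('a, 'k) arrow) category" where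
  "yd_category X =
     \<lparr>obj = {M. yd_module X M \<and> unital_action X M},
      arr = {Arrow M N f | M N f.
               yd_module X M \<and> unital_action X M \<and> yd_module X N \<and> unital_action X N \<and>
               yd_hom X M N f},
      src = dom_of, tgt = cod_of, ident = yd_ident, comp = yd_comp\<rparr>"

definition yd_tensor :: "('a, 'k) xmod \<Rightarrow> ('a, 'k) yd \<Rightarrow> ('a, 'k) yd \<Rightarrow> ('a, 'k) yd" where
  "yd_tensor X M M' =
     (let K = ground X; V = yspace M; V' = yspace M'; P = kplus X;
          T = tensor_space K V V'; TP = tensor_space K T P in
      \<lparr>yspace = T,
       yact = (\<lambda>t\<in>carrier T. \<lambda>p\<in>carrier (gplus X).
         (let g = plus_embed K (alg_part p) in
          sweedler T t (\<lambda>m m'.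
            pure_tensor K V V' m (yact M' m' g) \<oplus>\<^bsub>T\<^esub> pure_tensor K V V' (yact M m g) m')
          \<oplus>\<^bsub>T\<^esub> (unit_part p \<odot>\<^bsub>T\<^esub> t))),
       ycoact = (\<lambda>t\<in>carrier T.
         sweedler TP t (\<lambda>m m'.
           sweedler TP (ycoact M m) (\<lambda>m0 m1.
             sweedler TP (ycoact M' m') (\<lambda>m0' m1'.
               pure_tensor K T P (pure_tensor K V V' m0 m0') (kk_act X m1 m1')))))\<rparr>)"

definition yd_tensor_arrow ::
    "('a, 'k) xmod \<Rightarrow> ('a, 'k) arrow \<Rightarrow> ('a, 'k) arrow \<Rightarrow> ('a, 'k) arrow" where
  "yd_tensor_arrow X f g =
     (let S = yd_tensor X (dom_of f) (dom_of g) in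
      Arrow S (yd_tensor X (cod_of f) (cod_of g))
        (\<lambda>t\<in>carrier (yspace S).
           tensor_map (ground X) (yspace (cod_of f)) (yspace (cod_of g)) (fun_of f) (fun_of g) t))"

definition yd_assoc ::
    "('a, 'k) xmod \<Rightarrow> ('a, 'k) yd \<Rightarrow> ('a, 'k) yd \<Rightarrow> ('a, 'k) yd \<Rightarrow> ('a, 'k) arrow" where
  "yd_assoc X M M' M'' =
     (let K = ground X; V = yspace M; V' = yspace M'; V'' = yspace M'';
          S = yd_tensor X (yd_tensor X M M') M'';
          T = yd_tensor X M (yd_tensor X M' M'') in
      Arrow S T
        (\<lambda>t\<in>carrier (yspace S).
          sweedler (yspace T) t (\<lambda>s m''.
            sweedler (yspace T) s (\<lambda>m m'.
              sweedler (yspace T) (ycoact M'' m'') (\<lambda>m0'' m1''.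
                pure_tensor K V (tensor_space K V' V'')
                  (yact M m (pi_plus X m1''))
                  (pure_tensor K V' V'' m' m0''))))))"

definition yd_unit :: "('a, 'k) xmod \<Rightarrow> ('a, 'k) yd" where
  "yd_unit X =
     (let V = scalar_space (ground X) in
      \<lparr>yspace = V,
       yact = (\<lambda>c\<in>carrier V. \<lambda>g\<in>carrier (gplus X). plus_counit g \<odot>\<^bsub>V\<^esub> c),
       ycoact = (\<lambda>c\<in>carrier V. pure_tensor (ground X) V (kplus X) c (kone X))\<rparr>)"

text \<open>
  Strictness of the unit means that the right unitor is the canonical identification of vector
  spaces \<open>M \<otimes> \<k> = M\<close>, \<open>m \<otimes> c = c m\<close>.
\<close>

definition yd_right_unitor :: "('a, 'k) xmod \<Rightarrow> ('a, 'k) yd \<Rightarrow> ('a, 'k) arrow" where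
  "yd_right_unitor X M =
     (let S = yd_tensor X M (yd_unit X) in
      Arrow S M
        (\<lambda>t\<in>carrier (yspace S). sweedler (yspace M) t (\<lambda>m c. scalar_of c \<odot>\<^bsub>yspace M\<^esub> m)))"

section \<open>Representations of a crossed module\<close>

record ('a, 'k) rep =
  rspace :: "('a, 'k) vect"
  ract :: "('a, 'k) binop"
  rcoact :: "('a, 'k) endo"

definition representation :: "('a, 'k) xmod \<Rightarrow> ('a, 'k) rep \<Rightarrow> bool" where
  "representation X R \<longleftrightarrow>
     (let K = ground X; V = rspace R; k = space (kk X); Vk = tensor_space K V k in
      module K V \<and> leibniz_action K (gg X) V (ract R) \<and>
      linear_map K V Vk (rcoact R) \<and>
      (\<forall>m\<in>carrier V. tensor_map K Vk k (rcoact R) id (rcoact R m) = \<zero>\<^bsub>tensor_space K Vk k\<^esub>) \<and>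
      (\<forall>m\<in>carrier V. \<forall>g\<in>carrier (space (gg X)).
         rcoact R (ract R m g) =
         sweedler Vk (rcoact R m) (\<lambda>m0 m1.
           pure_tensor K V k m0 (xact X m1 g) \<oplus>\<^bsub>Vk\<^esub> pure_tensor K V k (ract R m0 g) m1)))"

definition rep_hom ::
    "('a, 'k) xmod \<Rightarrow> ('a, 'k) rep \<Rightarrow> ('a, 'k) rep \<Rightarrow> ('a, 'k) endo \<Rightarrow> bool" where
  "rep_hom X R S f \<longleftrightarrow>
     linear_map (ground X) (rspace R) (rspace S) f \<and>
     f \<in> extensional (carrier (rspace R)) \<and>
     (\<forall>m\<in>carrier (rspace R). \<forall>g\<in>carrier (space (gg X)). f (ract R m g) = ract S (f m) g) \<and>
     (\<forall>m\<in>carrier (rspace R).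
        rcoact S (f m) = tensor_map (ground X) (rspace S) (space (kk X)) f id (rcoact R m))"

definition rep_inclusion :: "('a, 'k) xmod \<Rightarrow> ('a, 'k) rep \<Rightarrow> ('a, 'k) yd" where
  "rep_inclusion X R =
     (let K = ground X; V = rspace R; P = kplus X; VP = tensor_space K V P in
      \<lparr>yspace = V,
       yact = (\<lambda>m\<in>carrier V. \<lambda>p\<in>carrier (gplus X).
         ract R m (alg_part p) \<oplus>\<^bsub>V\<^esub> (unit_part p \<odot>\<^bsub>V\<^esub> m)),
       ycoact = (\<lambda>m\<in>carrier V.
         tensor_map K V P id (plus_embed K) (rcoact R m) \<oplus>\<^bsub>VP\<^esub> pure_tensor K V P m (kone X))\<rparr>)"

text \<open>The category of representations, viewed inside the Yetter-Drinfel'd modules.\<close>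

definition rep_category :: "('a, 'k) xmod \<Rightarrow> (('a, 'k) yd, ('a, 'k) arrow) category" where
  "rep_category X =
     \<lparr>obj = {rep_inclusion X R | R. representation X R},
      arr = {Arrow (rep_inclusion X R) (rep_inclusion X S) f | R S f.
               representation X R \<and> representation X S \<and> rep_hom X R S f},
      src = dom_of, tgt = cod_of, ident = yd_ident, comp = yd_comp\<rparr>"

end

theory Submission
  imports Defs
begin

text \<open>
  The idea is to split the coaction. Since \<open>\<kk>\<^sup>+ = \<kk> \<oplus> K1\<close>, a linear map \<open>\<delta>: M \<rightarrow> M \<otimes> \<kk>\<^sup>+\<close> is the same as
  a pair \<open>\<delta>\<^sub>0: M \<rightarrow> M \<otimes> \<kk>\<close>, \<open>p: M \<rightarrow> M\<close> with \<open>\<delta> m = \<delta>\<^sub>0 m + p m \<otimes> 1\<close>. On modules on which \<open>1\<close> acts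
  as the identity, the three Yetter-Drinfel'd axioms become: \<open>\<gg>\<close> acts by a Leibniz action; \<open>\<delta>\<^sub>0\<close> and
  \<open>p\<close> are \<open>\<gg>\<close>-equivariant; \<open>(\<delta>\<^sub>0 \<otimes> id) \<delta>\<^sub>0 = 0\<close>; and \<open>\<delta>\<^sub>0 p = (p \<otimes> id) \<delta>\<^sub>0\<close>
  (\<open>action_axiom_iff\<close>, \<open>compatibility_iff\<close>, \<open>coaction_axiom_iff\<close>). Representations of the crossed
  module are the case \<open>p = id\<close>. Write \<open>m\<^sub>0 \<otimes> m\<^sub>1\<close> for \<open>\<delta>\<^sub>0 m\<close>. In these terms the tensor product has
  \<open>p (m \<otimes> m') = p m \<otimes> p m'\<close> and
  \<open>\<delta>\<^sub>0 (m \<otimes> m') = m\<^sub>0 \<otimes> p m' \<otimes> m\<^sub>1 + m\<^sub>0 \<otimes> m'\<^sub>0 \<otimes> [m\<^sub>1, m'\<^sub>1]\<close>, and the associator is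
  \<open>\<alpha> ((m \<otimes> m') \<otimes> m'') = m \<otimes> (m' \<otimes> p m'') + (m * \<pi> m''\<^sub>1) \<otimes> (m' \<otimes> m''\<^sub>0)\<close>.

  All claims are now identities between linear maps on iterated tensor products, so it suffices to
  check them on pure tensors, and there each has one reason. The associator is \<open>\<gg>\<close>-equivariant by the
  action identity and \<open>\<pi> (k \<cdot> g) = [\<pi> k, g]\<close>; it respects the coactions by the Leibniz identity
  of \<open>\<kk>\<close> and \<open>k \<cdot> \<pi> k' = [k, k']\<close>. The two sides of the pentagon differ by the action identity
  \<open>(u * \<pi> l) * \<pi> k = (u * \<pi> k) * \<pi> l + u * [\<pi> l, \<pi> k]\<close>. In both cases the terms that
  apply \<open>\<delta>\<^sub>0\<close> twice to the last factor vanish. For \<open>p = id\<close> the associator is the flat rebracketing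
  plus a map of square zero, again because \<open>(\<delta>\<^sub>0 \<otimes> id) \<delta>\<^sub>0 = 0\<close>, so changing the sign of the second
  summand gives its inverse. If \<open>p\<close> and \<open>\<delta>\<^sub>0\<close> both vanish on the last factor, then so does the associator,
  which is why invertibility is claimed for representations only. On the unit object \<open>\<delta>\<^sub>0 = 0\<close> and \<open>p = id\<close>, which makes the flat
  identification \<open>M \<otimes> K = M\<close> a natural isomorphism compatible with \<open>\<alpha>\<close>.

  Elements of a tensor product are classes of lists of pairs, hence a Sweedler expression is a finite
  sum over such a list. Every expression is brought to a normal form, a sum of nested Sweedler sums
  of pure tensors, by moving linear maps into the sums; the remaining identities are then rewriting
  modulo associativity and commutativity.
\<close>

section \<open>Vector spaces\<close>

locale tensors = cring K for K :: "'k ring" (structure)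
begin

abbreviation vs :: "('a, 'k) vect \<Rightarrow> bool" where "vs V \<equiv> module K V"
abbreviation tens :: "('a, 'k) vect \<Rightarrow> ('a, 'k) vect \<Rightarrow> ('a, 'k) vect" (infixr \<open>\<otimes>\<^sub>s\<close> 71)
  where "V \<otimes>\<^sub>s W \<equiv> tensor_space K V W"
abbreviation lin where "lin \<equiv> linear_map K"
abbreviation bil where "bil \<equiv> bilinear_map K"
abbreviation pt where "pt \<equiv> pure_tensor K"

lemma vs_simps [simp]:
  assumes "vs Z"
  shows "\<zero>\<^bsub>Z\<^esub> \<in> carrier Z"
    "x \<in> carrier Z \<Longrightarrow> y \<in> carrier Z \<Longrightarrow> x \<oplus>\<^bsub>Z\<^esub> y \<in> carrier Z"
    "x \<in> carrier Z \<Longrightarrow> \<zero>\<^bsub>Z\<^esub> \<oplus>\<^bsub>Z\<^esub> x = x"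
    "x \<in> carrier Z \<Longrightarrow> x \<oplus>\<^bsub>Z\<^esub> \<zero>\<^bsub>Z\<^esub> = x"
    "x \<in> carrier Z \<Longrightarrow> \<ominus>\<^bsub>Z\<^esub> x \<in> carrier Z"
    "x \<in> carrier Z \<Longrightarrow> y \<in> carrier Z \<Longrightarrow> x \<ominus>\<^bsub>Z\<^esub> y \<in> carrier Z"
    "x \<in> carrier Z \<Longrightarrow> x \<oplus>\<^bsub>Z\<^esub> \<ominus>\<^bsub>Z\<^esub> x = \<zero>\<^bsub>Z\<^esub>"
    "x \<in> carrier Z \<Longrightarrow> \<ominus>\<^bsub>Z\<^esub> x \<oplus>\<^bsub>Z\<^esub> x = \<zero>\<^bsub>Z\<^esub>"
    "a \<in> carrier K \<Longrightarrow> x \<in> carrier Z \<Longrightarrow> a \<odot>\<^bsub>Z\<^esub> x \<in> carrier Z"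
    "x \<in> carrier Z \<Longrightarrow> \<one> \<odot>\<^bsub>Z\<^esub> x = x"
    "x \<in> carrier Z \<Longrightarrow> \<zero> \<odot>\<^bsub>Z\<^esub> x = \<zero>\<^bsub>Z\<^esub>"
    "a \<in> carrier K \<Longrightarrow> a \<odot>\<^bsub>Z\<^esub> \<zero>\<^bsub>Z\<^esub> = \<zero>\<^bsub>Z\<^esub>"
    "\<ominus>\<^bsub>Z\<^esub> \<zero>\<^bsub>Z\<^esub> = \<zero>\<^bsub>Z\<^esub>"
proof -
  interpret module K Z by fact
  show "\<zero>\<^bsub>Z\<^esub> \<in> carrier Z"
    "x \<in> carrier Z \<Longrightarrow> y \<in> carrier Z \<Longrightarrow> x \<oplus>\<^bsub>Z\<^esub> y \<in> carrier Z"
    "x \<in> carrier Z \<Longrightarrow> \<zero>\<^bsub>Z\<^esub> \<oplus>\<^bsub>Z\<^esub> x = x"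
    "x \<in> carrier Z \<Longrightarrow> x \<oplus>\<^bsub>Z\<^esub> \<zero>\<^bsub>Z\<^esub> = x"
    "x \<in> carrier Z \<Longrightarrow> \<ominus>\<^bsub>Z\<^esub> x \<in> carrier Z"
    "x \<in> carrier Z \<Longrightarrow> y \<in> carrier Z \<Longrightarrow> x \<ominus>\<^bsub>Z\<^esub> y \<in> carrier Z"
    "x \<in> carrier Z \<Longrightarrow> x \<oplus>\<^bsub>Z\<^esub> \<ominus>\<^bsub>Z\<^esub> x = \<zero>\<^bsub>Z\<^esub>"
    "x \<in> carrier Z \<Longrightarrow> \<ominus>\<^bsub>Z\<^esub> x \<oplus>\<^bsub>Z\<^esub> x = \<zero>\<^bsub>Z\<^esub>"
    "a \<in> carrier K \<Longrightarrow> x \<in> carrier Z \<Longrightarrow> a \<odot>\<^bsub>Z\<^esub> x \<in> carrier Z"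
    "x \<in> carrier Z \<Longrightarrow> \<one> \<odot>\<^bsub>Z\<^esub> x = x"
    "x \<in> carrier Z \<Longrightarrow> \<zero> \<odot>\<^bsub>Z\<^esub> x = \<zero>\<^bsub>Z\<^esub>"
    "a \<in> carrier K \<Longrightarrow> a \<odot>\<^bsub>Z\<^esub> \<zero>\<^bsub>Z\<^esub> = \<zero>\<^bsub>Z\<^esub>"
    "\<ominus>\<^bsub>Z\<^esub> \<zero>\<^bsub>Z\<^esub> = \<zero>\<^bsub>Z\<^esub>"
    by (auto simp: M.r_neg M.l_neg)
qed

lemma vs_ac:
  assumes "vs Z" "x \<in> carrier Z" "y \<in> carrier Z"
  shows "x \<oplus>\<^bsub>Z\<^esub> y = y \<oplus>\<^bsub>Z\<^esub> x"
    "z \<in> carrier Z \<Longrightarrow> (x \<oplus>\<^bsub>Z\<^esub> y) \<oplus>\<^bsub>Z\<^esub> z = x \<oplus>\<^bsub>Z\<^esub> (y \<oplus>\<^bsub>Z\<^esub> z)"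
    "z \<in> carrier Z \<Longrightarrow> x \<oplus>\<^bsub>Z\<^esub> (y \<oplus>\<^bsub>Z\<^esub> z) = y \<oplus>\<^bsub>Z\<^esub> (x \<oplus>\<^bsub>Z\<^esub> z)"
proof -
  interpret module K Z by fact
  show "x \<oplus>\<^bsub>Z\<^esub> y = y \<oplus>\<^bsub>Z\<^esub> x"
    "z \<in> carrier Z \<Longrightarrow> (x \<oplus>\<^bsub>Z\<^esub> y) \<oplus>\<^bsub>Z\<^esub> z = x \<oplus>\<^bsub>Z\<^esub> (y \<oplus>\<^bsub>Z\<^esub> z)"
    "z \<in> carrier Z \<Longrightarrow> x \<oplus>\<^bsub>Z\<^esub> (y \<oplus>\<^bsub>Z\<^esub> z) = y \<oplus>\<^bsub>Z\<^esub> (x \<oplus>\<^bsub>Z\<^esub> z)"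
    using assms(2,3) by (auto simp: a_ac)
qed

lemma vs_distr:
  assumes "vs Z" "a \<in> carrier K" "x \<in> carrier Z"
  shows "y \<in> carrier Z \<Longrightarrow> a \<odot>\<^bsub>Z\<^esub> (x \<oplus>\<^bsub>Z\<^esub> y) = a \<odot>\<^bsub>Z\<^esub> x \<oplus>\<^bsub>Z\<^esub> a \<odot>\<^bsub>Z\<^esub> y"
    "b \<in> carrier K \<Longrightarrow> (a \<oplus> b) \<odot>\<^bsub>Z\<^esub> x = a \<odot>\<^bsub>Z\<^esub> x \<oplus>\<^bsub>Z\<^esub> b \<odot>\<^bsub>Z\<^esub> x"
    "b \<in> carrier K \<Longrightarrow> (a \<otimes> b) \<odot>\<^bsub>Z\<^esub> x = a \<odot>\<^bsub>Z\<^esub> (b \<odot>\<^bsub>Z\<^esub> x)"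
    "b \<in> carrier K \<Longrightarrow> b \<odot>\<^bsub>Z\<^esub> (a \<odot>\<^bsub>Z\<^esub> x) = a \<odot>\<^bsub>Z\<^esub> (b \<odot>\<^bsub>Z\<^esub> x)"
proof -
  interpret module K Z by fact
  show "y \<in> carrier Z \<Longrightarrow> a \<odot>\<^bsub>Z\<^esub> (x \<oplus>\<^bsub>Z\<^esub> y) = a \<odot>\<^bsub>Z\<^esub> x \<oplus>\<^bsub>Z\<^esub> a \<odot>\<^bsub>Z\<^esub> y"
    "b \<in> carrier K \<Longrightarrow> (a \<oplus> b) \<odot>\<^bsub>Z\<^esub> x = a \<odot>\<^bsub>Z\<^esub> x \<oplus>\<^bsub>Z\<^esub> b \<odot>\<^bsub>Z\<^esub> x"
    "b \<in> carrier K \<Longrightarrow> (a \<otimes> b) \<odot>\<^bsub>Z\<^esub> x = a \<odot>\<^bsub>Z\<^esub> (b \<odot>\<^bsub>Z\<^esub> x)"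
    "b \<in> carrier K \<Longrightarrow> b \<odot>\<^bsub>Z\<^esub> (a \<odot>\<^bsub>Z\<^esub> x) = a \<odot>\<^bsub>Z\<^esub> (b \<odot>\<^bsub>Z\<^esub> x)"
    using assms(2,3) by (simp_all add: smult_r_distr smult_l_distr m_comm flip: smult_assoc1)
qed

lemma vs_diff_eq:
  assumes "vs Z" "a \<in> carrier Z" "b \<in> carrier Z" "c \<in> carrier Z"
  shows "c = a \<ominus>\<^bsub>Z\<^esub> b \<longleftrightarrow> a = b \<oplus>\<^bsub>Z\<^esub> c"
proof -
  interpret module K Z by fact
  have "b \<oplus>\<^bsub>Z\<^esub> (a \<ominus>\<^bsub>Z\<^esub> b) = a" "(b \<oplus>\<^bsub>Z\<^esub> c) \<ominus>\<^bsub>Z\<^esub> b = c"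
    using assms by (simp_all add: M.minus_eq M.a_lcomm[of b a] M.a_comm[of b c] M.a_assoc M.r_neg)
  then show ?thesis by metis
qed

section \<open>Linear and bilinear maps\<close>

lemma linI:
  assumes "\<And>x. x \<in> carrier V \<Longrightarrow> f x \<in> carrier W"
    "\<And>x y. x \<in> carrier V \<Longrightarrow> y \<in> carrier V \<Longrightarrow> f (x \<oplus>\<^bsub>V\<^esub> y) = f x \<oplus>\<^bsub>W\<^esub> f y"
    "\<And>a x. a \<in> carrier K \<Longrightarrow> x \<in> carrier V \<Longrightarrow> f (a \<odot>\<^bsub>V\<^esub> x) = a \<odot>\<^bsub>W\<^esub> f x"
  shows "lin V W f"
  using assms by (auto simp: linear_map_def)

lemma linD:
  assumes "lin V W f"
  shows "x \<in> carrier V \<Longrightarrow> f x \<in> carrier W"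
    "x \<in> carrier V \<Longrightarrow> y \<in> carrier V \<Longrightarrow> f (x \<oplus>\<^bsub>V\<^esub> y) = f x \<oplus>\<^bsub>W\<^esub> f y"
    "a \<in> carrier K \<Longrightarrow> x \<in> carrier V \<Longrightarrow> f (a \<odot>\<^bsub>V\<^esub> x) = a \<odot>\<^bsub>W\<^esub> f x"
  using assms by (auto simp: linear_map_def)

lemma lin_zero:
  assumes "lin V W f" "vs V" "vs W"
  shows "f \<zero>\<^bsub>V\<^esub> = \<zero>\<^bsub>W\<^esub>"
proof -
  have "f (\<zero> \<odot>\<^bsub>V\<^esub> \<zero>\<^bsub>V\<^esub>) = \<zero> \<odot>\<^bsub>W\<^esub> f \<zero>\<^bsub>V\<^esub>"
    using assms by (intro linD(3)[OF assms(1)]) auto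
  with assms linD(1)[OF assms(1)] show ?thesis by simp
qed

lemma neg_smult: "vs V \<Longrightarrow> x \<in> carrier V \<Longrightarrow> \<ominus>\<^bsub>V\<^esub> x = (\<ominus> \<one>) \<odot>\<^bsub>V\<^esub> x"
  by (simp add: module.smult_l_minus)

lemma bilI:
  assumes "\<And>x. x \<in> carrier V \<Longrightarrow> lin W Z (b x)" "\<And>y. y \<in> carrier W \<Longrightarrow> lin V Z (\<lambda>x. b x y)"
  shows "bil V W Z b"
  using assms by (auto simp: bilinear_map_def)

lemma bilD:
  assumes "bil V W Z b"
  shows "x \<in> carrier V \<Longrightarrow> lin W Z (b x)" "y \<in> carrier W \<Longrightarrow> lin V Z (\<lambda>x. b x y)"
  using assms by (auto simp: bilinear_map_def)

section \<open>Tensor products as vector spaces\<close>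

lemma tensor_eq_carrier:
  assumes "vs V" "vs W" "tensor_eq K V W r s"
  shows "set r \<subseteq> carrier V \<times> carrier W \<and> set s \<subseteq> carrier V \<times> carrier W"
  using assms(3) by induction (use assms(1,2) in auto)

text \<open>
  The relation is generated by appending on the right only; commutativity supplies the other side,
  so that concatenation is well defined on classes.
\<close>

lemma tensor_eq_append:
  assumes V: "vs V" and W: "vs W" and rr: "tensor_eq K V W r r'" and ss: "tensor_eq K V W s s'"
  shows "tensor_eq K V W (r @ s) (r' @ s')"
proof -
  note c = tensor_eq_carrier[OF V W]
  have 1: "tensor_eq K V W (r @ s) (r' @ s)" using rr c[OF ss] by (auto intro: tensor_eq.cong)
  have 2: "tensor_eq K V W (r' @ s) (s @ r')" using c[OF rr] c[OF ss] by (auto intro: tensor_eq.comm)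
  have 3: "tensor_eq K V W (s @ r') (s' @ r')" using ss c[OF rr] by (auto intro: tensor_eq.cong)
  have 4: "tensor_eq K V W (s' @ r') (r' @ s')" using c[OF rr] c[OF ss] by (auto intro: tensor_eq.comm)
  show ?thesis by (rule tensor_eq.trans[OF 1 tensor_eq.trans[OF 2 tensor_eq.trans[OF 3 4]]])
qed

lemma smult_terms_carrier:
  assumes "vs V" "a \<in> carrier K" "set r \<subseteq> carrier V \<times> carrier W"
  shows "set (map (\<lambda>(x, y). (a \<odot>\<^bsub>V\<^esub> x, y)) r) \<subseteq> carrier V \<times> carrier W"
  using assms by (auto dest!: subsetD)

lemma tensor_eq_smult:
  assumes V: "vs V" and W: "vs W" and a: "a \<in> carrier K" and "tensor_eq K V W r s"
  shows "tensor_eq K V W (map (\<lambda>(x, y). (a \<odot>\<^bsub>V\<^esub> x, y)) r) (map (\<lambda>(x, y). (a \<odot>\<^bsub>V\<^esub> x, y)) s)"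
  using assms(4)
proof induction
  case (refl r)
  then show ?case using smult_terms_carrier[OF V a] by (intro tensor_eq.refl)
next
  case (cong r s t)
  then show ?case using smult_terms_carrier[OF V a] unfolding map_append by (intro tensor_eq.cong)
next
  case (comm r s)
  then show ?case using smult_terms_carrier[OF V a] unfolding map_append by (intro tensor_eq.comm)
next
  case (balanced b x y)
  have "tensor_eq K V W [(b \<odot>\<^bsub>V\<^esub> (a \<odot>\<^bsub>V\<^esub> x), y)] [(a \<odot>\<^bsub>V\<^esub> x, b \<odot>\<^bsub>W\<^esub> y)]"
    using balanced V a by (intro tensor_eq.balanced) auto
  then show ?case using balanced V a by (simp add: vs_distr(4)[of V a x b])
next
  case (trans r s t)
  then show ?case by (blast intro: tensor_eq.trans)
next
  case (sym r s)
  then show ?case by (blast intro: tensor_eq.sym)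
qed (use V W a in \<open>auto simp: vs_distr intro!: tensor_eq.zero tensor_eq.add_left tensor_eq.add_right\<close>)

abbreviation cls where "cls \<equiv> tensor_class K"

lemma tensor_eq_rep:
  assumes "set r \<subseteq> carrier V \<times> carrier W"
  shows "tensor_eq K V W r (terms_of (cls V W r))"
  using someI[of "tensor_eq K V W r" r] tensor_eq.refl[OF assms] by (simp add: tensor_class_def)

lemma cls_eqI:
  assumes "tensor_eq K V W r s"
  shows "cls V W r = cls V W s"
proof -
  have "tensor_eq K V W r = tensor_eq K V W s"
    using assms by (blast intro: tensor_eq.sym tensor_eq.trans)
  then show ?thesis by (simp add: tensor_class_def)
qed

lemma tensor_carrierE:
  assumes "t \<in> carrier (V \<otimes>\<^sub>s W)"
  obtains r where "set r \<subseteq> carrier V \<times> carrier W" "t = cls V W r"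
  using assms by (auto simp: tensor_space_def lists_eq_set)

lemma cls_carrier:
  "set r \<subseteq> carrier V \<times> carrier W \<Longrightarrow> cls V W r \<in> carrier (V \<otimes>\<^sub>s W)"
  by (auto simp: tensor_space_def lists_eq_set)

lemma tensor_zero: "\<zero>\<^bsub>V \<otimes>\<^sub>s W\<^esub> = cls V W []"
  by (simp add: tensor_space_def)

lemma cls_add:
  assumes "vs V" "vs W" "set r \<subseteq> carrier V \<times> carrier W" "set s \<subseteq> carrier V \<times> carrier W"
  shows "cls V W r \<oplus>\<^bsub>V \<otimes>\<^sub>s W\<^esub> cls V W s = cls V W (r @ s)"
  using tensor_eq_append[OF assms(1,2) tensor_eq_rep[OF assms(3)] tensor_eq_rep[OF assms(4)]]
  by (simp add: tensor_space_def cls_eqI)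

lemma cls_smult:
  assumes "vs V" "vs W" "a \<in> carrier K" "set r \<subseteq> carrier V \<times> carrier W"
  shows "a \<odot>\<^bsub>V \<otimes>\<^sub>s W\<^esub> cls V W r = cls V W (map (\<lambda>(x, y). (a \<odot>\<^bsub>V\<^esub> x, y)) r)"
  using tensor_eq_smult[OF assms(1,2,3) tensor_eq_rep[OF assms(4)]]
  by (simp add: tensor_space_def cls_eqI)

text \<open>
  The scalar acts on the left entries term by term, so distributivity over scalar addition holds only
  up to sorting the two kinds of terms.
\<close>

lemma tensor_eq_smult_sum:
  assumes V: "vs V" and W: "vs W" and a: "a \<in> carrier K" and b: "b \<in> carrier K"
    and "set r \<subseteq> carrier V \<times> carrier W"
  shows "tensor_eq K V W (map (\<lambda>(x, y). ((a \<oplus> b) \<odot>\<^bsub>V\<^esub> x, y)) r)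
    (map (\<lambda>(x, y). (a \<odot>\<^bsub>V\<^esub> x, y)) r @ map (\<lambda>(x, y). (b \<odot>\<^bsub>V\<^esub> x, y)) r)"
  using assms(5)
proof (induction r)
  case Nil
  then show ?case by (auto intro: tensor_eq.refl)
next
  case (Cons p r)
  obtain x y where p: "p = (x, y)" "x \<in> carrier V" "y \<in> carrier W" using Cons.prems by auto
  let ?A = "map (\<lambda>(x, y). (a \<odot>\<^bsub>V\<^esub> x, y)) r" and ?B = "map (\<lambda>(x, y). (b \<odot>\<^bsub>V\<^esub> x, y)) r"
  have c: "set ?A \<subseteq> carrier V \<times> carrier W" "set ?B \<subseteq> carrier V \<times> carrier W"
    using Cons.prems V a b by auto
  have ab: "a \<odot>\<^bsub>V\<^esub> x \<in> carrier V" "b \<odot>\<^bsub>V\<^esub> x \<in> carrier V" using p V a b by auto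
  have 1: "tensor_eq K V W ([((a \<oplus> b) \<odot>\<^bsub>V\<^esub> x, y)] @ map (\<lambda>(x, y). ((a \<oplus> b) \<odot>\<^bsub>V\<^esub> x, y)) r)
     ([(a \<odot>\<^bsub>V\<^esub> x, y), (b \<odot>\<^bsub>V\<^esub> x, y)] @ ?A @ ?B)"
    using Cons.IH Cons.prems p V a b ab
    by (intro tensor_eq_append[OF V W]) (auto simp: vs_distr intro: tensor_eq.add_left)
  have "tensor_eq K V W ([(a \<odot>\<^bsub>V\<^esub> x, y)] @ (([(b \<odot>\<^bsub>V\<^esub> x, y)] @ ?A) @ ?B))
     ([(a \<odot>\<^bsub>V\<^esub> x, y)] @ ((?A @ [(b \<odot>\<^bsub>V\<^esub> x, y)]) @ ?B))"
    using c p ab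
    by (intro tensor_eq_append[OF V W] tensor_eq.comm tensor_eq.refl) auto
  then show ?case using tensor_eq.trans[OF 1] by (simp add: p(1))
qed

lemma tensor_eq_smult_zero:
  assumes V: "vs V" and W: "vs W" and "set r \<subseteq> carrier V \<times> carrier W"
  shows "tensor_eq K V W (map (\<lambda>(x, y). (\<zero> \<odot>\<^bsub>V\<^esub> x, y)) r) []"
  using assms(3)
proof (induction r)
  case Nil
  then show ?case by (auto intro: tensor_eq.refl)
next
  case (Cons p r)
  obtain x y where p: "p = (x, y)" "x \<in> carrier V" "y \<in> carrier W" using Cons.prems by auto
  have "tensor_eq K V W ([(\<zero>\<^bsub>V\<^esub>, y)] @ map (\<lambda>(x, y). (\<zero> \<odot>\<^bsub>V\<^esub> x, y)) r) ([] @ [])"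
    using Cons p by (intro tensor_eq_append[OF V W] tensor_eq.zero) auto
  then show ?case using p V by simp
qed

lemma cls_smult_one:
  assumes "vs V" "set r \<subseteq> carrier V \<times> carrier W"
  shows "map (\<lambda>(x, y). (\<one> \<odot>\<^bsub>V\<^esub> x, y)) r = r"
  using assms by (auto intro!: map_idI)

lemma vs_tensor [simp]:
  assumes V: "vs V" and W: "vs W"
  shows "vs (V \<otimes>\<^sub>s W)"
proof -
  let ?T = "V \<otimes>\<^sub>s W"
  note s = cls_add[OF V W] cls_smult[OF V W] cls_carrier
  have neg: "(\<ominus> \<one>) \<odot>\<^bsub>?T\<^esub> x \<oplus>\<^bsub>?T\<^esub> x = \<zero>\<^bsub>?T\<^esub>" if x: "x \<in> carrier ?T" for x
  proof -
    obtain r where r: "set r \<subseteq> carrier V \<times> carrier W" "x = cls V W r"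
      using x by (elim tensor_carrierE)
    have "cls V W (map (\<lambda>(x, y). (\<ominus> \<one> \<odot>\<^bsub>V\<^esub> x, y)) r @ map (\<lambda>(x, y). (\<one> \<odot>\<^bsub>V\<^esub> x, y)) r)
      = cls V W (map (\<lambda>(x, y). ((\<ominus> \<one> \<oplus> \<one>) \<odot>\<^bsub>V\<^esub> x, y)) r)"
      by (rule cls_eqI[OF tensor_eq.sym, OF tensor_eq_smult_sum[OF V W]]) (use r in auto)
    also have "\<dots> = cls V W []"
      using cls_eqI[OF tensor_eq_smult_zero[OF V W r(1)]] by (simp add: l_neg)
    finally show ?thesis
      using r cls_smult_one[OF V r(1)] smult_terms_carrier[OF V _ r(1), of "\<ominus> \<one>"]
      by (simp add: s tensor_zero)
  qed
  show ?thesis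
  proof (rule moduleI)
  show "abelian_group ?T"
  proof (rule abelian_groupI)
    fix x assume x: "x \<in> carrier ?T"
    then obtain r where r: "set r \<subseteq> carrier V \<times> carrier W" "x = cls V W r" by (elim tensor_carrierE)
    have "(\<ominus> \<one>) \<odot>\<^bsub>?T\<^esub> x \<in> carrier ?T"
      using r V by (simp add: s smult_terms_carrier del: set_map)
    with neg[OF x] show "\<exists>y\<in>carrier ?T. y \<oplus>\<^bsub>?T\<^esub> x = \<zero>\<^bsub>?T\<^esub>" by blast
  next
    fix x y assume "x \<in> carrier ?T" "y \<in> carrier ?T"
    then show "x \<oplus>\<^bsub>?T\<^esub> y = y \<oplus>\<^bsub>?T\<^esub> x"
      by (elim tensor_carrierE) (auto simp: s intro!: cls_eqI tensor_eq.comm)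
  qed (auto elim!: tensor_carrierE simp: s tensor_zero)
next
  fix a x assume a: "a \<in> carrier K" and "x \<in> carrier ?T"
  then obtain r where r: "set r \<subseteq> carrier V \<times> carrier W" "x = cls V W r" by (elim tensor_carrierE)
  note c = smult_terms_carrier[OF V a r(1)]
  show "a \<odot>\<^bsub>?T\<^esub> x \<in> carrier ?T" using r c a by (simp add: s del: set_map)
  fix y assume "y \<in> carrier ?T"
  then obtain r' where r': "set r' \<subseteq> carrier V \<times> carrier W" "y = cls V W r'" by (elim tensor_carrierE)
  show "a \<odot>\<^bsub>?T\<^esub> (x \<oplus>\<^bsub>?T\<^esub> y) = a \<odot>\<^bsub>?T\<^esub> x \<oplus>\<^bsub>?T\<^esub> a \<odot>\<^bsub>?T\<^esub> y"
    using r r' c a smult_terms_carrier[OF V a r'(1)] by (simp add: s del: set_map)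
next
  fix a b x assume a: "a \<in> carrier K" and b: "b \<in> carrier K" and "x \<in> carrier ?T"
  then obtain r where r: "set r \<subseteq> carrier V \<times> carrier W" "x = cls V W r" by (elim tensor_carrierE)
  note c = smult_terms_carrier[OF V a r(1)] smult_terms_carrier[OF V b r(1)]
  show "(a \<oplus> b) \<odot>\<^bsub>?T\<^esub> x = a \<odot>\<^bsub>?T\<^esub> x \<oplus>\<^bsub>?T\<^esub> b \<odot>\<^bsub>?T\<^esub> x"
    using r c a b cls_eqI[OF tensor_eq_smult_sum[OF V W a b r(1)]] by (simp add: s del: set_map)
  have "map (\<lambda>(x, y). ((a \<otimes> b) \<odot>\<^bsub>V\<^esub> x, y)) r =
    map (\<lambda>(x, y). (a \<odot>\<^bsub>V\<^esub> x, y)) (map (\<lambda>(x, y). (b \<odot>\<^bsub>V\<^esub> x, y)) r)"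
    using r(1) V a b by (auto simp: vs_distr)
  then show "(a \<otimes> b) \<odot>\<^bsub>?T\<^esub> x = a \<odot>\<^bsub>?T\<^esub> (b \<odot>\<^bsub>?T\<^esub> x)"
    using r c a b by (simp add: s del: set_map map_map)
next
  fix x assume "x \<in> carrier ?T"
  then obtain r where r: "set r \<subseteq> carrier V \<times> carrier W" "x = cls V W r" by (elim tensor_carrierE)
  show "\<one> \<odot>\<^bsub>?T\<^esub> x = x" using r cls_smult_one[OF V r(1)] by (simp add: s)
qed (rule is_cring)
qed

lemma pt_closed [simp]:
  "x \<in> carrier V \<Longrightarrow> y \<in> carrier W \<Longrightarrow> pt V W x y \<in> carrier (V \<otimes>\<^sub>s W)"
  by (auto simp: pure_tensor_def intro!: cls_carrier)

lemma pt_bil: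
  assumes V: "vs V" and W: "vs W"
  shows "bil V W (V \<otimes>\<^sub>s W) (pt V W)"
proof (intro bilI linI)
  fix x y y' assume *: "x \<in> carrier V" "y \<in> carrier W" "y' \<in> carrier W"
  show "pt V W x (y \<oplus>\<^bsub>W\<^esub> y') = pt V W x y \<oplus>\<^bsub>V \<otimes>\<^sub>s W\<^esub> pt V W x y'"
    using * V W by (auto simp: pure_tensor_def cls_add intro!: cls_eqI tensor_eq.add_right)
next
  fix x y a assume *: "x \<in> carrier V" "a \<in> carrier K" "y \<in> carrier W"
  show "pt V W x (a \<odot>\<^bsub>W\<^esub> y) = a \<odot>\<^bsub>V \<otimes>\<^sub>s W\<^esub> pt V W x y"
    using * V W by (auto simp: pure_tensor_def cls_smult intro!: cls_eqI tensor_eq.sym[OF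
        tensor_eq.balanced])
next
  fix x x' y assume *: "y \<in> carrier W" "x \<in> carrier V" "x' \<in> carrier V"
  show "pt V W (x \<oplus>\<^bsub>V\<^esub> x') y = pt V W x y \<oplus>\<^bsub>V \<otimes>\<^sub>s W\<^esub> pt V W x' y"
    using * V W by (auto simp: pure_tensor_def cls_add intro!: cls_eqI tensor_eq.add_left)
next
  fix x y a assume *: "y \<in> carrier W" "a \<in> carrier K" "x \<in> carrier V"
  show "pt V W (a \<odot>\<^bsub>V\<^esub> x) y = a \<odot>\<^bsub>V \<otimes>\<^sub>s W\<^esub> pt V W x y"
    using * V W by (auto simp: pure_tensor_def cls_smult)
qed auto

lemma tensor_induct [consumes 3, case_names zero add]:
  assumes V: "vs V" and W: "vs W" and t: "t \<in> carrier (V \<otimes>\<^sub>s W)"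
    and "P \<zero>\<^bsub>V \<otimes>\<^sub>s W\<^esub>"
    and "\<And>x y t. x \<in> carrier V \<Longrightarrow> y \<in> carrier W \<Longrightarrow> t \<in> carrier (V \<otimes>\<^sub>s W) \<Longrightarrow> P t \<Longrightarrow>
      P (pt V W x y \<oplus>\<^bsub>V \<otimes>\<^sub>s W\<^esub> t)"
  shows "P t"
proof -
  obtain r where r: "set r \<subseteq> carrier V \<times> carrier W" "t = cls V W r" using t by (elim tensor_carrierE)
  from r(1) have "P (cls V W r)"
  proof (induction r)
    case Nil
    then show ?case using assms(4) by (simp add: tensor_zero)
  next
    case (Cons p r)
    obtain x y where p: "p = (x, y)" "x \<in> carrier V" "y \<in> carrier W" using Cons.prems by auto
    have "P (pt V W x y \<oplus>\<^bsub>V \<otimes>\<^sub>s W\<^esub> cls V W r)"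
      using Cons p by (intro assms(5) cls_carrier) auto
    then show ?case using Cons.prems V W p by (simp add: pure_tensor_def cls_add)
  qed
  with r show ?thesis by simp
qed

text \<open>
  Pure tensors generate, so linear maps out of a tensor product are compared on them. Every later
  identity between such maps is reduced to this.
\<close>

lemma tensor_ext:
  assumes V: "vs V" and W: "vs W" and Z: "vs Z" and t: "t \<in> carrier (V \<otimes>\<^sub>s W)"
    and f: "lin (V \<otimes>\<^sub>s W) Z f" and g: "lin (V \<otimes>\<^sub>s W) Z g"
    and "\<And>x y. x \<in> carrier V \<Longrightarrow> y \<in> carrier W \<Longrightarrow> f (pt V W x y) = g (pt V W x y)"
  shows "f t = g t"
  using V W t
proof (induction t rule: tensor_induct)
  case zero
  then show ?case using lin_zero[OF f] lin_zero[OF g] V W Z by simp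
next
  case (add x y t)
  then show ?case using assms(7) by (simp add: linD(2)[OF f] linD(2)[OF g])
qed

section \<open>Sweedler sums\<close>

text \<open>
  The value of \<^const>\<open>sweedler\<close> does not record in which tensor product its argument lies. The
  spaces \<open>A\<close> and \<open>B\<close> are carried along so that the congruence rule below can provide the membership of
  the bound variables, and the value outside \<open>A \<otimes> B\<close> is fixed to be zero so that this rule and the
  linearity rules hold for every \<open>t\<close>.
\<close>

definition tsum where
  "tsum A B Z t b = (if vs A \<and> vs B \<and> t \<in> carrier (A \<otimes>\<^sub>s B) then sweedler Z t b else \<zero>\<^bsub>Z\<^esub>)"

definition list_sum where
  "list_sum Z r b = foldr (\<lambda>(x, y) s. b x y \<oplus>\<^bsub>Z\<^esub> s) r \<zero>\<^bsub>Z\<^esub>"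

lemma sweedler_tsum: "vs A \<Longrightarrow> vs B \<Longrightarrow> t \<in> carrier (A \<otimes>\<^sub>s B) \<Longrightarrow> sweedler Z t b = tsum A B Z t b"
  by (simp add: tsum_def)

lemma terms_carrier:
  assumes "vs A" "vs B" "t \<in> carrier (A \<otimes>\<^sub>s B)"
  shows "set (terms_of t) \<subseteq> carrier A \<times> carrier B"
  using assms(3) tensor_eq_carrier[OF assms(1,2) tensor_eq_rep] by (elim tensor_carrierE) auto

lemma list_sum_simps [simp]: "list_sum Z [] b = \<zero>\<^bsub>Z\<^esub>" "list_sum Z ((x, y) # r) b = b x y \<oplus>\<^bsub>Z\<^esub> list_sum Z
    r b"
  by (simp_all add: list_sum_def)

lemma list_sum_closed:
  assumes "vs Z" "\<And>x y. x \<in> carrier A \<Longrightarrow> y \<in> carrier B \<Longrightarrow> b x y \<in> carrier Z"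
    "set r \<subseteq> carrier A \<times> carrier B"
  shows "list_sum Z r b \<in> carrier Z"
  using assms(3) by (induction r) (use assms(1,2) in auto)

lemma list_sum_append:
  assumes "vs Z" "\<And>x y. x \<in> carrier A \<Longrightarrow> y \<in> carrier B \<Longrightarrow> b x y \<in> carrier Z"
    "set r \<subseteq> carrier A \<times> carrier B" "set s \<subseteq> carrier A \<times> carrier B"
  shows "list_sum Z (r @ s) b = list_sum Z r b \<oplus>\<^bsub>Z\<^esub> list_sum Z s b"
  using assms(3)
  by (induction r) (use assms(1,2,4) in \<open>auto simp: vs_ac list_sum_closed[where A = A and B = B]\<close>)

lemma bil_closed: "bil A B Z b \<Longrightarrow> x \<in> carrier A \<Longrightarrow> y \<in> carrier B \<Longrightarrow> b x y \<in> carrier Z"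
  using bilD linD(1) by fastforce

lemma list_sum_tensor_eq:
  assumes A: "vs A" and B: "vs B" and Z: "vs Z" and b: "bil A B Z b"
    and "tensor_eq K A B r s"
  shows "list_sum Z r b = list_sum Z s b"
  using assms(5)
proof induction
  case (cong r s t)
  then show ?case using tensor_eq_carrier[OF A B] Z bil_closed[OF b]
    by (metis (mono_tags, lifting) list_sum_append)
next
  case (comm r s)
  then show ?case using Z bil_closed[OF b]
    by (simp add: list_sum_append[where A = A and B = B] list_sum_closed[where A = A and B = B] vs_ac)
next
  case (zero y)
  then show ?case using Z lin_zero[OF bilD(2)[OF b]] A by simp
qed (use A B Z bil_closed[OF b] linD[OF bilD(1)[OF b]] linD[OF bilD(2)[OF b]] in \<open>auto simp: vs_ac\<close>)

lemma sweedler_cls: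
  assumes "vs A" "vs B" "vs Z" "bil A B Z b" "set r \<subseteq> carrier A \<times> carrier B"
  shows "sweedler Z (cls A B r) b = list_sum Z r b"
  using list_sum_tensor_eq[OF assms(1-4) tensor_eq_rep[OF assms(5)]] by (simp add: sweedler_def
      list_sum_def)

lemma list_sum_cong:
  assumes "\<And>x y. x \<in> carrier A \<Longrightarrow> y \<in> carrier B \<Longrightarrow> b x y = b' x y" "set r \<subseteq> carrier A \<times> carrier B"
  shows "list_sum Z r b = list_sum Z r b'"
  using assms(2) by (induction r) (use assms(1) in auto)

lemma tsum_cong [cong]:
  assumes "A = A'" "B = B'" "Z = Z'" "t = t'"
    "\<And>x y. x \<in> carrier A' \<Longrightarrow> y \<in> carrier B' \<Longrightarrow> b x y = b' x y"
  shows "tsum A B Z t b = tsum A' B' Z' t' b'"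
proof (cases "vs A' \<and> vs B' \<and> t' \<in> carrier (A' \<otimes>\<^sub>s B')")
  case True
  then have "list_sum Z' (terms_of t') b = list_sum Z' (terms_of t') b'"
    by (intro list_sum_cong[OF assms(5) terms_carrier]) auto
  with True show ?thesis by (simp add: assms(1-4) tsum_def sweedler_def list_sum_def)
qed (auto simp: assms(1-4) tsum_def)

lemma tsum_list_sum:
  assumes "vs A" "vs B" "t \<in> carrier (A \<otimes>\<^sub>s B)"
  obtains r where "set r \<subseteq> carrier A \<times> carrier B" "\<And>Z b. tsum A B Z t b = list_sum Z r b"
  using assms terms_carrier[OF assms] by (auto simp: tsum_def sweedler_def list_sum_def)

lemma list_sum_lin:
  assumes "vs Z" "vs Y" "lin Z Y f" "\<And>x y. x \<in> carrier A \<Longrightarrow> y \<in> carrier B \<Longrightarrow> b x y \<in> carrier Z"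
    "set r \<subseteq> carrier A \<times> carrier B"
  shows "f (list_sum Z r b) = list_sum Y r (\<lambda>x y. f (b x y))"
  using assms(5)
proof (induction r)
  case Nil
  then show ?case using lin_zero[OF assms(3,1,2)] by simp
next
  case (Cons p r)
  obtain x y where p: "p = (x, y)" "x \<in> carrier A" "y \<in> carrier B" using Cons.prems by auto
  have "list_sum Z r b \<in> carrier Z" by (rule list_sum_closed) (use assms Cons.prems in auto)
  then have "f (b x y \<oplus>\<^bsub>Z\<^esub> list_sum Z r b) = f (b x y) \<oplus>\<^bsub>Y\<^esub> f (list_sum Z r b)"
    using p assms(4) by (intro linD(2)[OF assms(3)])
  then show ?case using Cons p by simp
qed

lemma list_sum_add:
  assumes "vs Z" "\<And>x y. x \<in> carrier A \<Longrightarrow> y \<in> carrier B \<Longrightarrow> b x y \<in> carrier Z"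
    "\<And>x y. x \<in> carrier A \<Longrightarrow> y \<in> carrier B \<Longrightarrow> b' x y \<in> carrier Z"
    "set r \<subseteq> carrier A \<times> carrier B"
  shows "list_sum Z r (\<lambda>x y. b x y \<oplus>\<^bsub>Z\<^esub> b' x y) = list_sum Z r b \<oplus>\<^bsub>Z\<^esub> list_sum Z r b'"
  using assms(4)
  by (induction r) (use assms(1-3) in \<open>auto simp: vs_ac list_sum_closed[where A = A and B = B]\<close>)

lemma list_sum_zero: "vs Z \<Longrightarrow> list_sum Z r (\<lambda>x y. \<zero>\<^bsub>Z\<^esub>) = \<zero>\<^bsub>Z\<^esub>"
  by (induction r) auto

lemma list_sum_swap:
  assumes "vs Z" "\<And>x y u v. x \<in> carrier A \<Longrightarrow> y \<in> carrier B \<Longrightarrow> u \<in> carrier C \<Longrightarrow> v \<in> carrier D \<Longrightarrow> b x y u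
      v \<in> carrier Z"
    "set r \<subseteq> carrier A \<times> carrier B" "set s \<subseteq> carrier C \<times> carrier D"
  shows "list_sum Z r (\<lambda>x y. list_sum Z s (b x y)) = list_sum Z s (\<lambda>u v. list_sum Z r (\<lambda>x y. b x y u
      v))"
  using assms(3)
proof (induction r)
  case Nil
  then show ?case using assms(1) by (simp add: list_sum_zero)
next
  case (Cons p r)
  obtain x y where p: "p = (x, y)" "x \<in> carrier A" "y \<in> carrier B" using Cons.prems by auto
  have "list_sum Z s (\<lambda>u v. b x y u v \<oplus>\<^bsub>Z\<^esub> list_sum Z r (\<lambda>x y. b x y u v)) =
    list_sum Z s (b x y) \<oplus>\<^bsub>Z\<^esub> list_sum Z s (\<lambda>u v. list_sum Z r (\<lambda>x y. b x y u v))"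
    using Cons.prems p assms by (intro list_sum_add[where A = C and B = D] list_sum_closed[where A =
        A and B = B]) auto
  then show ?case using Cons p by simp
qed

lemma tsum_closed [simp]:
  assumes "vs Z" "\<And>x y. x \<in> carrier A \<Longrightarrow> y \<in> carrier B \<Longrightarrow> b x y \<in> carrier Z"
  shows "tsum A B Z t b \<in> carrier Z"
proof (cases "vs A \<and> vs B \<and> t \<in> carrier (A \<otimes>\<^sub>s B)")
  case True
  then obtain r where "set r \<subseteq> carrier A \<times> carrier B" "\<And>Z b. tsum A B Z t b = list_sum Z r b"
    by (metis (no_types) tsum_list_sum)
  then show ?thesis using assms by (simp add: list_sum_closed[where A = A and B = B])
qed (use assms in \<open>auto simp: tsum_def\<close>)

text \<open>
  A Sweedler sum is a finite sum over a chosen list of pairs, so linearity of \<open>f\<close> suffices here.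
  Bilinearity of \<open>b\<close> enters through the dependence on \<open>t\<close>, in the lemma \<open>tsum_in_lin\<close>.
\<close>

lemma tsum_lin_out:
  assumes "lin Z Y f" "vs Z" "vs Y" "\<And>x y. x \<in> carrier A \<Longrightarrow> y \<in> carrier B \<Longrightarrow> b x y \<in> carrier Z"
  shows "f (tsum A B Z t b) = tsum A B Y t (\<lambda>x y. f (b x y))"
proof (cases "vs A \<and> vs B \<and> t \<in> carrier (A \<otimes>\<^sub>s B)")
  case True
  then obtain r where "set r \<subseteq> carrier A \<times> carrier B" "\<And>Z b. tsum A B Z t b = list_sum Z r b"
    by (metis (no_types) tsum_list_sum)
  then show ?thesis using assms by (simp add: list_sum_lin[where A = A and B = B])
qed (use assms lin_zero[OF assms(1)] in \<open>auto simp: tsum_def\<close>)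

lemma tsum_plus:
  assumes "vs Z" "\<And>x y. x \<in> carrier A \<Longrightarrow> y \<in> carrier B \<Longrightarrow> b x y \<in> carrier Z"
    "\<And>x y. x \<in> carrier A \<Longrightarrow> y \<in> carrier B \<Longrightarrow> b' x y \<in> carrier Z"
  shows "tsum A B Z t (\<lambda>x y. b x y \<oplus>\<^bsub>Z\<^esub> b' x y) = tsum A B Z t b \<oplus>\<^bsub>Z\<^esub> tsum A B Z t b'"
proof (cases "vs A \<and> vs B \<and> t \<in> carrier (A \<otimes>\<^sub>s B)")
  case True
  then obtain r where "set r \<subseteq> carrier A \<times> carrier B" "\<And>Z b. tsum A B Z t b = list_sum Z r b"
    by (metis (no_types) tsum_list_sum)
  then show ?thesis using assms by (simp add: list_sum_add[where A = A and B = B])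
qed (use assms in \<open>auto simp: tsum_def\<close>)

lemma tsum_null [simp]:
  assumes "vs Z"
  shows "tsum A B Z t (\<lambda>x y. \<zero>\<^bsub>Z\<^esub>) = \<zero>\<^bsub>Z\<^esub>"
proof (cases "vs A \<and> vs B \<and> t \<in> carrier (A \<otimes>\<^sub>s B)")
  case True
  then obtain r where "set r \<subseteq> carrier A \<times> carrier B" "\<And>Z b. tsum A B Z t b = list_sum Z r b"
    by (metis (no_types) tsum_list_sum)
  then show ?thesis using assms by (simp add: list_sum_zero)
qed (use assms in \<open>auto simp: tsum_def\<close>)

lemma tsum_swap:
  assumes "vs Z" "\<And>x y u v. x \<in> carrier A \<Longrightarrow> y \<in> carrier B \<Longrightarrow> u \<in> carrier C \<Longrightarrow> v \<in> carrier D \<Longrightarrow> b x y u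
      v \<in> carrier Z"
  shows "tsum A B Z t (\<lambda>x y. tsum C D Z s (\<lambda>u v. b x y u v)) = tsum C D Z s (\<lambda>u v. tsum A B Z t (\<lambda>x
      y. b x y u v))"
proof (cases "vs A \<and> vs B \<and> t \<in> carrier (A \<otimes>\<^sub>s B)")
  case t: True
  then obtain r where r: "set r \<subseteq> carrier A \<times> carrier B" "\<And>Z b. tsum A B Z t b = list_sum Z r b"
    by (metis (no_types) tsum_list_sum)
  show ?thesis
  proof (cases "vs C \<and> vs D \<and> s \<in> carrier (C \<otimes>\<^sub>s D)")
    case True
    then obtain q where "set q \<subseteq> carrier C \<times> carrier D" "\<And>Z b. tsum C D Z s b = list_sum Z q b"
      by (metis (no_types) tsum_list_sum)
    then show ?thesis using assms r by (simp add: list_sum_swap[where A = A and B = B and C = C and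
        D = D])
  next
    case False
    then have "tsum C D Z s b = \<zero>\<^bsub>Z\<^esub>" for b by (auto simp: tsum_def)
    then show ?thesis using assms by simp
  qed
next
  case False
  then have "tsum A B Z t b = \<zero>\<^bsub>Z\<^esub>" for b by (auto simp: tsum_def)
  then show ?thesis using assms by simp
qed

lemma tsum_in_lin:
  assumes "vs A" "vs B" "vs Z" "bil A B Z b"
  shows "lin (A \<otimes>\<^sub>s B) Z (\<lambda>t. tsum A B Z t b)"
proof (rule linI)
  fix s t assume "s \<in> carrier (A \<otimes>\<^sub>s B)" "t \<in> carrier (A \<otimes>\<^sub>s B)"
  then obtain r q where r: "set r \<subseteq> carrier A \<times> carrier B" "s = cls A B r"
    and q: "set q \<subseteq> carrier A \<times> carrier B" "t = cls A B q" by (elim tensor_carrierE)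
  show "tsum A B Z (s \<oplus>\<^bsub>A \<otimes>\<^sub>s B\<^esub> t) b = tsum A B Z s b \<oplus>\<^bsub>Z\<^esub> tsum A B Z t b"
    using assms r q cls_carrier[of r A B] cls_carrier[of q A B] cls_carrier[of "r @ q" A B]
        bil_closed[OF assms(4)]
    by (simp add: cls_add tsum_def sweedler_cls list_sum_append[where A = A and B = B])
next
  fix a t assume a: "a \<in> carrier K" "t \<in> carrier (A \<otimes>\<^sub>s B)"
  then obtain r where r: "set r \<subseteq> carrier A \<times> carrier B" "t = cls A B r" by (elim tensor_carrierE)
  let ?r = "map (\<lambda>(x, y). (a \<odot>\<^bsub>A\<^esub> x, y)) r"
  have c: "set ?r \<subseteq> carrier A \<times> carrier B" using smult_terms_carrier assms a r by blast
  have "lin Z Z (\<lambda>x. a \<odot>\<^bsub>Z\<^esub> x)" using assms a by (intro linI) (auto simp: vs_distr)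
  then have "a \<odot>\<^bsub>Z\<^esub> list_sum Z r b = list_sum Z r (\<lambda>x y. a \<odot>\<^bsub>Z\<^esub> b x y)"
    using assms r bil_closed[OF assms(4)] by (intro list_sum_lin[where A = A and B = B]) auto
  moreover have "list_sum Z ?r b = list_sum Z r (\<lambda>x y. a \<odot>\<^bsub>Z\<^esub> b x y)" using r(1)
    by (induction r) (use assms a linD(3)[OF bilD(2)[OF assms(4)]] in auto)
  ultimately show "tsum A B Z (a \<odot>\<^bsub>A \<otimes>\<^sub>s B\<^esub> t) b = a \<odot>\<^bsub>Z\<^esub> tsum A B Z t b"
    using assms r a cls_carrier[of r A B] cls_carrier[OF c] c bil_closed[OF assms(4)]
    by (simp add: cls_smult tsum_def sweedler_cls del: set_map)
qed (use assms bil_closed[OF assms(4)] in auto)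

lemma tsum_pure:
  assumes "bil A B Z b" "vs A" "vs B" "vs Z" "x \<in> carrier A" "y \<in> carrier B"
  shows "tsum A B Z (pt A B x y) b = b x y"
proof -
  have "cls A B [(x, y)] \<in> carrier (A \<otimes>\<^sub>s B)" using assms by (intro cls_carrier) auto
  then show ?thesis
  using assms bil_closed[OF assms(1)] by (simp add: tsum_def pure_tensor_def sweedler_cls)
qed

lemma tsum_id:
  assumes "vs A" "vs B" "t \<in> carrier (A \<otimes>\<^sub>s B)"
  shows "tsum A B (A \<otimes>\<^sub>s B) t (pt A B) = t"
  using assms by (intro tensor_ext[OF assms(1,2) _ assms(3) tsum_in_lin])
    (auto simp: tsum_pure pt_bil intro: linI)

section \<open>Calculus of multilinear expressions\<close>

lemma lin_id [simp]: "lin V V (\<lambda>x. x)"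
  by (rule linI) auto

text \<open>
  The side conditions of all later computations are of the form that some expression depends linearly
  on a variable. The rules from here on derive this by following the structure of the expression,
  so that the simplifier can discharge these conditions.
\<close>

lemma lin_comp:
  assumes "lin W Z h" "lin V W f"
  shows "lin V Z (\<lambda>x. h (f x))"
  using linD[OF assms(1)] linD[OF assms(2)] by (intro linI) auto

lemma lin_add [simp]:
  assumes "vs Z" "lin V Z f" "lin V Z g"
  shows "lin V Z (\<lambda>x. f x \<oplus>\<^bsub>Z\<^esub> g x)"
  using assms(1) linD[OF assms(2)] linD[OF assms(3)] by (intro linI) (auto simp: vs_ac vs_distr)

lemma lin_const_zero [simp]: "vs Z \<Longrightarrow> lin V Z (\<lambda>x. \<zero>\<^bsub>Z\<^esub>)"
  by (intro linI) auto

lemma lin_smult [simp]: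
  assumes "vs Z" "a \<in> carrier K" "lin V Z f"
  shows "lin V Z (\<lambda>x. a \<odot>\<^bsub>Z\<^esub> f x)"
  using assms(1,2) linD[OF assms(3)] by (intro linI) (auto simp: vs_distr)

lemma bil_lin:
  assumes "bil A B Z h"
  shows "lin V A f \<Longrightarrow> y \<in> carrier B \<Longrightarrow> lin V Z (\<lambda>x. h (f x) y)"
    "lin V B g \<Longrightarrow> x \<in> carrier A \<Longrightarrow> lin V Z (\<lambda>y. h x (g y))"
  using lin_comp[OF bilD(2)[OF assms]] lin_comp[OF bilD(1)[OF assms]] by auto

lemmas pt_lin [simp] = bil_lin[OF pt_bil]

lemma lin_tsum_in [simp]:
  assumes "vs A" "vs B" "vs Z" "bil A B Z b" "lin V (A \<otimes>\<^sub>s B) f"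
  shows "lin V Z (\<lambda>x. tsum A B Z (f x) b)"
  using lin_comp[OF tsum_in_lin[OF assms(1-4)] assms(5)] .

lemma lin_tsum_body [simp]:
  assumes "vs Z" "\<And>a b. a \<in> carrier A \<Longrightarrow> b \<in> carrier B \<Longrightarrow> lin V Z (\<lambda>x. F x a b)"
  shows "lin V Z (\<lambda>x. tsum A B Z t (\<lambda>a b. F x a b))"
proof (rule linI)
  fix x y assume x: "x \<in> carrier V" and y: "y \<in> carrier V"
  have "tsum A B Z t (F (x \<oplus>\<^bsub>V\<^esub> y)) = tsum A B Z t (\<lambda>a b. F x a b \<oplus>\<^bsub>Z\<^esub> F y a b)"
    by (rule tsum_cong) (use linD(2)[OF assms(2)] x y in auto)
  also have "\<dots> = tsum A B Z t (F x) \<oplus>\<^bsub>Z\<^esub> tsum A B Z t (F y)"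
    by (rule tsum_plus) (use assms(1) linD(1)[OF assms(2)] x y in auto)
  finally show "tsum A B Z t (F (x \<oplus>\<^bsub>V\<^esub> y)) = tsum A B Z t (F x) \<oplus>\<^bsub>Z\<^esub> tsum A B Z t (F y)" .
next
  fix a x assume a: "a \<in> carrier K" and x: "x \<in> carrier V"
  have "tsum A B Z t (F (a \<odot>\<^bsub>V\<^esub> x)) = tsum A B Z t (\<lambda>u v. a \<odot>\<^bsub>Z\<^esub> F x u v)"
    by (rule tsum_cong) (use linD(3)[OF assms(2)] a x in auto)
  also have "\<dots> = a \<odot>\<^bsub>Z\<^esub> tsum A B Z t (F x)"
    by (rule tsum_lin_out[OF lin_smult[OF assms(1) a lin_id], symmetric])
      (use assms(1) linD(1)[OF assms(2)] x in auto)
  finally show "tsum A B Z t (F (a \<odot>\<^bsub>V\<^esub> x)) = a \<odot>\<^bsub>Z\<^esub> tsum A B Z t (F x)" .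
qed (use assms(1) linD(1)[OF assms(2)] in auto)

text \<open>
  The other half of the calculus: a bilinear operation is moved inside sums, zeros, scalars and
  Sweedler sums in either argument. Together with the rules for linear maps and for Sweedler sums this
  normalizes an expression to a sum of nested Sweedler sums of pure tensors.
\<close>

lemma bil_push:
  assumes "bil A B Z h" "vs A" "vs B" "vs Z"
  shows "x \<in> carrier A \<Longrightarrow> x' \<in> carrier A \<Longrightarrow> y \<in> carrier B \<Longrightarrow> h (x \<oplus>\<^bsub>A\<^esub> x') y = h x y \<oplus>\<^bsub>Z\<^esub> h x' y"
    "x \<in> carrier A \<Longrightarrow> y \<in> carrier B \<Longrightarrow> y' \<in> carrier B \<Longrightarrow> h x (y \<oplus>\<^bsub>B\<^esub> y') = h x y \<oplus>\<^bsub>Z\<^esub> h x y'"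
    "a \<in> carrier K \<Longrightarrow> x \<in> carrier A \<Longrightarrow> y \<in> carrier B \<Longrightarrow> h (a \<odot>\<^bsub>A\<^esub> x) y = a \<odot>\<^bsub>Z\<^esub> h x y"
    "a \<in> carrier K \<Longrightarrow> x \<in> carrier A \<Longrightarrow> y \<in> carrier B \<Longrightarrow> h x (a \<odot>\<^bsub>B\<^esub> y) = a \<odot>\<^bsub>Z\<^esub> h x y"
    "y \<in> carrier B \<Longrightarrow> h \<zero>\<^bsub>A\<^esub> y = \<zero>\<^bsub>Z\<^esub>"
    "x \<in> carrier A \<Longrightarrow> h x \<zero>\<^bsub>B\<^esub> = \<zero>\<^bsub>Z\<^esub>"
    "y \<in> carrier B \<Longrightarrow> (\<And>u v. u \<in> carrier C \<Longrightarrow> v \<in> carrier D \<Longrightarrow> F u v \<in> carrier A) \<Longrightarrow>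
      h (tsum C D A t F) y = tsum C D Z t (\<lambda>u v. h (F u v) y)"
    "x \<in> carrier A \<Longrightarrow> (\<And>u v. u \<in> carrier C \<Longrightarrow> v \<in> carrier D \<Longrightarrow> F u v \<in> carrier B) \<Longrightarrow>
      h x (tsum C D B t F) = tsum C D Z t (\<lambda>u v. h x (F u v))"
  using linD(2,3)[OF bilD(1)[OF assms(1)]] linD(2,3)[OF bilD(2)[OF assms(1)]]
    lin_zero[OF bilD(1)[OF assms(1)]] lin_zero[OF bilD(2)[OF assms(1)]]
    tsum_lin_out[OF bilD(1)[OF assms(1)]] tsum_lin_out[OF bilD(2)[OF assms(1)]] assms(2-4)
  by auto

lemmas pt_push [simp] = bil_push[OF pt_bil]

lemma lin_push:
  assumes "lin A Z h" "vs A" "vs Z"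
  shows "x \<in> carrier A \<Longrightarrow> x' \<in> carrier A \<Longrightarrow> h (x \<oplus>\<^bsub>A\<^esub> x') = h x \<oplus>\<^bsub>Z\<^esub> h x'"
    "a \<in> carrier K \<Longrightarrow> x \<in> carrier A \<Longrightarrow> h (a \<odot>\<^bsub>A\<^esub> x) = a \<odot>\<^bsub>Z\<^esub> h x"
    "h \<zero>\<^bsub>A\<^esub> = \<zero>\<^bsub>Z\<^esub>"
    "(\<And>u v. u \<in> carrier C \<Longrightarrow> v \<in> carrier D \<Longrightarrow> F u v \<in> carrier A) \<Longrightarrow>
      h (tsum C D A t F) = tsum C D Z t (\<lambda>u v. h (F u v))"
  using linD(2,3)[OF assms(1)] lin_zero[OF assms] tsum_lin_out[OF assms] by auto

lemma tsum_push [simp]: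
  assumes "vs A" "vs B" "vs Z" "bil A B Z b"
  shows "s \<in> carrier (A \<otimes>\<^sub>s B) \<Longrightarrow> t \<in> carrier (A \<otimes>\<^sub>s B) \<Longrightarrow>
      tsum A B Z (s \<oplus>\<^bsub>A \<otimes>\<^sub>s B\<^esub> t) b = tsum A B Z s b \<oplus>\<^bsub>Z\<^esub> tsum A B Z t b"
    "a \<in> carrier K \<Longrightarrow> s \<in> carrier (A \<otimes>\<^sub>s B) \<Longrightarrow> tsum A B Z (a \<odot>\<^bsub>A \<otimes>\<^sub>s B\<^esub> s) b = a \<odot>\<^bsub>Z\<^esub> tsum A B Z s b"
    "tsum A B Z \<zero>\<^bsub>A \<otimes>\<^sub>s B\<^esub> b = \<zero>\<^bsub>Z\<^esub>"
    "(\<And>u v. u \<in> carrier C \<Longrightarrow> v \<in> carrier D \<Longrightarrow> F u v \<in> carrier (A \<otimes>\<^sub>s B)) \<Longrightarrow>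
      tsum A B Z (tsum C D (A \<otimes>\<^sub>s B) t F) b = tsum C D Z t (\<lambda>u v. tsum A B Z (F u v) b)"
    "x \<in> carrier A \<Longrightarrow> y \<in> carrier B \<Longrightarrow> tsum A B Z (pt A B x y) b = b x y"
  using lin_push[OF tsum_in_lin[OF assms]] assms tsum_pure[OF assms(4,1,2,3)] by simp_all

lemma tsum_smult:
  assumes "vs Z" "a \<in> carrier K" "\<And>x y. x \<in> carrier A \<Longrightarrow> y \<in> carrier B \<Longrightarrow> b x y \<in> carrier Z"
  shows "tsum A B Z t (\<lambda>x y. a \<odot>\<^bsub>Z\<^esub> b x y) = a \<odot>\<^bsub>Z\<^esub> tsum A B Z t b"
  using assms by (intro tsum_lin_out[OF lin_smult, symmetric]) auto

lemmas bil_iff [simp] = bilinear_map_def[of K]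

text \<open>
  Recombines a tensor that the preceding rules have taken apart without changing it.
\<close>

lemma tsum_pt_id [simp]:
  assumes "vs A" "vs B" "vs C" "s \<in> carrier (A \<otimes>\<^sub>s B)" "z \<in> carrier C"
  shows "tsum A B ((A \<otimes>\<^sub>s B) \<otimes>\<^sub>s C) s (\<lambda>x y. pt (A \<otimes>\<^sub>s B) C (pt A B x y) z) = pt (A \<otimes>\<^sub>s B) C s z"
    "tsum A B (C \<otimes>\<^sub>s (A \<otimes>\<^sub>s B)) s (\<lambda>x y. pt C (A \<otimes>\<^sub>s B) z (pt A B x y)) = pt C (A \<otimes>\<^sub>s B) z s"
  using pt_push(7)[of "A \<otimes>\<^sub>s B" C z A B "pt A B" s] pt_push(8)[of C "A \<otimes>\<^sub>s B" z A B "pt A B" s] assms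
  by (simp_all add: tsum_id)

declare tsum_id [simp] tsum_plus [simp] tsum_smult [simp] vs_distr(1)[simp]

section \<open>Unitarization\<close>

abbreviation plus where "plus \<equiv> plus_space K"
abbreviation emb where "emb \<equiv> plus_embed K"

lemma plus_carrier [simp]: "Unitar x c \<in> carrier (plus V) \<longleftrightarrow> x \<in> carrier V \<and> c \<in> carrier K"
  by (auto simp: plus_space_def)

lemma plus_parts [simp]:
  "q \<in> carrier (plus V) \<Longrightarrow> alg_part q \<in> carrier V"
  "q \<in> carrier (plus V) \<Longrightarrow> unit_part q \<in> carrier K"
  by (auto simp: plus_space_def)

lemma plus_ops [simp]:
  "\<zero>\<^bsub>plus V\<^esub> = Unitar \<zero>\<^bsub>V\<^esub> \<zero>"
  "p \<oplus>\<^bsub>plus V\<^esub> q = Unitar (alg_part p \<oplus>\<^bsub>V\<^esub> alg_part q) (unit_part p \<oplus> unit_part q)"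
  "a \<odot>\<^bsub>plus V\<^esub> p = Unitar (a \<odot>\<^bsub>V\<^esub> alg_part p) (a \<otimes> unit_part p)"
  by (auto simp: plus_space_def)

lemma plus_cases:
  assumes "q \<in> carrier (plus V)"
  obtains x c where "q = Unitar x c" "x \<in> carrier V" "c \<in> carrier K"
  using assms by (auto simp: plus_space_def)

lemma vs_plus [simp]:
  assumes V: "vs V"
  shows "vs (plus V)"
proof (rule moduleI)
  show "abelian_group (plus V)"
  proof (rule abelian_groupI)
    fix x assume "x \<in> carrier (plus V)"
    then show "\<exists>y\<in>carrier (plus V). y \<oplus>\<^bsub>plus V\<^esub> x = \<zero>\<^bsub>plus V\<^esub>"
      using V by (intro bexI[of _ "Unitar (\<ominus>\<^bsub>V\<^esub> alg_part x) (\<ominus> unit_part x)"]) (auto simp: l_neg)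
  qed (use V in \<open>auto elim!: plus_cases simp: vs_ac a_ac\<close>)
qed (use V in \<open>auto elim!: plus_cases simp: vs_distr is_cring l_distr r_distr m_ac\<close>)

lemma emb_lin: "vs V \<Longrightarrow> lin V (plus V) emb"
  by (rule linI) (auto simp: plus_embed_def)

lemma alg_lin: "vs V \<Longrightarrow> lin (plus V) V alg_part"
  by (rule linI) auto

lemma unit_lin: "vs V \<Longrightarrow> vs Z \<Longrightarrow> z \<in> carrier Z \<Longrightarrow> lin (plus V) Z (\<lambda>q. unit_part q \<odot>\<^bsub>Z\<^esub> z)"
  by (rule linI) (auto simp: vs_distr)

lemmas plus_lin [simp] = lin_comp[OF emb_lin] lin_comp[OF alg_lin]

lemma emb_simps [simp]:
  "alg_part (emb x) = x" "unit_part (emb x) = \<zero>"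
  "x \<in> carrier V \<Longrightarrow> emb x \<in> carrier (plus V)"
  "alg_part (plus_one K V) = \<zero>\<^bsub>V\<^esub>" "unit_part (plus_one K V) = \<one>"
  "vs V \<Longrightarrow> plus_one K V \<in> carrier (plus V)"
  by (auto simp: plus_embed_def plus_one_def)

text \<open>
  The splitting \<open>V\<^sup>+ = V \<oplus> K1\<close>, from which the splitting of coactions is derived.
\<close>

lemma plus_decomp:
  assumes "vs V" "q \<in> carrier (plus V)"
  shows "emb (alg_part q) \<oplus>\<^bsub>plus V\<^esub> unit_part q \<odot>\<^bsub>plus V\<^esub> plus_one K V = q"
  using assms by (auto elim!: plus_cases)

lemma bil_plus_act:
  assumes V: "vs V" and W: "vs W" and act: "bil V W V act"
  shows "bil (plus V) (plus W) (plus V) (plus_act K V act)"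
proof -
  have *: "lin W V (act x)" if "x \<in> carrier V" for x using bilD(1)[OF act] that .
  have **: "lin V V (\<lambda>x. act x y)" if "y \<in> carrier W" for y using bilD(2)[OF act] that .
  show ?thesis
    by (intro bilI linI) (use V W linD[OF *] linD[OF **] in \<open>auto simp: plus_act_def vs_distr vs_ac
        l_distr r_distr m_ac\<close>)
qed

lemma plus_act_simps:
  assumes V: "vs V" and W: "vs W" and act: "bil V W V act"
  shows "q \<in> carrier (plus V) \<Longrightarrow> plus_act K V act q (plus_one K W) = q"
    "x \<in> carrier V \<Longrightarrow> y \<in> carrier W \<Longrightarrow> plus_act K V act (emb x) (emb y) = emb (act x y)"
    "y \<in> carrier W \<Longrightarrow> plus_act K V act (plus_one K V) (emb y) = Unitar \<zero>\<^bsub>V\<^esub> \<zero>"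
  using V W lin_zero[OF bilD(1)[OF act]] lin_zero[OF bilD(2)[OF act]] bil_closed[OF act]
  by (auto simp: plus_act_def plus_embed_def plus_one_def elim!: plus_cases)

lemma tsum_plus_comult:
  assumes V: "vs V" and Z: "vs Z" and b: "bil (plus V) (plus V) Z b" and q: "q \<in> carrier (plus V)"
  defines "e \<equiv> plus_one K V" and "x \<equiv> emb (alg_part q)"
  shows "tsum (plus V) (plus V) Z (plus_comult K V q) b =
    (b x e \<oplus>\<^bsub>Z\<^esub> b e x) \<oplus>\<^bsub>Z\<^esub> unit_part q \<odot>\<^bsub>Z\<^esub> b e e"
  using V Z q b unfolding plus_comult_def Let_def e_def x_def by (simp del: bil_iff)

lemma plus_comult_closed [simp]:
  "vs V \<Longrightarrow> q \<in> carrier (plus V) \<Longrightarrow> plus_comult K V q \<in> carrier (plus V \<otimes>\<^sub>s plus V)"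
  by (simp add: plus_comult_def Let_def)

lemma plus_comult_lin: "vs V \<Longrightarrow> lin (plus V) (plus V \<otimes>\<^sub>s plus V) (plus_comult K V)"
  unfolding plus_comult_def[abs_def] Let_def by (simp add: unit_lin)

end

section \<open>Crossed modules of Leibniz algebras\<close>

locale leibniz_xmod =
  fixes X :: "('a, 'k) xmod"
  assumes xmod: "leibniz_crossed_module X"
begin

lemma cring_ground: "cring (ground X)"
  using xmod by (simp add: leibniz_crossed_module_def Let_def field.axioms domain.axioms)

end

sublocale leibniz_xmod \<subseteq> tensors "ground X"
  by (simp add: tensors_def cring_ground)

context leibniz_xmod
begin

notation tens (infixr \<open>\<otimes>\<^sub>s\<close> 71)

abbreviation kL where "kL \<equiv> space (kk X)"
abbreviation gL where "gL \<equiv> space (gg X)"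
abbreviation P where "P \<equiv> kplus X"
abbreviation G where "G \<equiv> gplus X"
abbreviation br where "br \<equiv> bracket (kk X)"
abbreviation gbr where "gbr \<equiv> bracket (gg X)"
abbreviation KK where "KK \<equiv> ground X"

lemma vs_kg [simp]: "vs kL" "vs gL"
  using xmod by (auto simp: leibniz_crossed_module_def leibniz_algebra_def Let_def)

lemma vs_PG [simp]: "vs P" "vs G"
  by (auto simp: kplus_def gplus_def)

lemma bil_br: "bil kL kL kL br" and bil_gbr: "bil gL gL gL gbr" and bil_xact: "bil kL gL kL (xact X)"
  and lin_pi: "lin kL gL (pi_map X)"
  using xmod by (simp_all add: leibniz_crossed_module_def leibniz_algebra_def leibniz_action_def
      Let_def del: bil_iff)

lemmas br_simps [simp] = bil_lin[OF bil_br] bil_push[OF bil_br vs_kg(1) vs_kg(1) vs_kg(1)]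
    bil_closed[OF bil_br]
lemmas gbr_simps [simp] = bil_lin[OF bil_gbr] bil_push[OF bil_gbr vs_kg(2) vs_kg(2) vs_kg(2)]
    bil_closed[OF bil_gbr]
lemmas xact_simps [simp] = bil_lin[OF bil_xact] bil_push[OF bil_xact vs_kg(1) vs_kg(2) vs_kg(1)]
    bil_closed[OF bil_xact]
lemmas pi_simps [simp] = lin_comp[OF lin_pi] lin_push[OF lin_pi vs_kg] linD(1)[OF lin_pi]

text \<open>
  The Leibniz identity is stated without subtraction, since the normal forms contain none.
\<close>

lemma leibniz_br: "x \<in> carrier kL \<Longrightarrow> y \<in> carrier kL \<Longrightarrow> z \<in> carrier kL \<Longrightarrow>
    br (br x y) z = br x (br y z) \<oplus>\<^bsub>kL\<^esub> br (br x z) y"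
  and pi_br [simp]: "x \<in> carrier kL \<Longrightarrow> y \<in> carrier kL \<Longrightarrow> pi_map X (br x y) = gbr (pi_map X x) (pi_map
      X y)"
  and xact_br [simp]: "x \<in> carrier kL \<Longrightarrow> y \<in> carrier kL \<Longrightarrow> u \<in> carrier gL \<Longrightarrow>
    xact X (br x y) u = br (xact X x u) y \<oplus>\<^bsub>kL\<^esub> br x (xact X y u)"
  and xact_pi [simp]: "x \<in> carrier kL \<Longrightarrow> y \<in> carrier kL \<Longrightarrow> xact X x (pi_map X y) = br x y"
  and pi_xact [simp]: "x \<in> carrier kL \<Longrightarrow> u \<in> carrier gL \<Longrightarrow> pi_map X (xact X x u) = gbr (pi_map X x) u"
proof -
  show "br (br x y) z = br x (br y z) \<oplus>\<^bsub>kL\<^esub> br (br x z) y"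
    if "x \<in> carrier kL" "y \<in> carrier kL" "z \<in> carrier kL"
  proof -
    have "br x (br y z) = br (br x y) z \<ominus>\<^bsub>kL\<^esub> br (br x z) y"
      using that xmod by (simp add: leibniz_crossed_module_def leibniz_algebra_def Let_def)
    then have "br (br x y) z = br (br x z) y \<oplus>\<^bsub>kL\<^esub> br x (br y z)"
      using vs_diff_eq[OF vs_kg(1)] that by simp
    then show ?thesis using that by (simp add: vs_ac)
  qed
qed (use xmod in \<open>simp_all add: leibniz_crossed_module_def Let_def\<close>)

lemma plus_elems [simp]:
  "x \<in> carrier kL \<Longrightarrow> emb x \<in> carrier P" "x \<in> carrier gL \<Longrightarrow> emb x \<in> carrier G"
  "kone X \<in> carrier P" "gone X \<in> carrier G"
  "q \<in> carrier P \<Longrightarrow> alg_part q \<in> carrier kL" "q \<in> carrier G \<Longrightarrow> alg_part q \<in> carrier gL"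
  "q \<in> carrier P \<Longrightarrow> unit_part q \<in> carrier KK" "q \<in> carrier G \<Longrightarrow> unit_part q \<in> carrier KK"
  "alg_part (kone X) = \<zero>\<^bsub>kL\<^esub>" "unit_part (kone X) = \<one>\<^bsub>KK\<^esub>"
  "alg_part (gone X) = \<zero>\<^bsub>gL\<^esub>" "unit_part (gone X) = \<one>\<^bsub>KK\<^esub>"
  by (auto simp: kplus_def gplus_def kone_def gone_def)

lemma PG_lin [simp]:
  "lin V kL f \<Longrightarrow> lin V P (\<lambda>x. emb (f x))" "lin V gL f \<Longrightarrow> lin V G (\<lambda>x. emb (f x))"
  "lin V P f \<Longrightarrow> lin V kL (\<lambda>x. alg_part (f x))" "lin V G f \<Longrightarrow> lin V gL (\<lambda>x. alg_part (f x))"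
  "vs Z \<Longrightarrow> z \<in> carrier Z \<Longrightarrow> lin P Z (\<lambda>x. unit_part x \<odot>\<^bsub>Z\<^esub> z)"
  "vs Z \<Longrightarrow> z \<in> carrier Z \<Longrightarrow> lin G Z (\<lambda>x. unit_part x \<odot>\<^bsub>Z\<^esub> z)"
  by (auto simp: kplus_def gplus_def unit_lin)

lemma bil_kg: "bil P G P (kg_act X)" and bil_kk: "bil P P P (kk_act X)" and bil_gg: "bil G G G
    (gg_act X)"
  unfolding kplus_def gplus_def kg_act_def kk_act_def gg_act_def
  by (intro bil_plus_act vs_kg bil_br bil_gbr bil_xact)+

lemmas kg_simps [simp] = bil_lin[OF bil_kg] bil_closed[OF bil_kg]
lemmas kk_simps [simp] = bil_lin[OF bil_kk] bil_closed[OF bil_kk]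
lemmas gg_simps [simp] = bil_lin[OF bil_gg] bil_closed[OF bil_gg]

lemma plus_actions [simp]:
  "q \<in> carrier P \<Longrightarrow> kg_act X q (gone X) = q"
  "x \<in> carrier kL \<Longrightarrow> y \<in> carrier gL \<Longrightarrow> kg_act X (emb x) (emb y) = emb (xact X x y)"
  "y \<in> carrier gL \<Longrightarrow> kg_act X (kone X) (emb y) = \<zero>\<^bsub>P\<^esub>"
  "q \<in> carrier P \<Longrightarrow> kk_act X q (kone X) = q"
  "x \<in> carrier kL \<Longrightarrow> y \<in> carrier kL \<Longrightarrow> kk_act X (emb x) (emb y) = emb (br x y)"
  "y \<in> carrier kL \<Longrightarrow> kk_act X (kone X) (emb y) = \<zero>\<^bsub>P\<^esub>"
  "q \<in> carrier G \<Longrightarrow> gg_act X q (gone X) = q"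
  using plus_act_simps[OF vs_kg(1) vs_kg(2) bil_xact] plus_act_simps[OF vs_kg(1) vs_kg(1) bil_br]
    plus_act_simps[OF vs_kg(2) vs_kg(2) bil_gbr]
  by (auto simp: kplus_def gplus_def kone_def gone_def kg_act_def kk_act_def gg_act_def)

lemma gg_act_parts:
  "q \<in> carrier G \<Longrightarrow> x \<in> carrier gL \<Longrightarrow> gg_act X q (emb x) = emb (gbr (alg_part q) x)"
  by (auto simp: gplus_def gg_act_def plus_act_def plus_embed_def)

lemma tsum_gcomult:
  assumes Z: "vs Z" and b: "bil G G Z b" and q: "q \<in> carrier G"
  shows "tsum G G Z (gcomult X q) b =
    (b (emb (alg_part q)) (gone X) \<oplus>\<^bsub>Z\<^esub> b (gone X) (emb (alg_part q))) \<oplus>\<^bsub>Z\<^esub> unit_part q \<odot>\<^bsub>Z\<^esub> b (gone X)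
        (gone X)"
  using tsum_plus_comult[OF vs_kg(2), of Z b q] assms by (simp add: gplus_def gone_def gcomult_def
      del: bil_iff)

lemma gcomult_closed [simp]: "q \<in> carrier G \<Longrightarrow> gcomult X q \<in> carrier (G \<otimes>\<^sub>s G)"
  by (simp add: gplus_def gcomult_def)

lemma kcomult_closed [simp]: "q \<in> carrier P \<Longrightarrow> kcomult X q \<in> carrier (P \<otimes>\<^sub>s P)"
  by (simp add: kplus_def kcomult_def)

lemma lin_kcomult: "lin P (P \<otimes>\<^sub>s P) (kcomult X)"
  using plus_comult_lin[OF vs_kg(1)] by (simp add: kplus_def kcomult_def)

lemma kcomult_emb: "x \<in> carrier kL \<Longrightarrow> kcomult X (emb x) = pt P P (emb x) (kone X) \<oplus>\<^bsub>P \<otimes>\<^sub>s P\<^esub> pt P P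
    (kone X) (emb x)"
  and kcomult_one: "kcomult X (kone X) = pt P P (kone X) (kone X)"
proof -
  show "x \<in> carrier kL \<Longrightarrow> kcomult X (emb x) = pt P P (emb x) (kone X) \<oplus>\<^bsub>P \<otimes>\<^sub>s P\<^esub> pt P P (kone X) (emb x)"
    by (simp add: kcomult_def plus_comult_def Let_def flip: kplus_def kone_def)
  have "emb \<zero>\<^bsub>kL\<^esub> = \<zero>\<^bsub>P\<^esub>" by (simp add: kplus_def plus_embed_def)
  then show "kcomult X (kone X) = pt P P (kone X) (kone X)"
    by (simp add: kcomult_def plus_comult_def Let_def flip: kplus_def kone_def)
qed

end

section \<open>Splitting off the group-like part of a coaction\<close>

text \<open>
  A unital action of \<open>\<gg>\<^sup>+\<close> is given by its restriction \<open>a\<close> to \<open>\<gg>\<close>, and a map \<open>M \<rightarrow> M \<otimes> \<kk>\<^sup>+\<close> by its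
  components \<open>d\<close> in \<open>M \<otimes> \<kk>\<close> and \<open>p\<close> in \<open>M \<otimes> K1 = M\<close>. The locale fixes such data without any
  Yetter-Drinfel'd axiom; the results below translate the axioms into conditions on \<open>a\<close>, \<open>d\<close> and \<open>p\<close>.
\<close>

locale split_coaction = leibniz_xmod X for X :: "('a, 'k) xmod" +
  fixes M :: "('a, 'k) yd" and a :: "('a, 'k) binop" and d p :: "('a, 'k) endo"
  assumes vs_M [simp]: "vs (yspace M)"
    and bil_a: "bil (yspace M) gL (yspace M) a"
    and lin_d: "lin (yspace M) (yspace M \<otimes>\<^sub>s kL) d"
    and lin_p: "lin (yspace M) (yspace M) p"
    and act_eq: "\<And>m q. m \<in> carrier (yspace M) \<Longrightarrow> q \<in> carrier G \<Longrightarrow>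
      yact M m q = a m (alg_part q) \<oplus>\<^bsub>yspace M\<^esub> unit_part q \<odot>\<^bsub>yspace M\<^esub> m"
    and coact_eq: "\<And>m. m \<in> carrier (yspace M) \<Longrightarrow>
      ycoact M m = tsum (yspace M) kL (yspace M \<otimes>\<^sub>s P) (d m) (\<lambda>m0 k. pt (yspace M) P m0 (emb k))
        \<oplus>\<^bsub>yspace M \<otimes>\<^sub>s P\<^esub> pt (yspace M) P (p m) (kone X)"
begin

abbreviation V where "V \<equiv> yspace M"

lemmas a_simps [simp] = bil_lin[OF bil_a] bil_push[OF bil_a vs_M vs_kg(2) vs_M] bil_closed[OF bil_a]
lemmas d_simps [simp] = lin_comp[OF lin_d] lin_push[OF lin_d vs_M vs_tensor[OF vs_M vs_kg(1)]]
    linD(1)[OF lin_d]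
lemmas p_simps [simp] = lin_comp[OF lin_p] lin_push[OF lin_p vs_M vs_M] linD(1)[OF lin_p]

lemma a_parts [simp]:
  "m \<in> carrier V \<Longrightarrow> q \<in> carrier G \<Longrightarrow> yact M m q \<in> carrier V"
  "m \<in> carrier V \<Longrightarrow> x \<in> carrier gL \<Longrightarrow> yact M m (emb x) = a m x"
  "m \<in> carrier V \<Longrightarrow> yact M m (gone X) = m"
  by (simp_all add: act_eq)

lemma unital: "unital_action X M"
  by (simp add: unital_action_def)

lemma lin_cong:
  assumes "lin A Z f" "\<And>x. x \<in> carrier A \<Longrightarrow> g x = f x" "vs A"
  shows "lin A Z g"
  using linD[OF assms(1)] assms(2,3) by (intro linI) auto

lemma bil_yact: "bil V G V (yact M)"
proof (rule bilI)
  fix m assume m: "m \<in> carrier V"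
  have "lin G V (\<lambda>q. a m (alg_part q) \<oplus>\<^bsub>V\<^esub> unit_part q \<odot>\<^bsub>V\<^esub> m)" using m by simp
  then show "lin G V (yact M m)" by (rule lin_cong) (use m in \<open>auto simp: act_eq\<close>)
next
  fix q assume q: "q \<in> carrier G"
  have "lin V V (\<lambda>m. a m (alg_part q) \<oplus>\<^bsub>V\<^esub> unit_part q \<odot>\<^bsub>V\<^esub> m)" using q by simp
  then show "lin V V (\<lambda>m. yact M m q)" by (rule lin_cong) (use q in \<open>auto simp: act_eq\<close>)
qed

lemma lin_ycoact: "lin V (V \<otimes>\<^sub>s P) (ycoact M)"
proof -
  have "lin V (V \<otimes>\<^sub>s P) (\<lambda>m. tsum V kL (V \<otimes>\<^sub>s P) (d m) (\<lambda>m0 k. pt V P m0 (emb k))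
        \<oplus>\<^bsub>V \<otimes>\<^sub>s P\<^esub> pt V P (p m) (kone X))" by simp
  then show ?thesis by (rule lin_cong) (auto simp: coact_eq)
qed

lemmas yact_simps [simp] = bil_lin[OF bil_yact]
lemmas ycoact_simps [simp] = lin_comp[OF lin_ycoact] lin_push[OF lin_ycoact vs_M vs_tensor[OF vs_M
    vs_PG(1)]] linD(1)[OF lin_ycoact]

lemma tsum_ycoact:
  assumes "vs Z" "bil V P Z b" "m \<in> carrier V"
  shows "tsum V P Z (ycoact M m) b = tsum V kL Z (d m) (\<lambda>m0 k. b m0 (emb k)) \<oplus>\<^bsub>Z\<^esub> b (p m) (kone X)"
  using assms by (simp add: coact_eq)

lemma d_eq: "m \<in> carrier V \<Longrightarrow> tsum V P (V \<otimes>\<^sub>s kL) (ycoact M m) (\<lambda>m0 m1. pt V kL m0 (alg_part m1)) = d m"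
  and p_eq: "m \<in> carrier V \<Longrightarrow> tsum V P V (ycoact M m) (\<lambda>m0 m1. unit_part m1 \<odot>\<^bsub>V\<^esub> m0) = p m"
  by (simp_all add: tsum_ycoact)

text \<open>
  In the braided-module axiom for \<open>x + c1\<close> and \<open>y + e1\<close> the terms containing \<open>c\<close> or \<open>e\<close> agree on both
  sides, because \<open>1\<close> acts as the identity and \<open>1 \<cdot> x = 0\<close>. What is left is the Leibniz action identity.
\<close>

lemma action_axiom_iff:
  "yd_action_axiom X M \<longleftrightarrow> (\<forall>m\<in>carrier V. \<forall>x\<in>carrier gL. \<forall>y\<in>carrier gL.
     a (a m y) x = a (a m x) y \<oplus>\<^bsub>V\<^esub> a m (gbr y x))"
proof -
  have rhs: "sweedler V (gcomult X g) (\<lambda>g1 g2. yact M (yact M m g1) (gg_act X g' g2)) =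
     ((a (a m (alg_part g)) (alg_part g') \<oplus>\<^bsub>V\<^esub> a m (gbr (alg_part g') (alg_part g)))
        \<oplus>\<^bsub>V\<^esub> unit_part g' \<odot>\<^bsub>V\<^esub> a m (alg_part g)) \<oplus>\<^bsub>V\<^esub>
       unit_part g \<odot>\<^bsub>V\<^esub> (a m (alg_part g') \<oplus>\<^bsub>V\<^esub> unit_part g' \<odot>\<^bsub>V\<^esub> m)"
    if "m \<in> carrier V" "g \<in> carrier G" "g' \<in> carrier G" for m g g'
    using that
    by (simp add: sweedler_tsum[of G G] tsum_gcomult gg_act_parts)
       (simp add: act_eq vs_ac)
  have lhs: "yact M (yact M m g') g =
     (a (a m (alg_part g')) (alg_part g) \<oplus>\<^bsub>V\<^esub> unit_part g' \<odot>\<^bsub>V\<^esub> a m (alg_part g)) \<oplus>\<^bsub>V\<^esub>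
       unit_part g \<odot>\<^bsub>V\<^esub> (a m (alg_part g') \<oplus>\<^bsub>V\<^esub> unit_part g' \<odot>\<^bsub>V\<^esub> m)"
    if "m \<in> carrier V" "g \<in> carrier G" "g' \<in> carrier G" for m g g'
    using that by (simp add: act_eq vs_ac)
  show ?thesis
  proof
    assume ax: "yd_action_axiom X M"
    show "\<forall>m\<in>carrier V. \<forall>x\<in>carrier gL. \<forall>y\<in>carrier gL.
     a (a m y) x = a (a m x) y \<oplus>\<^bsub>V\<^esub> a m (gbr y x)"
    proof (intro ballI)
      fix m x y assume *: "m \<in> carrier V" "x \<in> carrier gL" "y \<in> carrier gL"
      then have "yact M (yact M m (emb y)) (emb x) =
        sweedler V (gcomult X (emb x)) (\<lambda>g1 g2. yact M (yact M m g1) (gg_act X (emb y) g2))"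
        using ax[unfolded yd_action_axiom_def] plus_elems(2) by blast
      then show "a (a m y) x = a (a m x) y \<oplus>\<^bsub>V\<^esub> a m (gbr y x)"
        using * by (simp only: lhs rhs plus_elems emb_simps) simp
    qed
  next
    assume leib: "\<forall>m\<in>carrier V. \<forall>x\<in>carrier gL. \<forall>y\<in>carrier gL.
     a (a m y) x = a (a m x) y \<oplus>\<^bsub>V\<^esub> a m (gbr y x)"
    show "yd_action_axiom X M" unfolding yd_action_axiom_def
    proof (intro ballI)
      fix m g g' assume *: "m \<in> carrier V" "g \<in> carrier G" "g' \<in> carrier G"
      have "a (a m (alg_part g')) (alg_part g) = a (a m (alg_part g)) (alg_part g') \<oplus>\<^bsub>V\<^esub> a m (gbr
          (alg_part g') (alg_part g))"
        using leib * by (intro leib[rule_format]) simp_all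
      then show "yact M (yact M m g') g = sweedler V (gcomult X g) (\<lambda>g1 g2. yact M (yact M m g1)
          (gg_act X g' g2))"
        by (simp only: lhs[OF *] rhs[OF *])
    qed
  qed
qed

text \<open>
  The two components of an element of \<open>M \<otimes> \<kk>\<^sup>+\<close> are recovered by the projections of \<open>\<kk>\<^sup>+\<close> to \<open>\<kk>\<close> and
  to \<open>K1\<close>.
\<close>

lemma plus_coeff_inj:
  assumes "t \<in> carrier (V \<otimes>\<^sub>s kL)" "t' \<in> carrier (V \<otimes>\<^sub>s kL)" "v \<in> carrier V" "v' \<in> carrier V"
    and eq: "tsum V kL (V \<otimes>\<^sub>s P) t (\<lambda>m0 k. pt V P m0 (emb k)) \<oplus>\<^bsub>V \<otimes>\<^sub>s P\<^esub> pt V P v (kone X)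
      = tsum V kL (V \<otimes>\<^sub>s P) t' (\<lambda>m0 k. pt V P m0 (emb k)) \<oplus>\<^bsub>V \<otimes>\<^sub>s P\<^esub> pt V P v' (kone X)"
  shows "t = t' \<and> v = v'"
proof
  show "t = t'"
    using arg_cong[OF eq, of "\<lambda>s. tsum V P (V \<otimes>\<^sub>s kL) s (\<lambda>m0 m1. pt V kL m0 (alg_part m1))"] assms(1-4)
    by simp
  show "v = v'"
    using arg_cong[OF eq, of "\<lambda>s. tsum V P V s (\<lambda>m0 m1. unit_part m1 \<odot>\<^bsub>V\<^esub> m0)"] assms(1-4)
    by simp
qed

text \<open>
  Since \<open>1 \<cdot> x = 0\<close> and \<open>m\<^sub>1 \<cdot> 1 = m\<^sub>1\<close>, both components of the coaction can be compared
  separately, and each has to be equivariant.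
\<close>

lemma compatibility_iff:
  "yd_compatibility X M \<longleftrightarrow> (\<forall>m\<in>carrier V. \<forall>x\<in>carrier gL.
     d (a m x) = tsum V kL (V \<otimes>\<^sub>s kL) (d m) (\<lambda>m0 k. pt V kL m0 (xact X k x) \<oplus>\<^bsub>V \<otimes>\<^sub>s kL\<^esub> pt V kL (a m0 x)
         k) \<and>
     p (a m x) = a (p m) x)"
proof -
  let ?T = "V \<otimes>\<^sub>s P" and ?S = "V \<otimes>\<^sub>s kL"
  let ?\<iota> = "\<lambda>t. tsum V kL ?T t (\<lambda>m0 k. pt V P m0 (emb k))"
  let ?e = "\<lambda>m x. tsum V kL ?S (d m) (\<lambda>m0 k. pt V kL m0 (xact X k x) \<oplus>\<^bsub>?S\<^esub> pt V kL (a m0 x) k)"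
  have rhs: "sweedler ?T (ycoact M m) (\<lambda>m0 m1. sweedler ?T (gcomult X g) (\<lambda>g1 g2.
          pt V P (yact M m0 g1) (kg_act X m1 g2))) =
      (?\<iota> (?e m (alg_part g)) \<oplus>\<^bsub>?T\<^esub> pt V P (a (p m) (alg_part g)) (kone X)) \<oplus>\<^bsub>?T\<^esub> unit_part g \<odot>\<^bsub>?T\<^esub> ycoact
          M m"
    if "m \<in> carrier V" "g \<in> carrier G" for m g
    using that
    by (simp add: sweedler_tsum[of G G] sweedler_tsum[of V P] tsum_gcomult tsum_ycoact)
       (simp add: coact_eq vs_ac)
  have lhs: "ycoact M (yact M m g) =
     (?\<iota> (d (a m (alg_part g))) \<oplus>\<^bsub>?T\<^esub> pt V P (p (a m (alg_part g))) (kone X)) \<oplus>\<^bsub>?T\<^esub> unit_part g \<odot>\<^bsub>?T\<^esub>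
         ycoact M m"
    if "m \<in> carrier V" "g \<in> carrier G" for m g
    using that by (simp add: act_eq vs_ac) (simp add: coact_eq vs_ac)
  show ?thesis
  proof
    assume ax: "yd_compatibility X M"
    show "\<forall>m\<in>carrier V. \<forall>x\<in>carrier gL. d (a m x) = ?e m x \<and> p (a m x) = a (p m) x"
    proof (intro ballI)
      fix m x assume *: "m \<in> carrier V" "x \<in> carrier gL"
      then have "ycoact M (yact M m (emb x)) = sweedler ?T (ycoact M m) (\<lambda>m0 m1. sweedler ?T
          (gcomult X (emb x)) (\<lambda>g1 g2.
          pt V P (yact M m0 g1) (kg_act X m1 g2)))"
        using ax[unfolded yd_compatibility_def Let_def] plus_elems(2) by blast
      then have "?\<iota> (d (a m x)) \<oplus>\<^bsub>?T\<^esub> pt V P (p (a m x)) (kone X) =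
        ?\<iota> (?e m x) \<oplus>\<^bsub>?T\<^esub> pt V P (a (p m) x) (kone X)"
        using * by (simp only: lhs rhs plus_elems) simp
      then show "d (a m x) = ?e m x \<and> p (a m x) = a (p m) x"
        using * by (intro plus_coeff_inj) simp_all
    qed
  next
    assume e: "\<forall>m\<in>carrier V. \<forall>x\<in>carrier gL. d (a m x) = ?e m x \<and> p (a m x) = a (p m) x"
    then have e1: "\<And>m x. m \<in> carrier V \<Longrightarrow> x \<in> carrier gL \<Longrightarrow> d (a m x) = ?e m x"
      and e2: "\<And>m x. m \<in> carrier V \<Longrightarrow> x \<in> carrier gL \<Longrightarrow> p (a m x) = a (p m) x" by blast+
    show "yd_compatibility X M" unfolding yd_compatibility_def Let_def
      by (intro ballI) (simp only: lhs rhs e1 e2 plus_elems)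
  qed
qed

text \<open>
  The iterated coaction of \<open>m\<close> has components in \<open>\<kk> \<otimes> \<kk>\<close>, \<open>\<kk> \<otimes> 1\<close>, \<open>1 \<otimes> \<kk>\<close> and \<open>1 \<otimes> 1\<close>, namely
  \<open>(d \<otimes> id) d m\<close>, \<open>d (p m)\<close>, \<open>(p \<otimes> id) d m\<close> and \<open>p (p m)\<close>. The braiding \<open>\<sigma>\<close> kills
  everything whose first entry is in \<open>\<kk>\<close> and replaces \<open>1 \<otimes> k\<close> by \<open>k \<otimes> 1 + 1 \<otimes> k\<close>. Comparing components
  gives the two conditions, and none on \<open>p (p m)\<close>.
\<close>

lemma coaction_axiom_iff:
  "yd_coaction_axiom X M \<longleftrightarrow> (\<forall>m\<in>carrier V.
     tsum V kL ((V \<otimes>\<^sub>s kL) \<otimes>\<^sub>s kL) (d m) (\<lambda>m0 k. pt (V \<otimes>\<^sub>s kL) kL (d m0) k) = \<zero>\<^bsub>(V \<otimes>\<^sub>s kL) \<otimes>\<^sub>s kL\<^esub> \<and>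
     d (p m) = tsum V kL (V \<otimes>\<^sub>s kL) (d m) (\<lambda>m0 k. pt V kL (p m0) k))"
proof -
  let ?PP = "P \<otimes>\<^sub>s P" and ?S = "V \<otimes>\<^sub>s kL"
  let ?T = "V \<otimes>\<^sub>s P \<otimes>\<^sub>s P"
  let ?pt = "\<lambda>m u v. pt V ?PP m (pt P P u v)"
  define twice where "twice m = vect_assoc KK V P P (tensor_map KK (V \<otimes>\<^sub>s P) P (ycoact M) id (ycoact
      M m))" for m
  define dd where "dd m = tsum V kL (?S \<otimes>\<^sub>s kL) (d m) (\<lambda>m0 k. pt ?S kL (d m0) k)" for m
  define pd where "pd m = tsum V kL ?S (d m) (\<lambda>m0 k. pt V kL (p m0) k)" for m
  define \<iota>3 where "\<iota>3 t = tsum ?S kL ?T t (\<lambda>s k. tsum V kL ?T s (\<lambda>m k'. ?pt m (emb k') (emb k)))" for t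
  define \<iota>l where "\<iota>l t = tsum V kL ?T t (\<lambda>m k. ?pt m (emb k) (kone X))" for t
  define \<iota>r where "\<iota>r t = tsum V kL ?T t (\<lambda>m k. ?pt m (kone X) (emb k))" for t
  have c: "dd m \<in> carrier (?S \<otimes>\<^sub>s kL)" "pd m \<in> carrier ?S" if "m \<in> carrier V" for m
    using that by (simp_all add: dd_def pd_def)
  \<comment> \<open>the four components of the iterated coaction\<close>
  have tw: "twice m = (\<iota>3 (dd m) \<oplus>\<^bsub>?T\<^esub> \<iota>l (d (p m))) \<oplus>\<^bsub>?T\<^esub> (\<iota>r (pd m) \<oplus>\<^bsub>?T\<^esub> ?pt (p (p m)) (kone X) (kone X))"
    if "m \<in> carrier V" for m
    using that unfolding twice_def dd_def pd_def \<iota>3_def \<iota>l_def \<iota>r_def tensor_map_def vect_assoc_def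
        Let_def id_def
    by (simp add: sweedler_tsum[of V P] sweedler_tsum[of "V \<otimes>\<^sub>s P" P] tsum_ycoact vs_ac)
  have \<sigma>: "sigma X q = tsum P P ?PP q (\<lambda>u v. unit_part u \<odot>\<^bsub>?PP\<^esub> kcomult X v)" if "q \<in> carrier ?PP" for q
    using that by (simp add: sigma_def Let_def plus_counit_def sweedler_tsum[of P P])
  have "lin ?PP ?PP (\<lambda>q. tsum P P ?PP q (\<lambda>u v. unit_part u \<odot>\<^bsub>?PP\<^esub> kcomult X v))"
    using lin_comp[OF lin_kcomult] by simp
  then have \<sigma>_lin: "lin ?PP ?PP (sigma X)" by (rule lin_cong) (auto simp: \<sigma>)
  have sg: "tensor_map KK V ?PP id (sigma X) (twice m) =
      \<iota>l (pd m) \<oplus>\<^bsub>?T\<^esub> (\<iota>r (pd m) \<oplus>\<^bsub>?T\<^esub> ?pt (p (p m)) (kone X) (kone X))"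
    if "m \<in> carrier V" for m
    using that c[OF that] lin_comp[OF lin_kcomult] lin_comp[OF \<sigma>_lin] unfolding tw[OF that] \<iota>3_def
        \<iota>l_def \<iota>r_def tensor_map_def id_def
    by (simp add: sweedler_tsum[of V ?PP] \<sigma> kcomult_emb kcomult_one vs_ac)
  \<comment> \<open>the projections to \<open>\<kk> \<otimes> \<kk>\<close> and to \<open>\<kk> \<otimes> 1\<close>, applied to both sides of the axiom\<close>
  have \<Phi>1: "tsum V ?PP (?S \<otimes>\<^sub>s kL) (twice m) (\<lambda>m q. tsum P P (?S \<otimes>\<^sub>s kL) q (\<lambda>u v. pt ?S kL (pt V kL m
      (alg_part u)) (alg_part v))) = dd m"
    "tsum V ?PP (?S \<otimes>\<^sub>s kL) (tensor_map KK V ?PP id (sigma X) (twice m)) (\<lambda>m q. tsum P P (?S \<otimes>\<^sub>s kL) q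
        (\<lambda>u v. pt ?S kL (pt V kL m (alg_part u)) (alg_part v))) = \<zero>\<^bsub>?S \<otimes>\<^sub>s kL\<^esub>"
    "tsum V ?PP ?S (twice m) (\<lambda>m q. tsum P P ?S q (\<lambda>u v. unit_part v \<odot>\<^bsub>?S\<^esub> pt V kL m (alg_part u))) =
        d (p m)"
    "tsum V ?PP ?S (tensor_map KK V ?PP id (sigma X) (twice m)) (\<lambda>m q. tsum P P ?S q (\<lambda>u v.
        unit_part v \<odot>\<^bsub>?S\<^esub> pt V kL m (alg_part u))) = pd m"
    if "m \<in> carrier V" for m
    unfolding sg[OF that] unfolding tw[OF that] unfolding \<iota>3_def \<iota>l_def \<iota>r_def
    using that c[OF that] by simp_all
  show ?thesis
    unfolding yd_coaction_axiom_def Let_def twice_def[symmetric] dd_def[symmetric] pd_def[symmetric]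
  proof (intro ball_cong HOL.refl iffI)
    fix m assume m: "m \<in> carrier V" and "twice m = tensor_map KK V ?PP id (sigma X) (twice m)"
    then show "dd m = \<zero>\<^bsub>?S \<otimes>\<^sub>s kL\<^esub> \<and> d (p m) = pd m" by (metis \<Phi>1)
  next
    fix m assume m: "m \<in> carrier V" and *: "dd m = \<zero>\<^bsub>?S \<otimes>\<^sub>s kL\<^esub> \<and> d (p m) = pd m"
    then have "\<iota>3 (dd m) = \<zero>\<^bsub>?T\<^esub>" by (simp add: \<iota>3_def)
    moreover have "\<iota>l (pd m) \<in> carrier ?T" "\<iota>r (pd m) \<in> carrier ?T" by (simp_all add: \<iota>l_def \<iota>r_def)
    ultimately show "twice m = tensor_map KK V ?PP id (sigma X) (twice m)"
      unfolding sg[OF m] unfolding tw[OF m] using * m by simp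
  qed
qed

lemma yd_moduleI:
  assumes "\<And>m x y. m \<in> carrier V \<Longrightarrow> x \<in> carrier gL \<Longrightarrow> y \<in> carrier gL \<Longrightarrow>
      a (a m y) x = a (a m x) y \<oplus>\<^bsub>V\<^esub> a m (gbr y x)"
    and "\<And>x. x \<in> carrier gL \<Longrightarrow> \<forall>m\<in>carrier V.
      d (a m x) = tsum V kL (V \<otimes>\<^sub>s kL) (d m) (\<lambda>m0 k. pt V kL m0 (xact X k x) \<oplus>\<^bsub>V \<otimes>\<^sub>s kL\<^esub> pt V kL (a m0
          x) k)"
    and "\<And>x. x \<in> carrier gL \<Longrightarrow> \<forall>m\<in>carrier V. p (a m x) = a (p m) x"
    and "\<forall>m\<in>carrier V. tsum V kL ((V \<otimes>\<^sub>s kL) \<otimes>\<^sub>s kL) (d m) (\<lambda>m0 k. pt (V \<otimes>\<^sub>s kL) kL (d m0) k) = \<zero>\<^bsub>(V \<otimes>\<^sub>s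
        kL) \<otimes>\<^sub>s kL\<^esub>"
    and "\<forall>m\<in>carrier V. d (p m) = tsum V kL (V \<otimes>\<^sub>s kL) (d m) (\<lambda>m0 k. pt V kL (p m0) k)"
  shows "yd_module X M"
proof -
  have "yd_action_axiom X M" unfolding action_axiom_iff using assms(1) by blast
  moreover have "yd_coaction_axiom X M" unfolding coaction_axiom_iff using assms(4,5) by blast
  moreover have "yd_compatibility X M" unfolding compatibility_iff using assms(2,3) by blast
  ultimately show ?thesis unfolding yd_module_def using bil_yact lin_ycoact vs_M by blast
qed

end

context leibniz_xmod
begin

section \<open>Objects\<close>

definition yd_object :: "('a, 'k) yd \<Rightarrow> bool" where "yd_object M \<longleftrightarrow> yd_module X M \<and> unital_action X M"

definition gact :: "('a, 'k) yd \<Rightarrow> ('a, 'k) binop" where "gact M m x = yact M m (emb x)"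

text \<open>
  The components of the coaction of a module in \<open>M \<otimes> \<kk>\<close> and, below, in \<open>M \<otimes> K1 = M\<close>.
\<close>

definition coact0 :: "('a, 'k) yd \<Rightarrow> ('a, 'k) endo" where
  "coact0 M m = tsum (yspace M) P (yspace M \<otimes>\<^sub>s kL) (ycoact M m) (\<lambda>m0 m1. pt (yspace M) kL m0
      (alg_part m1))"

definition coeff1 :: "('a, 'k) yd \<Rightarrow> ('a, 'k) endo" where
  "coeff1 M m = tsum (yspace M) P (yspace M) (ycoact M m) (\<lambda>m0 m1. unit_part m1 \<odot>\<^bsub>yspace M\<^esub> m0)"

lemma PG_decomp:
  "q \<in> carrier P \<Longrightarrow> emb (alg_part q) \<oplus>\<^bsub>P\<^esub> unit_part q \<odot>\<^bsub>P\<^esub> kone X = q"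
  "q \<in> carrier G \<Longrightarrow> emb (alg_part q) \<oplus>\<^bsub>G\<^esub> unit_part q \<odot>\<^bsub>G\<^esub> gone X = q"
  unfolding kplus_def gplus_def kone_def gone_def by (intro plus_decomp; simp)+

text \<open>
  Every object is an instance of the split data; from now on its structure is used only through
  \<^const>\<open>gact\<close>, \<^const>\<open>coact0\<close> and \<^const>\<open>coeff1\<close>.
\<close>

lemma split_object:
  assumes "yd_object M"
  shows "split_coaction X M (gact M) (coact0 M) (coeff1 M)"
proof (intro split_coaction.intro split_coaction_axioms.intro leibniz_xmod_axioms)
  let ?V = "yspace M"
  show V: "vs ?V" using assms by (simp add: yd_object_def yd_module_def)
  have act: "bil ?V G ?V (yact M)" and coact: "lin ?V (?V \<otimes>\<^sub>s P) (ycoact M)"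
    and unit: "\<And>m. m \<in> carrier ?V \<Longrightarrow> yact M m (gone X) = m"
    using assms by (simp_all add: yd_object_def yd_module_def unital_action_def del: bil_iff)
  note rules = V bil_lin[OF act] lin_comp[OF coact] bil_push[OF act V vs_PG(2) V]
  show "bil ?V gL ?V (gact M)" unfolding gact_def[abs_def] using rules by simp
  show "lin ?V (?V \<otimes>\<^sub>s kL) (coact0 M)" unfolding coact0_def[abs_def] using rules by simp
  show "lin ?V ?V (coeff1 M)" unfolding coeff1_def[abs_def] using rules by simp
  fix m assume m: "m \<in> carrier ?V"
  then have c: "ycoact M m \<in> carrier (?V \<otimes>\<^sub>s P)" using linD(1)[OF coact] by simp
  show "yact M m q = gact M m (alg_part q) \<oplus>\<^bsub>?V\<^esub> unit_part q \<odot>\<^bsub>?V\<^esub> m" if q: "q \<in> carrier G" for q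
  proof -
    have "yact M m (emb (alg_part q) \<oplus>\<^bsub>G\<^esub> unit_part q \<odot>\<^bsub>G\<^esub> gone X) = yact M m (emb (alg_part q)) \<oplus>\<^bsub>?V\<^esub>
        unit_part q \<odot>\<^bsub>?V\<^esub> m"
      using bil_push(2,4)[OF act V vs_PG(2) V] m q unit[OF m] by simp
    then show ?thesis by (simp add: PG_decomp q gact_def)
  qed
  have "ycoact M m = tsum ?V P (?V \<otimes>\<^sub>s P) (ycoact M m) (\<lambda>m0 m1. pt ?V P m0 (emb (alg_part m1) \<oplus>\<^bsub>P\<^esub>
      unit_part m1 \<odot>\<^bsub>P\<^esub> kone X))"
    by (rule HOL.trans[OF tsum_id[OF V vs_PG(1) c, symmetric]], rule tsum_cong) (simp_all only:
        PG_decomp)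
  also have "\<dots> = tsum ?V kL (?V \<otimes>\<^sub>s P) (coact0 M m) (\<lambda>m0 k. pt ?V P m0 (emb k)) \<oplus>\<^bsub>?V \<otimes>\<^sub>s P\<^esub> pt ?V P
      (coeff1 M m) (kone X)"
    using V c m by (simp add: coact0_def coeff1_def)
  finally show "ycoact M m = tsum ?V kL (?V \<otimes>\<^sub>s P) (coact0 M m) (\<lambda>m0 k. pt ?V P m0 (emb k))
        \<oplus>\<^bsub>?V \<otimes>\<^sub>s P\<^esub> pt ?V P (coeff1 M m) (kone X)" .
qed

lemmas obj_vs [simp] = split_coaction.vs_M[OF split_object]
lemmas obj_act [simp] = split_coaction.a_simps[OF split_object]
lemmas obj_coact0 [simp] = split_coaction.d_simps[OF split_object]
lemmas obj_coeff1 [simp] = split_coaction.p_simps[OF split_object]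
lemmas obj_yact [simp] = split_coaction.a_parts[OF split_object] split_coaction.yact_simps[OF
    split_object]
lemmas obj_ycoact [simp] = split_coaction.ycoact_simps[OF split_object]

lemma obj_tsum_ycoact [simp]:
  assumes "yd_object M" "vs Z" "bil (yspace M) P Z b" "m \<in> carrier (yspace M)"
  shows "tsum (yspace M) P Z (ycoact M m) b =
    tsum (yspace M) kL Z (coact0 M m) (\<lambda>m0 k. b m0 (emb k)) \<oplus>\<^bsub>Z\<^esub> b (coeff1 M m) (kone X)"
  by (rule split_coaction.tsum_ycoact[OF split_object]) (rule assms)+

lemma obj_axioms:
  assumes M: "yd_object M"
  shows obj_leib: "m \<in> carrier (yspace M) \<Longrightarrow> x \<in> carrier gL \<Longrightarrow> y \<in> carrier gL \<Longrightarrow>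
      gact M (gact M m y) x = gact M (gact M m x) y \<oplus>\<^bsub>yspace M\<^esub> gact M m (gbr y x)"
    and obj_coact0_act [simp]: "m \<in> carrier (yspace M) \<Longrightarrow> x \<in> carrier gL \<Longrightarrow>
      coact0 M (gact M m x) = tsum (yspace M) kL (yspace M \<otimes>\<^sub>s kL) (coact0 M m) (\<lambda>m0 k.
        pt (yspace M) kL m0 (xact X k x) \<oplus>\<^bsub>yspace M \<otimes>\<^sub>s kL\<^esub> pt (yspace M) kL (gact M m0 x) k)"
    and obj_coeff1_act [simp]: "m \<in> carrier (yspace M) \<Longrightarrow> x \<in> carrier gL \<Longrightarrow> coeff1 M (gact M m x) =
        gact M (coeff1 M m) x"
    and obj_coact0_square_tensor: "m \<in> carrier (yspace M) \<Longrightarrow> tsum (yspace M) kL ((yspace M \<otimes>\<^sub>s kL) \<otimes>\<^sub>s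
        kL) (coact0 M m)
       (\<lambda>m0 k. pt (yspace M \<otimes>\<^sub>s kL) kL (coact0 M m0) k) = \<zero>\<^bsub>(yspace M \<otimes>\<^sub>s kL) \<otimes>\<^sub>s kL\<^esub>"
    and obj_coact0_coeff1 [simp]: "m \<in> carrier (yspace M) \<Longrightarrow>
      coact0 M (coeff1 M m) = tsum (yspace M) kL (yspace M \<otimes>\<^sub>s kL) (coact0 M m) (\<lambda>m0 k. pt (yspace M)
          kL (coeff1 M m0) k)"
  using split_coaction.action_axiom_iff[OF split_object[OF M]] split_coaction.coaction_axiom_iff[OF
      split_object[OF M]]
    split_coaction.compatibility_iff[OF split_object[OF M]] M[unfolded yd_object_def yd_module_def]
  by blast+

text \<open>
  The equation \<open>(\<delta>\<^sub>0 \<otimes> id) \<delta>\<^sub>0 = 0\<close> in the form in which it occurs inside a computation: any expression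
  that is trilinear in the three Sweedler components sums to zero.
\<close>

lemma obj_coact0_square [simp]:
  assumes M: "yd_object M" and m: "m \<in> carrier (yspace M)" and Z: "vs Z"
    and F: "\<And>k. k \<in> carrier kL \<Longrightarrow> bil (yspace M) kL Z (\<lambda>m0 k0. F m0 k0 k)"
     "\<And>m0 k0. m0 \<in> carrier (yspace M) \<Longrightarrow> k0 \<in> carrier kL \<Longrightarrow> lin kL Z (\<lambda>k. F m0 k0 k)"
  shows "tsum (yspace M) kL Z (coact0 M m) (\<lambda>m0 k. tsum (yspace M) kL Z (coact0 M m0) (\<lambda>m00 k0. F
      m00 k0 k)) = \<zero>\<^bsub>Z\<^esub>"
proof -
  let ?V = "yspace M"
  have "tsum (?V \<otimes>\<^sub>s kL) kL Z (tsum ?V kL ((?V \<otimes>\<^sub>s kL) \<otimes>\<^sub>s kL) (coact0 M m) (\<lambda>m0 k. pt (?V \<otimes>\<^sub>s kL) kL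
      (coact0 M m0) k))
    (\<lambda>s k. tsum ?V kL Z s (\<lambda>m0 k0. F m0 k0 k)) = \<zero>\<^bsub>Z\<^esub>"
    unfolding obj_coact0_square_tensor[OF M m] using M Z F by simp
  then show ?thesis using M m Z F by simp
qed

text \<open>
  The two coactions need not be adjacent: another sum can stand between them.
\<close>

lemma obj_coact0_square_nested [simp]:
  assumes M: "yd_object M" and m: "m \<in> carrier (yspace M)" and Z: "vs Z"
    and F: "\<And>k u v. k \<in> carrier kL \<Longrightarrow> u \<in> carrier A \<Longrightarrow> v \<in> carrier B \<Longrightarrow> bil (yspace M) kL Z (\<lambda>m0 k0. F
        m0 k0 k u v)"
     "\<And>m0 k0 u v. m0 \<in> carrier (yspace M) \<Longrightarrow> k0 \<in> carrier kL \<Longrightarrow> u \<in> carrier A \<Longrightarrow> v \<in> carrier B \<Longrightarrow> lin kL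
         Z (\<lambda>k. F m0 k0 k u v)"
  shows "tsum (yspace M) kL Z (coact0 M m) (\<lambda>m0 k. tsum A B Z t (\<lambda>u v. tsum (yspace M) kL Z (coact0
      M m0) (\<lambda>m00 k0. F m00 k0 k u v))) = \<zero>\<^bsub>Z\<^esub>"
proof -
  let ?V = "yspace M"
  have F': "F m0 k0 k u v \<in> carrier Z" if "m0 \<in> carrier ?V" "k0 \<in> carrier kL" "k \<in> carrier kL" "u \<in>
      carrier A" "v \<in> carrier B" for m0 k0 k u v
    using linD(1)[OF F(2)] that by simp
  have "tsum ?V kL Z (coact0 M m) (\<lambda>m0 k. tsum A B Z t (\<lambda>u v. tsum ?V kL Z (coact0 M m0) (\<lambda>m00 k0. F
      m00 k0 k u v)))
    = tsum A B Z t (\<lambda>u v. tsum ?V kL Z (coact0 M m) (\<lambda>m0 k. tsum ?V kL Z (coact0 M m0) (\<lambda>m00 k0. F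
        m00 k0 k u v)))"
    using Z F' by (intro tsum_swap) auto
  then show ?thesis using obj_coact0_square[OF M m Z F] Z by simp
qed

text \<open>
  The split data of a module are determined by the module.
\<close>

lemma yd_objectI:
  assumes "split_coaction X M a d p" "yd_module X M"
  shows "yd_object M" "m \<in> carrier (yspace M) \<Longrightarrow> x \<in> carrier gL \<Longrightarrow> gact M m x = a m x"
    "m \<in> carrier (yspace M) \<Longrightarrow> coact0 M m = d m" "m \<in> carrier (yspace M) \<Longrightarrow> coeff1 M m = p m"
  unfolding yd_object_def gact_def coact0_def coeff1_def
  using assms split_coaction.unital[OF assms(1)] split_coaction.a_parts(2)[OF assms(1)]
      split_coaction.d_eq[OF assms(1)] split_coaction.p_eq[OF assms(1)]
  by blast+

text \<open>
  Quantified so that \<open>F\<close> and \<open>H\<close> are found by pattern unification, and so that the rule can be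
  iterated when the left factor is itself a tensor product.
\<close>

lemma tensor_ball_ext:
  assumes "vs V" "vs W" "vs Z" "lin (V \<otimes>\<^sub>s W) Z F" "lin (V \<otimes>\<^sub>s W) Z H"
   "\<And>y. y \<in> carrier W \<Longrightarrow> \<forall>x\<in>carrier V. F (pt V W x y) = H (pt V W x y)"
  shows "\<forall>t\<in>carrier (V \<otimes>\<^sub>s W). F t = H t"
  using assms tensor_ext[OF assms(1-3) _ assms(4,5)] by blast

section \<open>Tensor products of Yetter-Drinfel'd modules\<close>

abbreviation yt (infixr \<open>\<otimes>\<^sub>y\<close> 71) where "M \<otimes>\<^sub>y N \<equiv> yd_tensor X M N"

lemma yspace_tensor [simp]: "yspace (M \<otimes>\<^sub>y N) = yspace M \<otimes>\<^sub>s yspace N"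
  by (simp add: yd_tensor_def Let_def)

text \<open>
  The three definitions that follow are the split data of a tensor product. They come from multiplying
  \<open>(k + a1) \<cdot> (l + b1) = [k, l] + b k + (a b)1\<close>, where \<open>1 \<cdot> l = 0\<close> is responsible for the
  absence of a term with \<open>\<delta>\<^sub>0\<close> only on the right factor.
\<close>

definition act_tensor where
  "act_tensor M N t x = tsum (yspace M) (yspace N) (yspace M \<otimes>\<^sub>s yspace N) t (\<lambda>m n.
     pt (yspace M) (yspace N) m (gact N n x) \<oplus>\<^bsub>yspace M \<otimes>\<^sub>s yspace N\<^esub> pt (yspace M) (yspace N) (gact M
         m x) n)"

definition coact0_tensor where
  "coact0_tensor M N t = (let T = yspace M \<otimes>\<^sub>s yspace N in
     tsum (yspace M) (yspace N) (T \<otimes>\<^sub>s kL) t (\<lambda>m n. tsum (yspace M) kL (T \<otimes>\<^sub>s kL) (coact0 M m) (\<lambda>m0 k.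
        pt T kL (pt (yspace M) (yspace N) m0 (coeff1 N n)) k \<oplus>\<^bsub>T \<otimes>\<^sub>s kL\<^esub>
        tsum (yspace N) kL (T \<otimes>\<^sub>s kL) (coact0 N n) (\<lambda>n0 l. pt T kL (pt (yspace M) (yspace N) m0 n0)
            (br k l)))))"

definition coeff1_tensor where
  "coeff1_tensor M N t = tsum (yspace M) (yspace N) (yspace M \<otimes>\<^sub>s yspace N) t (\<lambda>m n.
     pt (yspace M) (yspace N) (coeff1 M m) (coeff1 N n))"

lemma split_tensor:
  assumes M: "yd_object M" and N: "yd_object N"
  shows "split_coaction X (M \<otimes>\<^sub>y N) (act_tensor M N) (coact0_tensor M N) (coeff1_tensor M N)"
proof (intro split_coaction.intro split_coaction_axioms.intro leibniz_xmod_axioms)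
  show "vs (yspace (M \<otimes>\<^sub>y N))" using M N by simp
  show "bil (yspace (M \<otimes>\<^sub>y N)) gL (yspace (M \<otimes>\<^sub>y N)) (act_tensor M N)"
    unfolding act_tensor_def[abs_def] using M N by simp
  show "lin (yspace (M \<otimes>\<^sub>y N)) (yspace (M \<otimes>\<^sub>y N) \<otimes>\<^sub>s kL) (coact0_tensor M N)"
    unfolding coact0_tensor_def[abs_def] Let_def using M N by simp
  show "lin (yspace (M \<otimes>\<^sub>y N)) (yspace (M \<otimes>\<^sub>y N)) (coeff1_tensor M N)"
    unfolding coeff1_tensor_def[abs_def] Let_def using M N by simp
next
  fix t q assume "t \<in> carrier (yspace (M \<otimes>\<^sub>y N))" "q \<in> carrier G"
  then show "yact (M \<otimes>\<^sub>y N) t q = act_tensor M N t (alg_part q) \<oplus>\<^bsub>yspace (M \<otimes>\<^sub>y N)\<^esub> unit_part q \<odot>\<^bsub>yspace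
      (M \<otimes>\<^sub>y N)\<^esub> t"
    using M N by (simp add: yd_tensor_def Let_def sweedler_tsum[of "yspace M" "yspace N"]
        act_tensor_def del: tsum_plus)
next
  fix t assume "t \<in> carrier (yspace (M \<otimes>\<^sub>y N))"
  then show "ycoact (M \<otimes>\<^sub>y N) t = tsum (yspace (M \<otimes>\<^sub>y N)) kL (yspace (M \<otimes>\<^sub>y N) \<otimes>\<^sub>s P) (coact0_tensor M N t)
      (\<lambda>m0 k. pt (yspace (M \<otimes>\<^sub>y N)) P m0 (emb k)) \<oplus>\<^bsub>yspace (M \<otimes>\<^sub>y N) \<otimes>\<^sub>s P\<^esub>
      pt (yspace (M \<otimes>\<^sub>y N)) P (coeff1_tensor M N t) (kone X)"
    using M N by (simp add: yd_tensor_def Let_def sweedler_tsum[of "yspace M" "yspace N"]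
       sweedler_tsum[of "yspace M" P] sweedler_tsum[of "yspace N" P] coact0_tensor_def
           coeff1_tensor_def vs_ac)
qed

text \<open>
  Equivariance of \<open>\<delta>\<^sub>0\<close> holds because \<open>\<gg>\<close> acts on \<open>\<kk>\<close> by derivations. The other conditions are
  inherited from the factors; \<open>\<delta>\<^sub>0\<close> squares to zero because it always involves \<open>\<delta>\<^sub>0\<close> of the left factor.
\<close>

lemma yd_module_tensor:
  assumes M: "yd_object M" and N: "yd_object N"
  shows "yd_module X (M \<otimes>\<^sub>y N)"
proof (rule split_coaction.yd_moduleI[OF split_tensor[OF M N]])
  let ?A = "yspace M" and ?B = "yspace N"
  let ?T = "?A \<otimes>\<^sub>s ?B"
  note MN = M N
  show "act_tensor M N (act_tensor M N t y) x = act_tensor M N (act_tensor M N t x) y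
        \<oplus>\<^bsub>yspace (M \<otimes>\<^sub>y N)\<^esub> act_tensor M N t (gbr y x)"
    if t: "t \<in> carrier (yspace (M \<otimes>\<^sub>y N))" and x: "x \<in> carrier gL" and y: "y \<in> carrier gL" for t x y
  proof -
    have "\<forall>t\<in>carrier ?T. act_tensor M N (act_tensor M N t y) x = act_tensor M N (act_tensor M N t x) y
        \<oplus>\<^bsub>?T\<^esub> act_tensor M N t (gbr y x)"
      unfolding act_tensor_def
      by (rule tensor_ball_ext[of ?A ?B ?T])
        (use MN x y in \<open>simp_all add: obj_leib[of _ _ x y] vs_ac\<close>)
    with t show ?thesis by simp
  qed
  show "\<forall>t\<in>carrier (yspace (M \<otimes>\<^sub>y N)). coact0_tensor M N (act_tensor M N t x) =
    tsum (yspace (M \<otimes>\<^sub>y N)) kL (yspace (M \<otimes>\<^sub>y N) \<otimes>\<^sub>s kL) (coact0_tensor M N t)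
     (\<lambda>m0 k. pt (yspace (M \<otimes>\<^sub>y N)) kL m0 (xact X k x) \<oplus>\<^bsub>yspace (M \<otimes>\<^sub>y N) \<otimes>\<^sub>s kL\<^esub>
       pt (yspace (M \<otimes>\<^sub>y N)) kL (act_tensor M N m0 x) k)"
    if x: "x \<in> carrier gL" for x
    unfolding act_tensor_def coact0_tensor_def yspace_tensor Let_def
    by (rule tensor_ball_ext[of ?A ?B "?T \<otimes>\<^sub>s kL"]) (use MN x in \<open>simp_all add: vs_ac\<close>)
  show "\<forall>t\<in>carrier (yspace (M \<otimes>\<^sub>y N)). coeff1_tensor M N (act_tensor M N t x) = act_tensor M N
      (coeff1_tensor M N t) x"
    if x: "x \<in> carrier gL" for x
    unfolding act_tensor_def coeff1_tensor_def yspace_tensor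
    by (rule tensor_ball_ext[of ?A ?B "?T"]) (use MN x in \<open>simp_all add: vs_ac\<close>)
  show "\<forall>t\<in>carrier (yspace (M \<otimes>\<^sub>y N)).
     tsum (yspace (M \<otimes>\<^sub>y N)) kL ((yspace (M \<otimes>\<^sub>y N) \<otimes>\<^sub>s kL) \<otimes>\<^sub>s kL) (coact0_tensor M N t)
      (\<lambda>m0 k. pt (yspace (M \<otimes>\<^sub>y N) \<otimes>\<^sub>s kL) kL (coact0_tensor M N m0) k) =
     \<zero>\<^bsub>(yspace (M \<otimes>\<^sub>y N) \<otimes>\<^sub>s kL) \<otimes>\<^sub>s kL\<^esub>"
    unfolding coact0_tensor_def yspace_tensor Let_def
    by (rule tensor_ball_ext[of ?A ?B "(?T \<otimes>\<^sub>s kL) \<otimes>\<^sub>s kL"]) (use MN in \<open>simp_all add: vs_ac\<close>)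
  show "\<forall>t\<in>carrier (yspace (M \<otimes>\<^sub>y N)). coact0_tensor M N (coeff1_tensor M N t) =
     tsum (yspace (M \<otimes>\<^sub>y N)) kL (yspace (M \<otimes>\<^sub>y N) \<otimes>\<^sub>s kL) (coact0_tensor M N t)
      (\<lambda>m0 k. pt (yspace (M \<otimes>\<^sub>y N)) kL (coeff1_tensor M N m0) k)"
    unfolding coact0_tensor_def coeff1_tensor_def yspace_tensor Let_def
    by (rule tensor_ball_ext[of ?A ?B "?T \<otimes>\<^sub>s kL"]) (use MN in \<open>simp_all add: vs_ac\<close>)
qed

lemma yd_object_tensor [simp]: "yd_object M \<Longrightarrow> yd_object N \<Longrightarrow> yd_object (M \<otimes>\<^sub>y N)"
  by (rule yd_objectI(1)[OF split_tensor yd_module_tensor])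

lemma tensor_pt_simps [simp]:
  assumes M: "yd_object M" and N: "yd_object N" and m: "m \<in> carrier (yspace M)" and n: "n \<in> carrier
      (yspace N)"
  defines "T \<equiv> yspace M \<otimes>\<^sub>s yspace N" and "t \<equiv> pt (yspace M) (yspace N)"
  shows "x \<in> carrier gL \<Longrightarrow> gact (M \<otimes>\<^sub>y N) (pt (yspace M) (yspace N) m n) x =
      t m (gact N n x) \<oplus>\<^bsub>T\<^esub> t (gact M m x) n"
    "coeff1 (M \<otimes>\<^sub>y N) (pt (yspace M) (yspace N) m n) = t (coeff1 M m) (coeff1 N n)"
    "coact0 (M \<otimes>\<^sub>y N) (pt (yspace M) (yspace N) m n) = tsum (yspace M) kL (T \<otimes>\<^sub>s kL) (coact0 M m) (\<lambda>m0 k.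
        pt T kL (t m0 (coeff1 N n)) k \<oplus>\<^bsub>T \<otimes>\<^sub>s kL\<^esub>
        tsum (yspace N) kL (T \<otimes>\<^sub>s kL) (coact0 N n) (\<lambda>n0 l. pt T kL (t m0 n0) (br k l)))"
proof -
  have c: "pt (yspace M) (yspace N) m n \<in> carrier (yspace (M \<otimes>\<^sub>y N))" using m n by simp
  note r = yd_objectI(2-)[OF split_tensor[OF M N] yd_module_tensor[OF M N] c]
  show "x \<in> carrier gL \<Longrightarrow> gact (M \<otimes>\<^sub>y N) (pt (yspace M) (yspace N) m n) x =
      t m (gact N n x) \<oplus>\<^bsub>T\<^esub> t (gact M m x) n"
    "coeff1 (M \<otimes>\<^sub>y N) (pt (yspace M) (yspace N) m n) = t (coeff1 M m) (coeff1 N n)"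
    "coact0 (M \<otimes>\<^sub>y N) (pt (yspace M) (yspace N) m n) = tsum (yspace M) kL (T \<otimes>\<^sub>s kL) (coact0 M m) (\<lambda>m0 k.
        pt T kL (t m0 (coeff1 N n)) k \<oplus>\<^bsub>T \<otimes>\<^sub>s kL\<^esub>
        tsum (yspace N) kL (T \<otimes>\<^sub>s kL) (coact0 N n) (\<lambda>n0 l. pt T kL (t m0 n0) (br k l)))"
    using M N m n
    by (simp_all add: r act_tensor_def coact0_tensor_def coeff1_tensor_def Let_def T_def t_def del:
        tsum_plus)
qed

section \<open>Morphisms\<close>

lemma lin_restrict: "lin V W (restrict f (carrier V)) \<longleftrightarrow> lin V W f" if "vs V"
  using that by (auto simp: linear_map_def Pi_iff)

lemma yd_hom_tensor_map:
  assumes M: "yd_object M" and N: "yd_object N" and f: "lin (yspace M) (yspace N) f" and m: "m \<in>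
      carrier (yspace M)"
  defines "V \<equiv> yspace N"
  shows "tensor_map KK V P f id (ycoact M m) =
    tsum V kL (V \<otimes>\<^sub>s P) (tsum (yspace M) kL (V \<otimes>\<^sub>s kL) (coact0 M m) (\<lambda>m0 k. pt V kL (f m0) k))
      (\<lambda>n0 k. pt V P n0 (emb k)) \<oplus>\<^bsub>V \<otimes>\<^sub>s P\<^esub> pt V P (f (coeff1 M m)) (kone X)"
  using M N m lin_comp[OF f] linD(1)[OF f]
  by (simp add: V_def tensor_map_def sweedler_tsum[of "yspace M" P])

text \<open>
  A linear map is compatible with the coactions exactly if it is compatible with both components.
\<close>

lemma yd_hom_iff:
  assumes M: "yd_object M" and N: "yd_object N"
  shows "yd_hom X M N f \<longleftrightarrow> lin (yspace M) (yspace N) f \<and> f \<in> extensional (carrier (yspace M)) \<and>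
    (\<forall>x\<in>carrier gL. \<forall>m\<in>carrier (yspace M). f (gact M m x) = gact N (f m) x) \<and>
    (\<forall>m\<in>carrier (yspace M). f (coeff1 M m) = coeff1 N (f m)) \<and>
    (\<forall>m\<in>carrier (yspace M). tsum (yspace M) kL (yspace N \<otimes>\<^sub>s kL) (coact0 M m) (\<lambda>m0 k. pt (yspace N)
        kL (f m0) k) =
      coact0 N (f m))"
proof (cases "lin (yspace M) (yspace N) f")
  case f: True
  note fs = linD[OF f] lin_comp[OF f]
  have 1: "(\<forall>m\<in>carrier (yspace M). \<forall>g\<in>carrier G. f (yact M m g) = yact N (f m) g) \<longleftrightarrow>
    (\<forall>x\<in>carrier gL. \<forall>m\<in>carrier (yspace M). f (gact M m x) = gact N (f m) x)"
  proof
    assume *: "\<forall>m\<in>carrier (yspace M). \<forall>g\<in>carrier G. f (yact M m g) = yact N (f m) g"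
    show "\<forall>x\<in>carrier gL. \<forall>m\<in>carrier (yspace M). f (gact M m x) = gact N (f m) x"
      using * by (simp add: gact_def del: obj_yact)
  next
    assume *: "\<forall>x\<in>carrier gL. \<forall>m\<in>carrier (yspace M). f (gact M m x) = gact N (f m) x"
    show "\<forall>m\<in>carrier (yspace M). \<forall>g\<in>carrier G. f (yact M m g) = yact N (f m) g"
      using M N * by (simp add: split_coaction.act_eq[OF split_object] fs)
  qed
  have 2: "(ycoact N (f m) = tensor_map KK (yspace N) P f id (ycoact M m)) \<longleftrightarrow>
    f (coeff1 M m) = coeff1 N (f m) \<and> tsum (yspace M) kL (yspace N \<otimes>\<^sub>s kL) (coact0 M m) (\<lambda>m0 k. pt
        (yspace N) kL (f m0) k) =
      coact0 N (f m)" if m: "m \<in> carrier (yspace M)" for m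
  proof
    assume "ycoact N (f m) = tensor_map KK (yspace N) P f id (ycoact M m)"
    then have "coact0 N (f m) = tsum (yspace M) kL (yspace N \<otimes>\<^sub>s kL) (coact0 M m) (\<lambda>m0 k. pt (yspace
        N) kL (f m0) k)
      \<and> coeff1 N (f m) = f (coeff1 M m)"
      unfolding yd_hom_tensor_map[OF M N f m] split_coaction.coact_eq[OF split_object[OF N] fs(1)[OF m]]
      by (rule split_coaction.plus_coeff_inj[OF split_object[OF N], rotated 4]) (use M N m fs(1) in
          simp_all)
    then show "f (coeff1 M m) = coeff1 N (f m) \<and> tsum (yspace M) kL (yspace N \<otimes>\<^sub>s kL) (coact0 M m)
        (\<lambda>m0 k. pt (yspace N) kL (f m0) k) =
      coact0 N (f m)" by simp
  next
    assume "f (coeff1 M m) = coeff1 N (f m) \<and> tsum (yspace M) kL (yspace N \<otimes>\<^sub>s kL) (coact0 M m) (\<lambda>m0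
        k. pt (yspace N) kL (f m0) k) =
      coact0 N (f m)"
    then show "ycoact N (f m) = tensor_map KK (yspace N) P f id (ycoact M m)"
      unfolding yd_hom_tensor_map[OF M N f m] split_coaction.coact_eq[OF split_object[OF N] fs(1)[OF m]]
      by (simp del: tsum_push)
  qed
  show ?thesis unfolding yd_hom_def using f 1 2 by (simp add: ball_conj_distrib del: bil_iff)
qed (simp add: yd_hom_def)

lemma yd_homI:
  assumes M: "yd_object M" and N: "yd_object N" and f: "lin (yspace M) (yspace N) f"
    and "\<And>x. x \<in> carrier gL \<Longrightarrow> \<forall>m\<in>carrier (yspace M). f (gact M m x) = gact N (f m) x"
    and "\<forall>m\<in>carrier (yspace M). f (coeff1 M m) = coeff1 N (f m)"
    and "\<forall>m\<in>carrier (yspace M). tsum (yspace M) kL (yspace N \<otimes>\<^sub>s kL) (coact0 M m) (\<lambda>m0 k. pt (yspace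
        N) kL (f m0) k) =
      coact0 N (f m)"
  shows "yd_hom X M N (restrict f (carrier (yspace M)))"
  unfolding yd_hom_iff[OF M N] using assms by (simp add: lin_restrict)

lemma yd_homD:
  assumes "yd_hom X M N f" "yd_object M" "yd_object N"
  shows "lin (yspace M) (yspace N) f" "f \<in> extensional (carrier (yspace M))"
    "\<And>x m. x \<in> carrier gL \<Longrightarrow> m \<in> carrier (yspace M) \<Longrightarrow> gact N (f m) x = f (gact M m x)"
    "\<And>m. m \<in> carrier (yspace M) \<Longrightarrow> coeff1 N (f m) = f (coeff1 M m)"
    "\<And>m. m \<in> carrier (yspace M) \<Longrightarrow> coact0 N (f m) = tsum (yspace M) kL (yspace N \<otimes>\<^sub>s kL) (coact0 M m)
        (\<lambda>m0 k. pt (yspace N) kL (f m0) k)"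
  using assms(1) unfolding yd_hom_iff[OF assms(2,3)] by auto

lemma yd_hom_id: "yd_object M \<Longrightarrow> yd_hom X M M (\<lambda>m\<in>carrier (yspace M). m)"
  by (rule yd_homI) simp_all

lemma yd_hom_compose:
  assumes L: "yd_object L" and M: "yd_object M" and N: "yd_object N" and f: "yd_hom X L M f" and g:
      "yd_hom X M N g"
  shows "yd_hom X L N (compose (carrier (yspace L)) g f)"
proof -
  note F = yd_homD[OF f L M] and G = yd_homD[OF g M N]
  note r = F(3-5) G(3-5) linD(1)[OF F(1)] linD(1)[OF G(1)] lin_comp[OF F(1)] lin_comp[OF G(1)]
  have "yd_hom X L N (restrict (\<lambda>m. g (f m)) (carrier (yspace L)))"
    by (rule yd_homI) (use L M N in \<open>simp_all add: r del: bil_iff add: bilinear_map_def\<close>)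
  then show ?thesis by (simp add: compose_def)
qed

section \<open>The category of Yetter-Drinfel'd modules\<close>

abbreviation \<C> where "\<C> \<equiv> yd_category X"

lemma obj_C [simp]: "M \<in> obj \<C> \<longleftrightarrow> yd_object M"
  by (simp add: yd_category_def yd_object_def)

lemma homset_C: "f \<in> homset \<C> M N \<longleftrightarrow> (\<exists>h. f = Arrow M N h \<and> yd_object M \<and> yd_object N \<and> yd_hom X M N h)"
  by (auto simp: homset_def yd_category_def yd_object_def)

lemma arr_C: "f \<in> arr \<C> \<longleftrightarrow> (\<exists>M N h. f = Arrow M N h \<and> yd_object M \<and> yd_object N \<and> yd_hom X M N h)"
  by (auto simp: yd_category_def yd_object_def)

lemma C_simps [simp]: "src \<C> = dom_of" "tgt \<C> = cod_of" "ident \<C> = yd_ident" "comp \<C> = yd_comp"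
  by (simp_all add: yd_category_def)

lemma yd_comp_Arrow [simp]: "yd_comp (Arrow B C g) (Arrow A B' f) = Arrow A C (compose (carrier
    (yspace A)) g f)"
  by (simp add: yd_comp_def)

lemma category_yd: "category \<C>"
proof
  fix f A B assume "f \<in> homset \<C> A B"
  then obtain h where h: "f = Arrow A B h" "yd_object A" "yd_object B" "yd_hom X A B h" by (auto
      simp: homset_C)
  note H = yd_homD(1,2)[OF h(4,2,3)]
  have "compose (carrier (yspace A)) (\<lambda>m\<in>carrier (yspace B). m) h = h"
    using linD(1)[OF H(1)] H(2) by (intro extensionalityI[OF compose_extensional H(2)]) (simp add:
        compose_def)
  then show "comp \<C> (ident \<C> B) f = f" using h by (simp add: yd_ident_def)
  have "compose (carrier (yspace A)) h (\<lambda>m\<in>carrier (yspace A). m) = h"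
    using linD(1)[OF H(1)] H(2) by (intro extensionalityI[OF compose_extensional H(2)]) (simp add:
        compose_def)
  then show "comp \<C> f (ident \<C> A) = f" using h by (simp add: yd_ident_def)
next
  fix f g h A B D E assume "f \<in> homset \<C> A B" "g \<in> homset \<C> B D" "h \<in> homset \<C> D E"
  then obtain f' g' h' where *: "f = Arrow A B f'" "g = Arrow B D g'" "h = Arrow D E h'"
    "yd_object A" "yd_object B" "yd_hom X A B f'" by (auto simp: homset_C)
  have "f' \<in> carrier (yspace A) \<rightarrow> carrier (yspace B)" using linD(1)[OF yd_homD(1)[OF *(6,4,5)]] by auto
  then have "compose (carrier (yspace A)) h' (compose (carrier (yspace A)) g' f') =
     compose (carrier (yspace A)) (compose (carrier (yspace B)) h' g') f'" by (rule compose_assoc)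
  then show "comp \<C> h (comp \<C> g f) = comp \<C> (comp \<C> h g) f" using * by simp
next
  fix A B D f g assume "f \<in> homset \<C> A B" "g \<in> homset \<C> B D"
  then show "comp \<C> g f \<in> homset \<C> A D" by (auto simp: homset_C intro: yd_hom_compose)
qed (auto simp: homset_C arr_C yd_ident_def intro: yd_hom_id)

section \<open>Tensor products of morphisms\<close>

definition arrow_tensor where
  "arrow_tensor M N M' N' f g t = tsum (yspace M) (yspace N) (yspace M' \<otimes>\<^sub>s yspace N') t
     (\<lambda>m n. pt (yspace M') (yspace N') (f m) (g n))"

lemma yd_tensor_arrow_eq:
  assumes "yd_object M" "yd_object N"
  shows "yd_tensor_arrow X (Arrow M M' f) (Arrow N N' g) =
     Arrow (M \<otimes>\<^sub>y N) (M' \<otimes>\<^sub>y N') (\<lambda>t\<in>carrier (yspace M \<otimes>\<^sub>s yspace N). arrow_tensor M N M' N' f g t)"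
  using assms by (auto simp: yd_tensor_arrow_def Let_def tensor_map_def arrow_tensor_def
      sweedler_tsum[of "yspace M" "yspace N"] cong: restrict_cong)

lemma arrow_tensor_pt:
  assumes "yd_object M" "yd_object N" "yd_object M'" "yd_object N'" and f: "lin (yspace M) (yspace
      M') f" and g: "lin (yspace N) (yspace N') g"
    and "m \<in> carrier (yspace M)" "n \<in> carrier (yspace N)"
  shows "arrow_tensor M N M' N' f g (pt (yspace M) (yspace N) m n) = pt (yspace M') (yspace N') (f
      m) (g n)"
  using assms linD(1)[OF f] linD(1)[OF g] lin_comp[OF f] lin_comp[OF g] by (simp add: arrow_tensor_def)

lemma arrow_tensor_lin:
  assumes "yd_object M" "yd_object N" "yd_object M'" "yd_object N'" and f: "lin (yspace M) (yspace
      M') f" and g: "lin (yspace N) (yspace N') g"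
  shows "lin (yspace M \<otimes>\<^sub>s yspace N) (yspace M' \<otimes>\<^sub>s yspace N') (arrow_tensor M N M' N' f g)"
  using assms linD(1)[OF f] linD(1)[OF g] lin_comp[OF f] lin_comp[OF g] by (simp add:
      arrow_tensor_def[abs_def])

text \<open>
  The rules for objects mention \<open>yspace (M \<otimes> N)\<close>, which simplifies to a tensor product of spaces and
  then no longer matches; hence these instances.
\<close>

lemmas obj_tensor [unfolded yspace_tensor, simp] =
  obj_act[of "M \<otimes>\<^sub>y N" for M N] obj_coact0[of "M \<otimes>\<^sub>y N" for M N] obj_coeff1[of "M \<otimes>\<^sub>y N" for M N]
      obj_vs[of "M \<otimes>\<^sub>y N" for M N]

lemma arrow_tensor_hom:
  assumes M: "yd_object M" and N: "yd_object N" and M': "yd_object M'" and N': "yd_object N'"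
    and f: "yd_hom X M M' f" and g: "yd_hom X N N' g"
  shows "yd_hom X (M \<otimes>\<^sub>y N) (M' \<otimes>\<^sub>y N') (\<lambda>t\<in>carrier (yspace M \<otimes>\<^sub>s yspace N). arrow_tensor M N M' N' f g t)"
proof -
  note F = yd_homD[OF f M M'] and G = yd_homD[OF g N N']
  note r = F(3-5) G(3-5) linD(1)[OF F(1)] linD(1)[OF G(1)] lin_comp[OF F(1)] lin_comp[OF G(1)]
    lin_push[OF F(1) obj_vs[OF M] obj_vs[OF M']] lin_push[OF G(1) obj_vs[OF N] obj_vs[OF N']]
  let ?A = "yspace M" and ?B = "yspace N" and ?A' = "yspace M'" and ?B' = "yspace N'"
  note t = arrow_tensor_pt[OF M N M' N' F(1) G(1)] lin_comp[OF arrow_tensor_lin[OF M N M' N' F(1)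
      G(1)]] linD(1)[OF arrow_tensor_lin[OF M N M' N' F(1) G(1)]]
     lin_push[OF arrow_tensor_lin[OF M N M' N' F(1) G(1)] vs_tensor[OF obj_vs[OF M] obj_vs[OF N]]
         vs_tensor[OF obj_vs[OF M'] obj_vs[OF N']]]
  show ?thesis
  proof (rule yd_homI[of "M \<otimes>\<^sub>y N" "M' \<otimes>\<^sub>y N'" "arrow_tensor M N M' N' f g", unfolded yspace_tensor])
    show "\<forall>m\<in>carrier (?A \<otimes>\<^sub>s ?B). arrow_tensor M N M' N' f g (gact (M \<otimes>\<^sub>y N) m x) = gact (M' \<otimes>\<^sub>y N')
        (arrow_tensor M N M' N' f g m) x"
      if "x \<in> carrier gL" for x
      by (rule tensor_ball_ext[of ?A ?B "?A' \<otimes>\<^sub>s ?B'"]) (use M N M' N' that in \<open>simp_all add: t r\<close>)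
    show "\<forall>m\<in>carrier (?A \<otimes>\<^sub>s ?B). arrow_tensor M N M' N' f g (coeff1 (M \<otimes>\<^sub>y N) m) = coeff1 (M' \<otimes>\<^sub>y N')
        (arrow_tensor M N M' N' f g m)"
      by (rule tensor_ball_ext[of ?A ?B "?A' \<otimes>\<^sub>s ?B'"]) (use M N M' N' in \<open>simp_all add: t r\<close>)
    show "\<forall>m\<in>carrier (?A \<otimes>\<^sub>s ?B).
       tsum (?A \<otimes>\<^sub>s ?B) kL ((?A' \<otimes>\<^sub>s ?B') \<otimes>\<^sub>s kL) (coact0 (M \<otimes>\<^sub>y N) m)
        (\<lambda>m0 k. pt (?A' \<otimes>\<^sub>s ?B') kL (arrow_tensor M N M' N' f g m0) k) =
       coact0 (M' \<otimes>\<^sub>y N') (arrow_tensor M N M' N' f g m)"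
      by (rule tensor_ball_ext[of ?A ?B "(?A' \<otimes>\<^sub>s ?B') \<otimes>\<^sub>s kL"]) (use M N M' N' in \<open>simp_all add: t r
          vs_ac\<close>)
  qed (use M N M' N' arrow_tensor_lin[OF M N M' N' F(1) G(1)] in simp_all)
qed

section \<open>The associator\<close>

lemma pi_plus_simps [simp]:
  "x \<in> carrier kL \<Longrightarrow> pi_plus X (emb x) = emb (pi_map X x)"
  "pi_plus X (kone X) = gone X"
  "lin V P f \<Longrightarrow> lin V G (\<lambda>x. pi_plus X (f x))"
proof -
  have "lin P G (pi_plus X)"
    by (rule linI) (auto simp: pi_plus_def kplus_def gplus_def elim!: plus_cases)
  then show "lin V P f \<Longrightarrow> lin V G (\<lambda>x. pi_plus X (f x))" by (rule lin_comp)
qed (simp_all add: pi_plus_def plus_embed_def kone_def gone_def plus_one_def)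

lemma pi_plus_closed [simp]: "q \<in> carrier P \<Longrightarrow> pi_plus X q \<in> carrier G"
  by (auto simp: pi_plus_def kplus_def gplus_def elim!: plus_cases)

text \<open>
  The associator after splitting the coaction of the last factor.
\<close>

definition assoc_map where
  "assoc_map L M N t = (let A = yspace L; B = yspace M; C = yspace N; T = A \<otimes>\<^sub>s B \<otimes>\<^sub>s C in
     tsum (A \<otimes>\<^sub>s B) C T t (\<lambda>s n. tsum A B T s (\<lambda>l m. pt A (B \<otimes>\<^sub>s C) l (pt B C m (coeff1 N n)) \<oplus>\<^bsub>T\<^esub>
       tsum C kL T (coact0 N n) (\<lambda>n0 k. pt A (B \<otimes>\<^sub>s C) (gact L l (pi_map X k)) (pt B C m n0)))))"

lemma yd_assoc_eq:
  assumes "yd_object L" "yd_object M" "yd_object N"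
  shows "yd_assoc X L M N = Arrow ((L \<otimes>\<^sub>y M) \<otimes>\<^sub>y N) (L \<otimes>\<^sub>y M \<otimes>\<^sub>y N)
    (restrict (assoc_map L M N) (carrier ((yspace L \<otimes>\<^sub>s yspace M) \<otimes>\<^sub>s yspace N)))"
  using assms
  by (auto simp: yd_assoc_def assoc_map_def Let_def sweedler_tsum[of "yspace L \<otimes>\<^sub>s yspace M" "yspace N"]
     sweedler_tsum[of "yspace L" "yspace M"] sweedler_tsum[of "yspace N" P] vs_ac intro!: restrict_ext)

lemma assoc_map_lin:
  assumes "yd_object L" "yd_object M" "yd_object N"
  shows "lin ((yspace L \<otimes>\<^sub>s yspace M) \<otimes>\<^sub>s yspace N) (yspace L \<otimes>\<^sub>s yspace M \<otimes>\<^sub>s yspace N) (assoc_map L M N)"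
  unfolding assoc_map_def[abs_def] Let_def using assms by simp

lemma assoc_map_pt [simp]:
  assumes "yd_object L" "yd_object M" "yd_object N" "l \<in> carrier (yspace L)" "m \<in> carrier (yspace
      M)" "n \<in> carrier (yspace N)"
  defines "A \<equiv> yspace L" and "B \<equiv> yspace M" and "C \<equiv> yspace N"
  shows "assoc_map L M N (pt (yspace L \<otimes>\<^sub>s yspace M) (yspace N) (pt (yspace L) (yspace M) l m) n) =
    pt A (B \<otimes>\<^sub>s C) l (pt B C m (coeff1 N n)) \<oplus>\<^bsub>A \<otimes>\<^sub>s B \<otimes>\<^sub>s C\<^esub>
       tsum C kL (A \<otimes>\<^sub>s B \<otimes>\<^sub>s C) (coact0 N n) (\<lambda>n0 k. pt A (B \<otimes>\<^sub>s C) (gact L l (pi_map X k)) (pt B C m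
           n0))"
  unfolding assoc_map_def Let_def A_def B_def C_def using assms(1-6) by simp

lemmas assoc_map_simps [simp] = lin_comp[OF assoc_map_lin] linD(1)[OF assoc_map_lin]

lemma assoc_map_push [simp]:
  assumes "yd_object L" "yd_object M" "yd_object N"
  defines "S \<equiv> (yspace L \<otimes>\<^sub>s yspace M) \<otimes>\<^sub>s yspace N" and "T \<equiv> yspace L \<otimes>\<^sub>s yspace M \<otimes>\<^sub>s yspace N"
  shows "x \<in> carrier S \<Longrightarrow> y \<in> carrier S \<Longrightarrow> assoc_map L M N (x \<oplus>\<^bsub>S\<^esub> y) = assoc_map L M N x \<oplus>\<^bsub>T\<^esub> assoc_map L
      M N y"
    "(\<And>u v. u \<in> carrier D \<Longrightarrow> v \<in> carrier E \<Longrightarrow> F u v \<in> carrier S) \<Longrightarrow>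
      assoc_map L M N (tsum D E S t F) = tsum D E T t (\<lambda>u v. assoc_map L M N (F u v))"
  using lin_push[OF assoc_map_lin[OF assms(1-3)]] assms(1-3) by (simp_all add: S_def T_def)

lemmas obj_tensor_triple [simp] = obj_tensor[of "L \<otimes>\<^sub>y M" N for L M N, unfolded yspace_tensor]
   obj_tensor[of L "M \<otimes>\<^sub>y N" for L M N, unfolded yspace_tensor]
lemmas tensor_pt_triple [simp] = tensor_pt_simps[of "L \<otimes>\<^sub>y M" N for L M N, unfolded yspace_tensor]
   tensor_pt_simps[of L "M \<otimes>\<^sub>y N" for L M N, unfolded yspace_tensor]

lemma tensor_ball_ext3:
  assumes "vs A" "vs B" "vs C" "vs Z" "lin ((A \<otimes>\<^sub>s B) \<otimes>\<^sub>s C) Z F" "lin ((A \<otimes>\<^sub>s B) \<otimes>\<^sub>s C) Z H"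
   "\<And>x y z. x \<in> carrier A \<Longrightarrow> y \<in> carrier B \<Longrightarrow> z \<in> carrier C \<Longrightarrow>
     F (pt (A \<otimes>\<^sub>s B) C (pt A B x y) z) = H (pt (A \<otimes>\<^sub>s B) C (pt A B x y) z)"
  shows "\<forall>t\<in>carrier ((A \<otimes>\<^sub>s B) \<otimes>\<^sub>s C). F t = H t"
  using assms lin_comp[OF assms(5)] lin_comp[OF assms(6)]
  by (intro tensor_ball_ext[of _ _ Z]) simp_all

text \<open>
  With \<open>\<delta>\<^sub>0\<close> equivariant, the difference of both sides is the sum over \<open>\<delta>\<^sub>0 n\<close> of
  \<open>l * \<pi> (k \<cdot> x) - (l * \<pi> k) * x + (l * x) * \<pi> k\<close> tensored with the other factors. It vanishes by
  \<open>\<pi> (k \<cdot> x) = [\<pi> k, x]\<close> and the action identity.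
\<close>

lemma assoc_map_act:
  assumes L: "yd_object L" and M: "yd_object M" and N: "yd_object N" and x: "x \<in> carrier gL"
  defines "A \<equiv> yspace L" and "B \<equiv> yspace M" and "C \<equiv> yspace N"
  shows "\<forall>t\<in>carrier ((A \<otimes>\<^sub>s B) \<otimes>\<^sub>s C).
    assoc_map L M N (gact ((L \<otimes>\<^sub>y M) \<otimes>\<^sub>y N) t x) = gact (L \<otimes>\<^sub>y M \<otimes>\<^sub>y N) (assoc_map L M N t) x"
  unfolding A_def B_def C_def
proof (rule tensor_ball_ext3[of _ _ _ "yspace L \<otimes>\<^sub>s yspace M \<otimes>\<^sub>s yspace N"], goal_cases)
  case (7 l m n)
  then show ?case using L M N x
    by (simp add: vs_ac obj_leib[OF L, of l x])
qed (use L M N x in simp_all)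

lemma assoc_map_coeff1:
  assumes L: "yd_object L" and M: "yd_object M" and N: "yd_object N"
  defines "A \<equiv> yspace L" and "B \<equiv> yspace M" and "C \<equiv> yspace N"
  shows "\<forall>t\<in>carrier ((A \<otimes>\<^sub>s B) \<otimes>\<^sub>s C).
    assoc_map L M N (coeff1 ((L \<otimes>\<^sub>y M) \<otimes>\<^sub>y N) t) = coeff1 (L \<otimes>\<^sub>y M \<otimes>\<^sub>y N) (assoc_map L M N t)"
  unfolding A_def B_def C_def
  by (rule tensor_ball_ext3[of _ _ _ "yspace L \<otimes>\<^sub>s yspace M \<otimes>\<^sub>s yspace N"]) (use L M N in simp_all)

text \<open>
  Associativity fails in \<open>\<kk>\<close>, and the failure is compensated by \<open>\<delta>\<^sub>0\<close> of \<open>l * \<pi> k\<close>, which contributes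
  \<open>[i, k]\<close> through \<open>i \<cdot> \<pi> k = [i, k]\<close>. The Leibniz identity balances the terms with three
  brackets; the terms in which \<open>\<delta>\<^sub>0\<close> hits the last factor twice are zero.
\<close>

lemma assoc_map_coact0:
  assumes L: "yd_object L" and M: "yd_object M" and N: "yd_object N"
  defines "A \<equiv> yspace L" and "B \<equiv> yspace M" and "C \<equiv> yspace N"
  shows "\<forall>t\<in>carrier ((A \<otimes>\<^sub>s B) \<otimes>\<^sub>s C).
     tsum ((A \<otimes>\<^sub>s B) \<otimes>\<^sub>s C) kL ((A \<otimes>\<^sub>s B \<otimes>\<^sub>s C) \<otimes>\<^sub>s kL) (coact0 ((L \<otimes>\<^sub>y M) \<otimes>\<^sub>y N) t)
      (\<lambda>m0 k. pt (A \<otimes>\<^sub>s B \<otimes>\<^sub>s C) kL (assoc_map L M N m0) k) = coact0 (L \<otimes>\<^sub>y M \<otimes>\<^sub>y N) (assoc_map L M N t)"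
  unfolding A_def B_def C_def
proof (rule tensor_ball_ext3[of _ _ _ "(yspace L \<otimes>\<^sub>s yspace M \<otimes>\<^sub>s yspace N) \<otimes>\<^sub>s kL"], goal_cases)
  case (7 l m n)
  let ?A = "yspace L" and ?B = "yspace M" and ?C = "yspace N"
  let ?T = "?A \<otimes>\<^sub>s ?B \<otimes>\<^sub>s ?C"
  let ?t = "\<lambda>u v w k. pt ?T kL (pt ?A (?B \<otimes>\<^sub>s ?C) u (pt ?B ?C v w)) k"
  \<comment> \<open>The Leibniz identity is applied under the sums, at one place of the normal form. As a rewrite
    rule for brackets it would not terminate.\<close>
  have "tsum ?A kL (?T \<otimes>\<^sub>s kL) (coact0 L l) (\<lambda>u i. tsum ?B kL (?T \<otimes>\<^sub>s kL) (coact0 M m) (\<lambda>v j.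
      tsum ?C kL (?T \<otimes>\<^sub>s kL) (coact0 N n) (\<lambda>w k. ?t u v (coeff1 N w) (br (br i j) k)))) =
    tsum ?A kL (?T \<otimes>\<^sub>s kL) (coact0 L l) (\<lambda>u i. tsum ?B kL (?T \<otimes>\<^sub>s kL) (coact0 M m) (\<lambda>v j.
      tsum ?C kL (?T \<otimes>\<^sub>s kL) (coact0 N n) (\<lambda>w k. ?t u v (coeff1 N w) (br i (br j k) \<oplus>\<^bsub>kL\<^esub> br (br i k)
          j))))"
    by (intro tsum_cong HOL.refl arg_cong[where f = "pt _ kL _"] leibniz_br)
  also have "\<dots> = tsum ?A kL (?T \<otimes>\<^sub>s kL) (coact0 L l) (\<lambda>u i. tsum ?B kL (?T \<otimes>\<^sub>s kL) (coact0 M m) (\<lambda>v j.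
      tsum ?C kL (?T \<otimes>\<^sub>s kL) (coact0 N n) (\<lambda>w k. ?t u v (coeff1 N w) (br i (br j k))))) \<oplus>\<^bsub>?T \<otimes>\<^sub>s kL\<^esub>
    tsum ?A kL (?T \<otimes>\<^sub>s kL) (coact0 L l) (\<lambda>u i. tsum ?B kL (?T \<otimes>\<^sub>s kL) (coact0 M m) (\<lambda>v j.
      tsum ?C kL (?T \<otimes>\<^sub>s kL) (coact0 N n) (\<lambda>w k. ?t u v (coeff1 N w) (br (br i k) j))))"
    using 7 L M N by simp
  finally have leibniz: "tsum ?A kL (?T \<otimes>\<^sub>s kL) (coact0 L l) (\<lambda>u i. tsum ?B kL (?T \<otimes>\<^sub>s kL) (coact0 M
      m) (\<lambda>v j.
      tsum ?C kL (?T \<otimes>\<^sub>s kL) (coact0 N n) (\<lambda>w k. ?t u v (coeff1 N w) (br (br i j) k)))) = \<dots>" .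
  \<comment> \<open>The sum over the last factor is moved inside, next to its second coaction.\<close>
  from 7 show ?case using L M N
    by (simp add: vs_ac leibniz tsum_swap[where t = "coact0 N n" and s = "coact0 L l"]
        tsum_swap[where t = "coact0 N n" and s = "coact0 M m"])
qed (use L M N in simp_all)

lemma assoc_map_hom:
  assumes L: "yd_object L" and M: "yd_object M" and N: "yd_object N"
  shows "yd_hom X ((L \<otimes>\<^sub>y M) \<otimes>\<^sub>y N) (L \<otimes>\<^sub>y M \<otimes>\<^sub>y N)
    (restrict (assoc_map L M N) (carrier ((yspace L \<otimes>\<^sub>s yspace M) \<otimes>\<^sub>s yspace N)))"
  using L M N assoc_map_act[OF L M N] assoc_map_coeff1[OF L M N] assoc_map_coact0[OF L M N]
      assoc_map_lin[OF L M N]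
  by (intro yd_homI[of "(L \<otimes>\<^sub>y M) \<otimes>\<^sub>y N" "L \<otimes>\<^sub>y M \<otimes>\<^sub>y N" "assoc_map L M N", unfolded yspace_tensor])
      simp_all

text \<open>
  The associator is built from the action on the first factor and the coaction on the last one, both of
  which commute with morphisms.
\<close>

lemma assoc_map_natural:
  assumes L: "yd_object L" and M: "yd_object M" and N: "yd_object N" and L': "yd_object L'" and M':
      "yd_object M'" and N': "yd_object N'"
    and f: "yd_hom X L L' f" and g: "yd_hom X M M' g" and h: "yd_hom X N N' h"
  defines "A \<equiv> yspace L" and "B \<equiv> yspace M" and "C \<equiv> yspace N"
  shows "\<forall>t\<in>carrier ((A \<otimes>\<^sub>s B) \<otimes>\<^sub>s C).
     assoc_map L' M' N' (arrow_tensor (L \<otimes>\<^sub>y M) N (L' \<otimes>\<^sub>y M') N' (arrow_tensor L M L' M' f g) h t) =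
     arrow_tensor L (M \<otimes>\<^sub>y N) L' (M' \<otimes>\<^sub>y N') f (arrow_tensor M N M' N' g h) (assoc_map L M N t)"
proof -
  note F = yd_homD[OF f L L'] and G = yd_homD[OF g M M'] and H = yd_homD[OF h N N']
  note r = F(3-5) G(3-5) H(3-5) linD(1)[OF F(1)] linD(1)[OF G(1)] linD(1)[OF H(1)] lin_comp[OF F(1)]
      lin_comp[OF G(1)]
    lin_comp[OF H(1)]
  note fg = arrow_tensor_lin[OF L M L' M' F(1) G(1)] and gh = arrow_tensor_lin[OF M N M' N' G(1) H(1)]
  have fgh: "lin ((A \<otimes>\<^sub>s B) \<otimes>\<^sub>s C) ((yspace L' \<otimes>\<^sub>s yspace M') \<otimes>\<^sub>s yspace N') (arrow_tensor (L \<otimes>\<^sub>y M) N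
      (L' \<otimes>\<^sub>y M') N' (arrow_tensor L M L' M' f g) h)"
    using arrow_tensor_lin[of "L \<otimes>\<^sub>y M" N "L' \<otimes>\<^sub>y M'" N' _ h] fg H(1) L M N L' M' N' by (simp add:
        A_def B_def C_def)
  have fgh': "lin (A \<otimes>\<^sub>s B \<otimes>\<^sub>s C) (yspace L' \<otimes>\<^sub>s yspace M' \<otimes>\<^sub>s yspace N') (arrow_tensor L (M \<otimes>\<^sub>y N) L'
      (M' \<otimes>\<^sub>y N') f (arrow_tensor M N M' N' g h))"
    using arrow_tensor_lin[of L "M \<otimes>\<^sub>y N" L' "M' \<otimes>\<^sub>y N'" f] gh F(1) L M N L' M' N' by (simp add: A_def
        B_def C_def)
  note pts = arrow_tensor_pt[OF L M L' M' F(1) G(1)] arrow_tensor_pt[OF M N M' N' G(1) H(1)]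
    arrow_tensor_pt[of "L \<otimes>\<^sub>y M" N "L' \<otimes>\<^sub>y M'" N' "arrow_tensor L M L' M' f g" h, unfolded
        yspace_tensor, OF yd_object_tensor[OF L M] N yd_object_tensor[OF L' M'] N' fg H(1)]
    arrow_tensor_pt[of L "M \<otimes>\<^sub>y N" L' "M' \<otimes>\<^sub>y N'" f "arrow_tensor M N M' N' g h", unfolded
        yspace_tensor, OF L yd_object_tensor[OF M N] L' yd_object_tensor[OF M' N'] F(1) gh]
  show ?thesis unfolding A_def B_def C_def
    by (rule tensor_ball_ext3[of _ _ _ "yspace L' \<otimes>\<^sub>s yspace M' \<otimes>\<^sub>s yspace N'"])
      (use L M N L' M' N' lin_comp[OF fgh] lin_comp[OF fgh']
         lin_push[OF fgh'] in \<open>simp_all add: r pts A_def B_def C_def\<close>)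
qed

section \<open>The pentagon\<close>

text \<open>
  Both sides expand to sums over \<open>\<delta>\<^sub>0 w\<close> and \<open>\<delta>\<^sub>0 y\<close>. On the left \<open>u\<close> is acted on by \<open>\<pi> l\<close> and then by
  \<open>\<pi> k\<close>; on the right the order is reversed, and the coaction of \<open>W \<otimes> Y\<close> contributes a further term
  with \<open>[l, k]\<close>. The Leibniz action identity identifies them. The terms that contain \<open>\<delta>\<^sub>0\<close> of
  \<open>y\<^sub>0\<close> vanish.
\<close>

lemma pentagon_map:
  assumes U: "yd_object U" and V: "yd_object V" and W: "yd_object W" and Y: "yd_object Y"
  defines "A \<equiv> yspace U" and "B \<equiv> yspace V" and "C \<equiv> yspace W" and "D \<equiv> yspace Y"
  shows "\<forall>t\<in>carrier (((A \<otimes>\<^sub>s B) \<otimes>\<^sub>s C) \<otimes>\<^sub>s D).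
    arrow_tensor U ((V \<otimes>\<^sub>y W) \<otimes>\<^sub>y Y) U (V \<otimes>\<^sub>y W \<otimes>\<^sub>y Y) (\<lambda>x. x) (assoc_map V W Y)
      (assoc_map U (V \<otimes>\<^sub>y W) Y (arrow_tensor ((U \<otimes>\<^sub>y V) \<otimes>\<^sub>y W) Y (U \<otimes>\<^sub>y V \<otimes>\<^sub>y W) Y (assoc_map U V W) (\<lambda>x.
          x) t)) =
    assoc_map U V (W \<otimes>\<^sub>y Y) (assoc_map (U \<otimes>\<^sub>y V) W Y t)"
proof -
  let ?Z = "A \<otimes>\<^sub>s B \<otimes>\<^sub>s C \<otimes>\<^sub>s D"
  note defs = A_def B_def C_def D_def
  note obs = U V W Y
  have l1: "lin (((A \<otimes>\<^sub>s B) \<otimes>\<^sub>s C) \<otimes>\<^sub>s D) ((A \<otimes>\<^sub>s B \<otimes>\<^sub>s C) \<otimes>\<^sub>s D) (arrow_tensor ((U \<otimes>\<^sub>y V) \<otimes>\<^sub>y W) Y (U \<otimes>\<^sub>y V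
      \<otimes>\<^sub>y W) Y (assoc_map U V W) (\<lambda>x. x))"
    using arrow_tensor_lin[of "(U \<otimes>\<^sub>y V) \<otimes>\<^sub>y W" Y "U \<otimes>\<^sub>y V \<otimes>\<^sub>y W" Y "assoc_map U V W" "\<lambda>x. x"]
        assoc_map_lin[OF U V W] obs by (simp add: defs)
  have p1: "arrow_tensor ((U \<otimes>\<^sub>y V) \<otimes>\<^sub>y W) Y (U \<otimes>\<^sub>y V \<otimes>\<^sub>y W) Y (assoc_map U V W) (\<lambda>x. x) (pt ((A \<otimes>\<^sub>s B)
      \<otimes>\<^sub>s C) D s y) = pt (A \<otimes>\<^sub>s B \<otimes>\<^sub>s C) D (assoc_map U V W s) y"
    if "s \<in> carrier ((A \<otimes>\<^sub>s B) \<otimes>\<^sub>s C)" "y \<in> carrier D" for s y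
    using arrow_tensor_pt[of "(U \<otimes>\<^sub>y V) \<otimes>\<^sub>y W" Y "U \<otimes>\<^sub>y V \<otimes>\<^sub>y W" Y "assoc_map U V W" "\<lambda>x. x" s y]
        assoc_map_lin[OF U V W] obs that by (simp add: defs)
  have l2: "lin (A \<otimes>\<^sub>s (B \<otimes>\<^sub>s C) \<otimes>\<^sub>s D) ?Z (arrow_tensor U ((V \<otimes>\<^sub>y W) \<otimes>\<^sub>y Y) U (V \<otimes>\<^sub>y W \<otimes>\<^sub>y Y) (\<lambda>x. x)
      (assoc_map V W Y))"
    using arrow_tensor_lin[of U "(V \<otimes>\<^sub>y W) \<otimes>\<^sub>y Y" U "V \<otimes>\<^sub>y W \<otimes>\<^sub>y Y" "\<lambda>x. x" "assoc_map V W Y"]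
        assoc_map_lin[OF V W Y] obs by (simp add: defs)
  have p2: "arrow_tensor U ((V \<otimes>\<^sub>y W) \<otimes>\<^sub>y Y) U (V \<otimes>\<^sub>y W \<otimes>\<^sub>y Y) (\<lambda>x. x) (assoc_map V W Y) (pt A ((B \<otimes>\<^sub>s C)
      \<otimes>\<^sub>s D) u s) = pt A (B \<otimes>\<^sub>s C \<otimes>\<^sub>s D) u (assoc_map V W Y s)"
    if "s \<in> carrier ((B \<otimes>\<^sub>s C) \<otimes>\<^sub>s D)" "u \<in> carrier A" for s u
    using arrow_tensor_pt[of U "(V \<otimes>\<^sub>y W) \<otimes>\<^sub>y Y" U "V \<otimes>\<^sub>y W \<otimes>\<^sub>y Y" "\<lambda>x. x" "assoc_map V W Y" u s]
        assoc_map_lin[OF V W Y] obs that by (simp add: defs)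
  have vA: "vs A" "vs B" "vs C" "vs D" using obs by (simp_all add: defs)
  note af = assoc_map_lin[of U "V \<otimes>\<^sub>y W" Y, unfolded yspace_tensor, OF U yd_object_tensor[OF V W] Y,
      folded defs]
    assoc_map_lin[of U V "W \<otimes>\<^sub>y Y", unfolded yspace_tensor, OF U V yd_object_tensor[OF W Y], folded defs]
    assoc_map_lin[of "U \<otimes>\<^sub>y V" W Y, unfolded yspace_tensor, OF yd_object_tensor[OF U V] W Y, folded defs]
  note afl = lin_comp[OF af(1)] lin_comp[OF af(2)] lin_comp[OF af(3)] linD(1)[OF af(1)] linD(1)[OF
      af(2)] linD(1)[OF af(3)]
   lin_push[OF af(1)] lin_push[OF af(2)] lin_push[OF af(3)]
  note afp = assoc_map_pt[of U "V \<otimes>\<^sub>y W" Y, unfolded yspace_tensor, OF U yd_object_tensor[OF V W] Y,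
      folded defs]
    assoc_map_pt[of U V "W \<otimes>\<^sub>y Y", unfolded yspace_tensor, OF U V yd_object_tensor[OF W Y], folded defs]
    assoc_map_pt[of "U \<otimes>\<^sub>y V" W Y, unfolded yspace_tensor, OF yd_object_tensor[OF U V] W Y, folded defs]
    assoc_map_pt[OF U V W, folded defs] assoc_map_pt[OF V W Y, folded defs]
    assoc_map_simps[OF U V W, folded defs] assoc_map_simps[OF V W Y, folded defs]
    assoc_map_push[OF U V W, folded defs] assoc_map_push[OF V W Y, folded defs]
  note ob = obj_act[OF U, folded defs] obj_act[OF V, folded defs] obj_coact0[OF W, folded defs]
      obj_coact0[OF Y, folded defs]
    obj_coeff1[OF W, folded defs] obj_coeff1[OF Y, folded defs] tensor_pt_simps[OF W Y, folded defs]
        tensor_pt_simps[OF U V, folded defs]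
   obj_coact0_coeff1[OF Y, folded defs] obj_coact0_square[OF Y, folded defs]
       obj_coact0_square_nested[OF Y, folded defs] obj_tensor[OF yd_object_tensor[OF W Y], folded defs]
  show ?thesis
  proof (rule tensor_ball_ext[of _ _ ?Z])
    fix y assume y: "y \<in> carrier D"
    show "\<forall>t\<in>carrier ((A \<otimes>\<^sub>s B) \<otimes>\<^sub>s C).
    arrow_tensor U ((V \<otimes>\<^sub>y W) \<otimes>\<^sub>y Y) U (V \<otimes>\<^sub>y W \<otimes>\<^sub>y Y) (\<lambda>x. x) (assoc_map V W Y)
      (assoc_map U (V \<otimes>\<^sub>y W) Y (arrow_tensor ((U \<otimes>\<^sub>y V) \<otimes>\<^sub>y W) Y (U \<otimes>\<^sub>y V \<otimes>\<^sub>y W) Y (assoc_map U V W) (\<lambda>x.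
          x) (pt ((A \<otimes>\<^sub>s B) \<otimes>\<^sub>s C) D t y))) =
    assoc_map U V (W \<otimes>\<^sub>y Y) (assoc_map (U \<otimes>\<^sub>y V) W Y (pt ((A \<otimes>\<^sub>s B) \<otimes>\<^sub>s C) D t y))"
    proof (rule tensor_ball_ext3[of _ _ _ ?Z], goal_cases)
      case (7 u v w)
      have leib: "gact U (gact U u (pi_map X l)) (pi_map X k) = gact U (gact U u (pi_map X k))
          (pi_map X l) \<oplus>\<^bsub>A\<^esub> gact U u (gbr (pi_map X l) (pi_map X k))"
        if "k \<in> carrier kL" "l \<in> carrier kL" for k l
        using obj_leib[OF U, of u "pi_map X k" "pi_map X l"] 7 that by (simp add: defs)
      \<comment> \<open>again applied under the sums, since the action identity loops as a rewrite rule\<close>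
      have "tsum C kL ?Z (coact0 W w) (\<lambda>w0 l. tsum D kL ?Z (coact0 Y y) (\<lambda>y0 k.
           pt A (B \<otimes>\<^sub>s C \<otimes>\<^sub>s D) (gact U (gact U u (pi_map X l)) (pi_map X k)) (pt B (C \<otimes>\<^sub>s D) v (pt C D
               w0 (coeff1 Y y0))))) =
         tsum C kL ?Z (coact0 W w) (\<lambda>w0 l. tsum D kL ?Z (coact0 Y y) (\<lambda>y0 k.
           pt A (B \<otimes>\<^sub>s C \<otimes>\<^sub>s D) (gact U (gact U u (pi_map X k)) (pi_map X l) \<oplus>\<^bsub>A\<^esub> gact U u (gbr (pi_map
               X l) (pi_map X k))) (pt B (C \<otimes>\<^sub>s D) v (pt C D w0 (coeff1 Y y0)))))"
        by (intro tsum_cong HOL.refl arg_cong[where f = "\<lambda>a. pt A _ a _"] leib)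
      also have "\<dots> = tsum C kL ?Z (coact0 W w) (\<lambda>w0 l. tsum D kL ?Z (coact0 Y y) (\<lambda>y0 k.
           pt A (B \<otimes>\<^sub>s C \<otimes>\<^sub>s D) (gact U (gact U u (pi_map X k)) (pi_map X l)) (pt B (C \<otimes>\<^sub>s D) v (pt C D
               w0 (coeff1 Y y0))))) \<oplus>\<^bsub>?Z\<^esub>
         tsum C kL ?Z (coact0 W w) (\<lambda>w0 l. tsum D kL ?Z (coact0 Y y) (\<lambda>y0 k.
           pt A (B \<otimes>\<^sub>s C \<otimes>\<^sub>s D) (gact U u (gbr (pi_map X l) (pi_map X k))) (pt B (C \<otimes>\<^sub>s D) v (pt C D w0
               (coeff1 Y y0)))))"
        using 7 y vA obs ob by simp
      finally have leibniz: "tsum C kL ?Z (coact0 W w) (\<lambda>w0 l. tsum D kL ?Z (coact0 Y y) (\<lambda>y0 k.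
           pt A (B \<otimes>\<^sub>s C \<otimes>\<^sub>s D) (gact U (gact U u (pi_map X l)) (pi_map X k)) (pt B (C \<otimes>\<^sub>s D) v (pt C D
               w0 (coeff1 Y y0))))) = \<dots>" .
      from 7 show ?case using y vA obs
        by (simp add: ob afl afp p1 p2 lin_push[OF l2] vs_ac leibniz tsum_swap[where t = "coact0 Y
            y" and s = "coact0 W w"])
    qed (use obs vA y lin_comp[OF l1] lin_comp[OF l2] in \<open>simp_all add: afl\<close>)
  qed (use obs vA lin_comp[OF l1] lin_comp[OF l2] in \<open>simp_all add: afl\<close>)
qed

section \<open>The almost pre-tensor structure\<close>

lemma compose_restrict:
  assumes "\<And>x. x \<in> A \<Longrightarrow> f x \<in> B"
  shows "compose A (restrict g B) (restrict f A) = restrict (\<lambda>x. g (f x)) A"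
  using assms by (auto simp: compose_def intro!: restrict_ext)

lemma arrow_tensor_restrict:
  "A = carrier (yspace M) \<Longrightarrow> arrow_tensor M N M' N' (restrict f A) g = arrow_tensor M N M' N' f g"
  "B = carrier (yspace N) \<Longrightarrow> arrow_tensor M N M' N' f (restrict g B) = arrow_tensor M N M' N' f g"
  by (intro ext, simp add: arrow_tensor_def)+

lemma hom_restrict: "yd_hom X M N f \<Longrightarrow> restrict f (carrier (yspace M)) = f"
  by (simp add: yd_hom_def extensional_restrict)

lemma yd_almost_pre_tensor: "almost_pre_tensor_category \<C> (yd_tensor X) (yd_tensor_arrow X)
    (yd_assoc X)"
proof (intro almost_pre_tensor_category.intro almost_pre_tensor_category_axioms.intro category_yd)
  fix U V assume "U \<in> obj \<C>" "V \<in> obj \<C>"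
  then show "U \<otimes>\<^sub>y V \<in> obj \<C>" by simp
next
  fix f U U' g V V' assume "f \<in> homset \<C> U U'" "g \<in> homset \<C> V V'"
  then show "yd_tensor_arrow X f g \<in> homset \<C> (U \<otimes>\<^sub>y V) (U' \<otimes>\<^sub>y V')"
    by (auto simp: homset_C yd_tensor_arrow_eq intro!: arrow_tensor_hom)
next
  fix U V assume "U \<in> obj \<C>" "V \<in> obj \<C>"
  then have UV: "yd_object U" "yd_object V" by simp_all
  have "\<forall>t\<in>carrier (yspace U \<otimes>\<^sub>s yspace V). arrow_tensor U V U V (\<lambda>x. x) (\<lambda>x. x) t = t"
    by (rule tensor_ball_ext[of _ _ "yspace U \<otimes>\<^sub>s yspace V"])
      (use UV lin_comp[OF arrow_tensor_lin[of U V U V "\<lambda>x. x" "\<lambda>x. x"]] in \<open>simp_all add: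
          arrow_tensor_pt\<close>)
  then show "yd_tensor_arrow X (ident \<C> U) (ident \<C> V) = ident \<C> (U \<otimes>\<^sub>y V)"
    using UV by (auto simp: yd_ident_def yd_tensor_arrow_eq arrow_tensor_restrict intro!: restrict_ext)
next
  fix f U U' f' U'' g V V' g' V''
  assume "f \<in> homset \<C> U U'" "f' \<in> homset \<C> U' U''" "g \<in> homset \<C> V V'" "g' \<in> homset \<C> V' V''"
  then obtain a a' b b' where *: "f = Arrow U U' a" "f' = Arrow U' U'' a'" "g = Arrow V V' b" "g' =
      Arrow V' V'' b'"
    and ob: "yd_object U" "yd_object U'" "yd_object U''" "yd_object V" "yd_object V'" "yd_object V''"
    and h: "yd_hom X U U' a" "yd_hom X U' U'' a'" "yd_hom X V V' b" "yd_hom X V' V'' b'"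
    by (auto simp: homset_C)
  note l = yd_homD(1)[OF h(1) ob(1,2)] yd_homD(1)[OF h(2) ob(2,3)] yd_homD(1)[OF h(3) ob(4,5)]
      yd_homD(1)[OF h(4) ob(5,6)]
  note t1 = arrow_tensor_lin[OF ob(1,4,2,5) l(1,3)] and t2 = arrow_tensor_lin[OF ob(2,5,3,6) l(2,4)]
    and t3 = arrow_tensor_lin[OF ob(1,4,3,6) lin_comp[OF l(2,1)] lin_comp[OF l(4,3)]]
  have "\<forall>t\<in>carrier (yspace U \<otimes>\<^sub>s yspace V). arrow_tensor U V U'' V'' (\<lambda>x. a' (a x)) (\<lambda>x. b' (b x)) t =
    arrow_tensor U' V' U'' V'' a' b' (arrow_tensor U V U' V' a b t)"
    by (rule tensor_ball_ext[of _ _ "yspace U'' \<otimes>\<^sub>s yspace V''"])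
      (use ob t3 lin_comp[OF t2 t1] linD(1)[OF l(1)] linD(1)[OF l(3)] in
       \<open>simp_all add: arrow_tensor_pt l lin_comp[OF l(2,1)] lin_comp[OF l(4,3)]\<close>)
  then show "yd_tensor_arrow X (comp \<C> f' f) (comp \<C> g' g) = comp \<C> (yd_tensor_arrow X f' g')
      (yd_tensor_arrow X f g)"
    using ob * linD(1)[OF t1] by (simp add: yd_tensor_arrow_eq compose_restrict
        arrow_tensor_restrict compose_def[of _ a'] compose_def[of _ b'] cong: restrict_cong)
next
  fix U V W assume "U \<in> obj \<C>" "V \<in> obj \<C>" "W \<in> obj \<C>"
  then show "yd_assoc X U V W \<in> homset \<C> ((U \<otimes>\<^sub>y V) \<otimes>\<^sub>y W) (U \<otimes>\<^sub>y V \<otimes>\<^sub>y W)"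
    by (auto simp: yd_assoc_eq homset_C intro: assoc_map_hom)
next
  fix f U U' g V V' h W W' assume "f \<in> homset \<C> U U'" "g \<in> homset \<C> V V'" "h \<in> homset \<C> W W'"
  then obtain a b c where *: "f = Arrow U U' a" "g = Arrow V V' b" "h = Arrow W W' c"
    and ob: "yd_object U" "yd_object U'" "yd_object V" "yd_object V'" "yd_object W" "yd_object W'"
    and hs: "yd_hom X U U' a" "yd_hom X V V' b" "yd_hom X W W' c"
    by (auto simp: homset_C)
  note l = yd_homD(1)[OF hs(1) ob(1,2)] yd_homD(1)[OF hs(2) ob(3,4)] yd_homD(1)[OF hs(3) ob(5,6)]
  have 1: "arrow_tensor (U \<otimes>\<^sub>y V) W (U' \<otimes>\<^sub>y V') W' (arrow_tensor U V U' V' a b) c t \<in> carrier ((yspace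
      U' \<otimes>\<^sub>s yspace V') \<otimes>\<^sub>s yspace W')"
    if "t \<in> carrier ((yspace U \<otimes>\<^sub>s yspace V) \<otimes>\<^sub>s yspace W)" for t
    using linD(1)[OF arrow_tensor_lin[of "U \<otimes>\<^sub>y V" W "U' \<otimes>\<^sub>y V'" W' "arrow_tensor U V U' V' a b" c]]
        arrow_tensor_lin[OF ob(1,3,2,4) l(1,2)] l(3) ob that
    by simp
  show "comp \<C> (yd_assoc X U' V' W') (yd_tensor_arrow X (yd_tensor_arrow X f g) h) =
    comp \<C> (yd_tensor_arrow X f (yd_tensor_arrow X g h)) (yd_assoc X U V W)"
    using ob * 1 assoc_map_natural[OF ob(1,3,5,2,4,6) hs]
    by (simp add: yd_assoc_eq yd_tensor_arrow_eq arrow_tensor_restrict compose_restrict cong: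
        restrict_cong)
next
  fix U V W Y assume "U \<in> obj \<C>" "V \<in> obj \<C>" "W \<in> obj \<C>" "Y \<in> obj \<C>"
  then have ob: "yd_object U" "yd_object V" "yd_object W" "yd_object Y" by simp_all
  have 1: "arrow_tensor ((U \<otimes>\<^sub>y V) \<otimes>\<^sub>y W) Y (U \<otimes>\<^sub>y V \<otimes>\<^sub>y W) Y (assoc_map U V W) (\<lambda>x. x) t
      \<in> carrier ((yspace U \<otimes>\<^sub>s yspace V \<otimes>\<^sub>s yspace W) \<otimes>\<^sub>s yspace Y)"
    if "t \<in> carrier (((yspace U \<otimes>\<^sub>s yspace V) \<otimes>\<^sub>s yspace W) \<otimes>\<^sub>s yspace Y)" for t
    using linD(1)[OF arrow_tensor_lin[of "(U \<otimes>\<^sub>y V) \<otimes>\<^sub>y W" Y "U \<otimes>\<^sub>y V \<otimes>\<^sub>y W" Y "assoc_map U V W" "\<lambda>x.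
        x"]] assoc_map_lin[of U V W] ob that
    by simp
  have 2: "assoc_map U (V \<otimes>\<^sub>y W) Y t \<in> carrier (yspace U \<otimes>\<^sub>s (yspace V \<otimes>\<^sub>s yspace W) \<otimes>\<^sub>s yspace Y)"
    if "t \<in> carrier ((yspace U \<otimes>\<^sub>s yspace V \<otimes>\<^sub>s yspace W) \<otimes>\<^sub>s yspace Y)" for t
    using assoc_map_simps(2)[of U "V \<otimes>\<^sub>y W" Y t] ob that by simp
  have 3: "assoc_map (U \<otimes>\<^sub>y V) W Y t \<in> carrier ((yspace U \<otimes>\<^sub>s yspace V) \<otimes>\<^sub>s yspace W \<otimes>\<^sub>s yspace Y)"
    if "t \<in> carrier (((yspace U \<otimes>\<^sub>s yspace V) \<otimes>\<^sub>s yspace W) \<otimes>\<^sub>s yspace Y)" for t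
    using assoc_map_simps(2)[of "U \<otimes>\<^sub>y V" W Y t] ob that by simp
  show "comp \<C> (yd_tensor_arrow X (ident \<C> U) (yd_assoc X V W Y))
        (comp \<C> (yd_assoc X U (V \<otimes>\<^sub>y W) Y) (yd_tensor_arrow X (yd_assoc X U V W) (ident \<C> Y))) =
       comp \<C> (yd_assoc X U V (W \<otimes>\<^sub>y Y)) (yd_assoc X (U \<otimes>\<^sub>y V) W Y)"
    using ob 1 2 3 pentagon_map[OF ob]
    by (simp add: yd_assoc_eq yd_tensor_arrow_eq yd_ident_def arrow_tensor_restrict compose_restrict
        cong: restrict_cong)
qed

section \<open>Isomorphisms\<close>

text \<open>
  As for modules over an algebra, a linear inverse of a morphism is automatically a morphism.
\<close>

lemma yd_hom_inverse:
  assumes M: "yd_object M" and N: "yd_object N" and f: "yd_hom X M N f" and g: "lin (yspace N)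
      (yspace M) g"
    and gf: "\<And>m. m \<in> carrier (yspace M) \<Longrightarrow> g (f m) = m" and fg: "\<And>n. n \<in> carrier (yspace N) \<Longrightarrow> f (g n)
        = n"
  shows "yd_hom X N M (restrict g (carrier (yspace N)))"
proof (rule yd_homI[OF N M g])
  note F = yd_homD[OF f M N] and gc = linD(1)[OF g]
  show "\<forall>m\<in>carrier (yspace N). g (gact N m x) = gact M (g m) x" if x: "x \<in> carrier gL" for x
  proof
    fix n assume n: "n \<in> carrier (yspace N)"
    have "gact N (f (g n)) x = f (gact M (g n) x)" using F(3)[OF x gc[OF n]] .
    then show "g (gact N n x) = gact M (g n) x" using fg[OF n] gf M gc[OF n] x by simp
  qed
  show "\<forall>m\<in>carrier (yspace N). g (coeff1 N m) = coeff1 M (g m)"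
  proof
    fix n assume n: "n \<in> carrier (yspace N)"
    have "coeff1 N (f (g n)) = f (coeff1 M (g n))" using F(4)[OF gc[OF n]] .
    then show "g (coeff1 N n) = coeff1 M (g n)" using fg[OF n] gf M gc[OF n] by simp
  qed
  show "\<forall>m\<in>carrier (yspace N). tsum (yspace N) kL (yspace M \<otimes>\<^sub>s kL) (coact0 N m) (\<lambda>m0. pt (yspace M)
      kL (g m0)) = coact0 M (g m)"
  proof
    fix n assume n: "n \<in> carrier (yspace N)"
    have "coact0 N n = tsum (yspace M) kL (yspace N \<otimes>\<^sub>s kL) (coact0 M (g n)) (\<lambda>m0 k. pt (yspace N) kL
        (f m0) k)"
      using F(5)[OF gc[OF n]] fg[OF n] by simp
    then show "tsum (yspace N) kL (yspace M \<otimes>\<^sub>s kL) (coact0 N n) (\<lambda>m0. pt (yspace M) kL (g m0)) =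
        coact0 M (g n)"
      using M N n gc linD(1)[OF F(1)] lin_comp[OF g] gf by simp
  qed
qed

text \<open>
  Invertibility in the category thus only requires a linear inverse.
\<close>

lemma iso_arrowI:
  assumes M: "yd_object M" and N: "yd_object N" and f: "yd_hom X M N f" and g: "lin (yspace N)
      (yspace M) g"
    and gf: "\<And>m. m \<in> carrier (yspace M) \<Longrightarrow> g (f m) = m" and fg: "\<And>n. n \<in> carrier (yspace N) \<Longrightarrow> f (g n)
        = n"
  shows "iso_arrow \<C> (Arrow M N f)"
proof -
  have "Arrow N M (restrict g (carrier (yspace N))) \<in> homset \<C> N M"
    using yd_hom_inverse[OF assms] M N by (auto simp: homset_C)
  moreover have "compose (carrier (yspace M)) (restrict g (carrier (yspace N))) f = restrict (\<lambda>x. x)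
      (carrier (yspace M))"
    using linD(1)[OF yd_homD(1)[OF f M N]] gf by (auto simp: compose_def intro!: restrict_ext)
  moreover have "compose (carrier (yspace N)) f (restrict g (carrier (yspace N))) = restrict (\<lambda>x. x)
      (carrier (yspace N))"
    using fg by (auto simp: compose_def intro!: restrict_ext)
  ultimately show ?thesis using assms(1-3) unfolding iso_arrow_def
    by (auto simp: arr_C yd_ident_def intro!: bexI[of _ "Arrow N M (restrict g (carrier (yspace N)))"])
qed

section \<open>The right unit\<close>

abbreviation S :: "('a, 'k) vect" where "S \<equiv> scalar_space KK"
abbreviation I :: "('a, 'k) yd" where "I \<equiv> yd_unit X"

lemma scalar_carrier: "c \<in> carrier S \<longleftrightarrow> (\<exists>a\<in>carrier KK. c = Scalar a)"
  by (auto simp: scalar_space_def)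

text \<open>
  The last three rules unfold the operations of the scalar space. They are switched off wherever the
  rules for arbitrary spaces have to match.
\<close>

lemma scalar_simps [simp]:
  "Scalar a \<in> carrier S \<longleftrightarrow> a \<in> carrier KK"
  "c \<in> carrier S \<Longrightarrow> scalar_of c \<in> carrier KK"
  "\<zero>\<^bsub>S\<^esub> = Scalar \<zero>\<^bsub>KK\<^esub>" "c \<oplus>\<^bsub>S\<^esub> c' = Scalar (scalar_of c \<oplus>\<^bsub>KK\<^esub> scalar_of c')"
  "a \<odot>\<^bsub>S\<^esub> c = Scalar (a \<otimes>\<^bsub>KK\<^esub> scalar_of c)"
  by (auto simp: scalar_space_def)

lemma vs_S [simp]: "vs S"
proof (rule moduleI)
  show "abelian_group S"
  proof (rule abelian_groupI)
    fix x assume "x \<in> carrier S"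
    then show "\<exists>y\<in>carrier S. y \<oplus>\<^bsub>S\<^esub> x = \<zero>\<^bsub>S\<^esub>"
      by (intro bexI[of _ "Scalar (\<ominus>\<^bsub>KK\<^esub> scalar_of x)"]) (auto simp: l_neg)
  qed (auto simp: scalar_carrier a_ac)
qed (auto simp: scalar_carrier is_cring l_distr r_distr m_ac)

lemma scalar_lin [simp]: "vs V \<Longrightarrow> v \<in> carrier V \<Longrightarrow> lin S V (\<lambda>c. scalar_of c \<odot>\<^bsub>V\<^esub> v)"
  by (rule linI) (auto simp: vs_distr)

lemma yspace_unit [simp]: "yspace I = S"
  by (simp add: yd_unit_def Let_def)

lemma split_unit: "split_coaction X I (\<lambda>c x. \<zero>\<^bsub>S\<^esub>) (\<lambda>c. \<zero>\<^bsub>S \<otimes>\<^sub>s kL\<^esub>) (\<lambda>c. c)"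
proof (intro split_coaction.intro split_coaction_axioms.intro leibniz_xmod_axioms)
  show "lin (yspace I) (yspace I \<otimes>\<^sub>s kL) (\<lambda>c. \<zero>\<^bsub>S \<otimes>\<^sub>s kL\<^esub>)" by (simp del: scalar_simps)
  show "bil (yspace I) gL (yspace I) (\<lambda>c x. \<zero>\<^bsub>S\<^esub>)" by (simp del: scalar_simps)
next
  fix m q assume "m \<in> carrier (yspace I)" "q \<in> carrier G"
  then show "yact I m q = \<zero>\<^bsub>S\<^esub> \<oplus>\<^bsub>yspace I\<^esub> unit_part q \<odot>\<^bsub>yspace I\<^esub> m"
    by (simp add: yd_unit_def Let_def plus_counit_def)
next
  fix m assume "m \<in> carrier (yspace I)"
  then show "ycoact I m = tsum (yspace I) kL (yspace I \<otimes>\<^sub>s P) \<zero>\<^bsub>S \<otimes>\<^sub>s kL\<^esub> (\<lambda>m0 k. pt (yspace I) P m0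
      (emb k))
         \<oplus>\<^bsub>yspace I \<otimes>\<^sub>s P\<^esub> pt (yspace I) P m (kone X)"
    by (simp add: yd_unit_def Let_def del: scalar_simps)
qed (simp_all del: scalar_simps)

lemma yd_module_unit: "yd_module X I"
  by (rule split_coaction.yd_moduleI[OF split_unit]) (simp_all del: scalar_simps)

lemma yd_object_unit [simp]: "yd_object I"
  and unit_simps [simp]: "m \<in> carrier S \<Longrightarrow> x \<in> carrier gL \<Longrightarrow> gact I m x = \<zero>\<^bsub>S\<^esub>"
    "m \<in> carrier S \<Longrightarrow> coact0 I m = \<zero>\<^bsub>S \<otimes>\<^sub>s kL\<^esub>" "m \<in> carrier S \<Longrightarrow> coeff1 I m = m"
  using yd_objectI[OF split_unit yd_module_unit] by (simp_all del: scalar_simps)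

definition unitor_map where
  "unitor_map M t = tsum (yspace M) S (yspace M) t (\<lambda>m c. scalar_of c \<odot>\<^bsub>yspace M\<^esub> m)"

lemma yd_right_unitor_eq:
  "yd_object M \<Longrightarrow> yd_right_unitor X M = Arrow (M \<otimes>\<^sub>y I) M (restrict (unitor_map M) (carrier (yspace M
      \<otimes>\<^sub>s S)))"
  by (auto simp: yd_right_unitor_def Let_def unitor_map_def sweedler_tsum[of "yspace M" S] intro!:
      restrict_ext)

lemma unitor_map_lin: "yd_object M \<Longrightarrow> lin (yspace M \<otimes>\<^sub>s S) (yspace M) (unitor_map M)"
  unfolding unitor_map_def[abs_def] by simp

lemmas unitor_map_simps [simp] = lin_comp[OF unitor_map_lin] linD(1)[OF unitor_map_lin]

lemma unitor_map_pt [simp]: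
  "yd_object M \<Longrightarrow> m \<in> carrier (yspace M) \<Longrightarrow> c \<in> carrier S \<Longrightarrow> unitor_map M (pt (yspace M) S m c) =
      scalar_of c \<odot>\<^bsub>yspace M\<^esub> m"
  unfolding unitor_map_def by simp

lemma unitor_map_push [simp]:
  assumes "yd_object M"
  defines "T \<equiv> yspace M \<otimes>\<^sub>s S"
  shows "x \<in> carrier T \<Longrightarrow> y \<in> carrier T \<Longrightarrow> unitor_map M (x \<oplus>\<^bsub>T\<^esub> y) = unitor_map M x \<oplus>\<^bsub>yspace M\<^esub> unitor_map
      M y"
    "(\<And>u v. u \<in> carrier D \<Longrightarrow> v \<in> carrier E \<Longrightarrow> F u v \<in> carrier T) \<Longrightarrow>
      unitor_map M (tsum D E T t F) = tsum D E (yspace M) t (\<lambda>u v. unitor_map M (F u v))"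
  using lin_push[OF unitor_map_lin[OF assms(1)]] assms(1) by (simp_all add: T_def)

lemmas obj_tensor_unit [simp] = obj_tensor[of M I for M, unfolded yspace_unit]
lemmas tensor_pt_unit [simp] = tensor_pt_simps[of M I for M, unfolded yspace_unit]

lemma unitor_map_hom:
  assumes M: "yd_object M"
  shows "yd_hom X (M \<otimes>\<^sub>y I) M (restrict (unitor_map M) (carrier (yspace M \<otimes>\<^sub>s S)))"
proof (rule yd_homI[of "M \<otimes>\<^sub>y I" M "unitor_map M", unfolded yspace_tensor yspace_unit])
  let ?V = "yspace M"
  show "\<forall>m\<in>carrier (?V \<otimes>\<^sub>s S). unitor_map M (gact (M \<otimes>\<^sub>y I) m x) = gact M (unitor_map M m) x" if x: "x
      \<in> carrier gL" for x
    by (rule tensor_ball_ext[of _ _ ?V]) (use M x in \<open>simp_all del: scalar_simps(3-5)\<close>)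
  show "\<forall>m\<in>carrier (?V \<otimes>\<^sub>s S). unitor_map M (coeff1 (M \<otimes>\<^sub>y I) m) = coeff1 M (unitor_map M m)"
    by (rule tensor_ball_ext[of _ _ ?V]) (use M in \<open>simp_all del: scalar_simps(3-5)\<close>)
  show "\<forall>m\<in>carrier (?V \<otimes>\<^sub>s S).
       tsum (?V \<otimes>\<^sub>s S) kL (?V \<otimes>\<^sub>s kL) (coact0 (M \<otimes>\<^sub>y I) m) (\<lambda>m0 k. pt ?V kL (unitor_map M m0) k) =
           coact0 M (unitor_map M m)"
    by (rule tensor_ball_ext[of _ _ "?V \<otimes>\<^sub>s kL"]) (use M in \<open>simp_all del: scalar_simps(3-5)\<close>)
qed (use M unitor_map_lin in simp_all)

text \<open>
  The inverse sends \<open>m\<close> to \<open>m \<otimes> 1\<close>.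
\<close>

lemma unitor_iso:
  assumes M: "yd_object M"
  shows "iso_arrow \<C> (yd_right_unitor X M)"
  unfolding yd_right_unitor_eq[OF M]
proof (rule iso_arrowI[where g = "\<lambda>m. pt (yspace M) S m (Scalar \<one>\<^bsub>KK\<^esub>)"])
  let ?V = "yspace M"
  have "\<forall>t\<in>carrier (?V \<otimes>\<^sub>s S). pt ?V S (unitor_map M t) (Scalar \<one>\<^bsub>KK\<^esub>) = t"
  proof (rule tensor_ball_ext[of _ _ "?V \<otimes>\<^sub>s S"])
    fix c assume c: "c \<in> carrier S"
    show "\<forall>m\<in>carrier ?V. pt ?V S (unitor_map M (pt ?V S m c)) (Scalar \<one>\<^bsub>KK\<^esub>) = pt ?V S m c"
    proof
      fix m assume m: "m \<in> carrier ?V"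
      have "scalar_of c \<odot>\<^bsub>?V \<otimes>\<^sub>s S\<^esub> pt ?V S m (Scalar \<one>\<^bsub>KK\<^esub>) = pt ?V S m (scalar_of c \<odot>\<^bsub>S\<^esub> Scalar \<one>\<^bsub>KK\<^esub>)"
        using M m c by (simp del: scalar_simps(3-5))
      also have "\<dots> = pt ?V S m c" using c by (auto simp: scalar_carrier)
      finally show "pt ?V S (unitor_map M (pt ?V S m c)) (Scalar \<one>\<^bsub>KK\<^esub>) = pt ?V S m c"
        using M m c by (simp del: scalar_simps(3-5))
    qed
  qed (use M in \<open>simp_all del: scalar_simps(3-5)\<close>)
  then show "pt ?V S (restrict (unitor_map M) (carrier (?V \<otimes>\<^sub>s S)) m) (Scalar \<one>\<^bsub>KK\<^esub>) = m"
    if "m \<in> carrier (yspace (M \<otimes>\<^sub>y I))" for m using that by simp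
qed (use M unitor_map_hom in simp_all)

lemma yd_right_unit: "right_unit \<C> (yd_tensor X) (yd_tensor_arrow X) (yd_assoc X) (yd_unit X)
    (yd_right_unitor X)"
proof (intro right_unit.intro right_unit_axioms.intro yd_almost_pre_tensor)
  show "I \<in> obj \<C>" by simp
next
  fix U assume "U \<in> obj \<C>"
  then show "yd_right_unitor X U \<in> homset \<C> (U \<otimes>\<^sub>y I) U"
    by (auto simp: homset_C yd_right_unitor_eq intro: unitor_map_hom)
next
  fix U assume "U \<in> obj \<C>"
  then show "iso_arrow \<C> (yd_right_unitor X U)" by (simp add: unitor_iso)
next
  fix f U V assume "f \<in> homset \<C> U V"
  then obtain a where f: "f = Arrow U V a" and U: "yd_object U" and V: "yd_object V" and a: "yd_hom
      X U V a"
    by (auto simp: homset_C)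
  note l = yd_homD(1)[OF a U V]
  have t: "lin (yspace U \<otimes>\<^sub>s S) (yspace V \<otimes>\<^sub>s S) (arrow_tensor U I V I a (\<lambda>x. x))"
    using arrow_tensor_lin[of U I V I a "\<lambda>x. x"] U V l by simp
  have p: "arrow_tensor U I V I a (\<lambda>x. x) (pt (yspace U) S m c) = pt (yspace V) S (a m) c" if "m \<in>
      carrier (yspace U)" "c \<in> carrier S" for m c
    using arrow_tensor_pt[of U I V I a "\<lambda>x. x" m c] U V l that by simp
  have "\<forall>t\<in>carrier (yspace U \<otimes>\<^sub>s S). unitor_map V (arrow_tensor U I V I a (\<lambda>x. x) t) = a (unitor_map
      U t)"
    by (rule tensor_ball_ext[of _ _ "yspace V"])
      (use U V linD[OF l] lin_comp[OF l] lin_comp[OF t] in \<open>simp_all add: p\<close>)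
  then show "comp \<C> (yd_right_unitor X V) (yd_tensor_arrow X f (ident \<C> I)) = comp \<C> f
      (yd_right_unitor X U)"
    using U V linD(1)[OF t] hom_restrict[OF a] compose_restrict[of "carrier (yspace U \<otimes>\<^sub>s S)"
        "unitor_map U" "carrier (yspace U)" a]
    by (simp add: f yd_right_unitor_eq yd_tensor_arrow_eq yd_ident_def arrow_tensor_restrict
        compose_restrict cong: restrict_cong)
next
  fix U V assume "U \<in> obj \<C>" "V \<in> obj \<C>"
  then have U: "yd_object U" and V: "yd_object V" by simp_all
  let ?A = "yspace U" and ?B = "yspace V"
  have t: "lin (?A \<otimes>\<^sub>s ?B \<otimes>\<^sub>s S) (?A \<otimes>\<^sub>s ?B) (arrow_tensor U (V \<otimes>\<^sub>y I) U V (\<lambda>x. x) (unitor_map V))"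
    using arrow_tensor_lin[of U "V \<otimes>\<^sub>y I" U V "\<lambda>x. x" "unitor_map V"] U V unitor_map_lin[OF V] by simp
  have p: "arrow_tensor U (V \<otimes>\<^sub>y I) U V (\<lambda>x. x) (unitor_map V) (pt ?A (?B \<otimes>\<^sub>s S) m c) = pt ?A ?B m
      (unitor_map V c)"
    if "m \<in> carrier ?A" "c \<in> carrier (?B \<otimes>\<^sub>s S)" for m c
    using arrow_tensor_pt[of U "V \<otimes>\<^sub>y I" U V "\<lambda>x. x" "unitor_map V" m c] U V unitor_map_lin[OF V]
        that by simp
  have af: "assoc_map U V I (pt (?A \<otimes>\<^sub>s ?B) S (pt ?A ?B u v) c) = pt ?A (?B \<otimes>\<^sub>s S) u (pt ?B S v c)"
    if "u \<in> carrier ?A" "v \<in> carrier ?B" "c \<in> carrier S" for u v c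
    using assoc_map_pt[OF U V yd_object_unit, of u v c] that U V by (simp del: scalar_simps(3-5))
  have afl: "lin ((?A \<otimes>\<^sub>s ?B) \<otimes>\<^sub>s S) (?A \<otimes>\<^sub>s ?B \<otimes>\<^sub>s S) (assoc_map U V I)"
    using assoc_map_lin[OF U V yd_object_unit] by simp
  have uf: "unitor_map (U \<otimes>\<^sub>y V) (pt (?A \<otimes>\<^sub>s ?B) S s c) = scalar_of c \<odot>\<^bsub>?A \<otimes>\<^sub>s ?B\<^esub> s" if "s \<in> carrier (?A
      \<otimes>\<^sub>s ?B)" "c \<in> carrier S" for s c
    using unitor_map_pt[of "U \<otimes>\<^sub>y V" s c] that U V by simp
  have "\<forall>t\<in>carrier ((?A \<otimes>\<^sub>s ?B) \<otimes>\<^sub>s S). arrow_tensor U (V \<otimes>\<^sub>y I) U V (\<lambda>x. x) (unitor_map V) (assoc_map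
      U V I t) = unitor_map (U \<otimes>\<^sub>y V) t"
    by (rule tensor_ball_ext3[of _ _ _ "?A \<otimes>\<^sub>s ?B"])
      (use U V lin_comp[OF t afl] unitor_map_lin[of "U \<otimes>\<^sub>y V"] in \<open>simp_all add: p af uf\<close>)
  then show "comp \<C> (yd_tensor_arrow X (ident \<C> U) (yd_right_unitor X V)) (yd_assoc X U V I) =
      yd_right_unitor X (U \<otimes>\<^sub>y V)"
    using U V linD(1)[OF afl]
    by (simp add: yd_right_unitor_eq yd_assoc_eq yd_tensor_arrow_eq yd_ident_def
        arrow_tensor_restrict compose_restrict cong: restrict_cong)
qed

end

section \<open>Full subcategories closed under the tensor product\<close>

text \<open>
  Coherence, naturality and the unit axioms are equations between arrows, so they restrict to a full
  subcategory that is closed under the tensor product. This transfers the structure to representations.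
\<close>

locale closed_full_subcategory = almost_pre_tensor_category C tob tar \<alpha>
  for C :: "('o, 'm) category" and tob tar \<alpha> +
  fixes D :: "('o, 'm) category"
  assumes same: "src D = src C" "tgt D = tgt C" "ident D = ident C" "comp D = comp C"
    and obj_sub: "obj D \<subseteq> obj C"
    and arr_full: "arr D = {f \<in> arr C. src C f \<in> obj D \<and> tgt C f \<in> obj D}"
    and tob_closed: "U \<in> obj D \<Longrightarrow> V \<in> obj D \<Longrightarrow> tob U V \<in> obj D"
begin

lemma hom_D: "f \<in> homset D A B \<longleftrightarrow> f \<in> homset C A B \<and> A \<in> obj D \<and> B \<in> obj D"
  by (auto simp: homset_def arr_full same)

lemma obj_D: "U \<in> obj D \<Longrightarrow> U \<in> obj C"
  using obj_sub by blast

lemma category_D: "category D"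
  by (rule category.intro)
    (auto simp: hom_D obj_D same arr_full ident_hom comp_ident_left comp_ident_right intro: comp_hom
        comp_assoc)

lemma subcategory_D: "subcategory D C"
  using category_D category_axioms obj_sub by (auto simp: subcategory_def same arr_full)

lemma tensor_D: "almost_pre_tensor_category D tob tar \<alpha>"
proof (intro almost_pre_tensor_category.intro almost_pre_tensor_category_axioms.intro category_D)
  fix f f' g g' U U' U'' V V' V''
  assume "f \<in> homset D U U'" "f' \<in> homset D U' U''" "g \<in> homset D V V'" "g' \<in> homset D V' V''"
  then show "tar (comp D f' f) (comp D g' g) = comp D (tar f' g') (tar f g)"
    unfolding hom_D same by (metis tensor_comp)
next
  fix f g h U U' V V' W W'
  assume "f \<in> homset D U U'" "g \<in> homset D V V'" "h \<in> homset D W W'"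
  then show "comp D (\<alpha> U' V' W') (tar (tar f g) h) = comp D (tar f (tar g h)) (\<alpha> U V W)"
    unfolding hom_D same by (metis assoc_natural)
qed (auto simp: hom_D obj_D same tob_closed tensor_ident pentagon intro: tensor_hom assoc_hom)

lemma iso_D:
  assumes "iso_arrow C f" "src C f \<in> obj D" "tgt C f \<in> obj D"
  shows "iso_arrow D f"
  using assms by (auto simp: iso_arrow_def hom_D same arr_full)

lemma right_unit_D:
  assumes "right_unit C tob tar \<alpha> I \<rho>" "I \<in> obj D"
  shows "right_unit D tob tar \<alpha> I \<rho>"
proof -
  interpret right_unit C tob tar \<alpha> I \<rho> by fact
  show ?thesis
  proof (intro right_unit.intro right_unit_axioms.intro tensor_D assms(2))
    fix U assume U: "U \<in> obj D"
    show "\<rho> U \<in> homset D (tob U I) U"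
      using U assms(2) by (simp add: hom_D obj_D tob_closed unitor_hom)
    then show "iso_arrow D (\<rho> U)"
      using U assms(2) by (intro iso_D) (auto simp: unitor_iso obj_D homset_def same tob_closed)
  next
    fix f U V assume "f \<in> homset D U V"
    then show "comp D (\<rho> V) (tar f (ident D I)) = comp D f (\<rho> U)"
      unfolding hom_D same by (metis unitor_natural)
  qed (auto simp: obj_D same unitor_coherence)
qed

end

context leibniz_xmod
begin

section \<open>Representations\<close>

abbreviation \<D> where "\<D> \<equiv> rep_category X"

text \<open>
  The image of the representations among the objects is characterized by \<open>p = id\<close>. The remaining two
  conditions concern only the values of the structure maps outside the carriers, which have to be the
  default ones for a module to be equal to a \<^const>\<open>rep_inclusion\<close>.
\<close>

definition rep_object :: "('a, 'k) yd \<Rightarrow> bool" where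
  "rep_object M \<longleftrightarrow> yd_object M \<and> (\<forall>m\<in>carrier (yspace M). coeff1 M m = m) \<and>
     yact M = (\<lambda>m\<in>carrier (yspace M). \<lambda>q\<in>carrier G. yact M m q) \<and>
     ycoact M = (\<lambda>m\<in>carrier (yspace M). ycoact M m)"

lemma rep_facts:
  assumes R: "representation X R"
  shows "vs (rspace R)" "bil (rspace R) gL (rspace R) (ract R)" "lin (rspace R) (rspace R \<otimes>\<^sub>s kL)
      (rcoact R)"
  using R by (simp_all add: representation_def leibniz_action_def Let_def del: bil_iff)

lemma yspace_incl [simp]: "yspace (rep_inclusion X R) = rspace R"
  by (simp add: rep_inclusion_def Let_def)

lemma split_representation:
  assumes R: "representation X R"
  shows "split_coaction X (rep_inclusion X R) (ract R) (rcoact R) (\<lambda>m. m)"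
proof (intro split_coaction.intro split_coaction_axioms.intro leibniz_xmod_axioms)
  note r = rep_facts[OF R]
  fix m assume "m \<in> carrier (yspace (rep_inclusion X R))"
  then show "ycoact (rep_inclusion X R) m =
         tsum (yspace (rep_inclusion X R)) kL (yspace (rep_inclusion X R) \<otimes>\<^sub>s P) (rcoact R m)
          (\<lambda>m0 k. pt (yspace (rep_inclusion X R)) P m0 (emb k)) \<oplus>\<^bsub>yspace (rep_inclusion X R) \<otimes>\<^sub>s P\<^esub>
         pt (yspace (rep_inclusion X R)) P m (kone X)"
    using r(1) linD(1)[OF r(3)]
    by (simp add: rep_inclusion_def Let_def tensor_map_def sweedler_tsum[of "rspace R" kL])
qed (use rep_facts[OF R] in \<open>simp_all add: rep_inclusion_def Let_def del: bil_iff\<close>)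

lemma yd_module_rep:
  assumes R: "representation X R"
  shows "yd_module X (rep_inclusion X R)"
proof (rule split_coaction.yd_moduleI[OF split_representation[OF R]], unfold yspace_incl)
  note r = rep_facts[OF R]
  let ?V = "rspace R"
  show "ract R (ract R m y) x = ract R (ract R m x) y \<oplus>\<^bsub>?V\<^esub> ract R m (gbr y x)"
    if "m \<in> carrier ?V" "x \<in> carrier gL" "y \<in> carrier gL" for m x y
  proof -
    have "ract R m (gbr y x) = ract R (ract R m y) x \<ominus>\<^bsub>?V\<^esub> ract R (ract R m x) y"
      using R that by (simp add: representation_def leibniz_action_def Let_def)
    moreover have "ract R (ract R m y) x \<in> carrier ?V" "ract R (ract R m x) y \<in> carrier ?V"
      using that bil_closed[OF r(2)] by simp_all
    ultimately show ?thesis using vs_diff_eq[OF r(1)] bil_closed[OF r(2)] that by simp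
  qed
  show "\<forall>m\<in>carrier ?V. rcoact R (ract R m x) = tsum ?V kL (?V \<otimes>\<^sub>s kL) (rcoact R m)
      (\<lambda>m0 k. pt ?V kL m0 (xact X k x) \<oplus>\<^bsub>?V \<otimes>\<^sub>s kL\<^esub> pt ?V kL (ract R m0 x) k)" if "x \<in> carrier gL" for x
    using R that r(1) linD(1)[OF r(3)] by (simp add: representation_def Let_def sweedler_tsum[of ?V
        kL] del: tsum_plus bil_iff)
  show "\<forall>m\<in>carrier ?V. tsum ?V kL ((?V \<otimes>\<^sub>s kL) \<otimes>\<^sub>s kL) (rcoact R m) (\<lambda>m0. pt (?V \<otimes>\<^sub>s kL) kL (rcoact R
      m0)) =
      \<zero>\<^bsub>(?V \<otimes>\<^sub>s kL) \<otimes>\<^sub>s kL\<^esub>"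
    using R r(1) linD(1)[OF r(3)] by (simp add: representation_def Let_def tensor_map_def
        sweedler_tsum[of ?V kL] del: bil_iff)
qed (use rep_facts[OF R] linD(1)[OF rep_facts(3)[OF R]] in simp_all)

lemma rep_inclusion_parts:
  assumes R: "representation X R"
  shows "yd_object (rep_inclusion X R)"
    "m \<in> carrier (rspace R) \<Longrightarrow> x \<in> carrier gL \<Longrightarrow> gact (rep_inclusion X R) m x = ract R m x"
    "m \<in> carrier (rspace R) \<Longrightarrow> coact0 (rep_inclusion X R) m = rcoact R m"
    "m \<in> carrier (rspace R) \<Longrightarrow> coeff1 (rep_inclusion X R) m = m"
  using yd_objectI[OF split_representation[OF R] yd_module_rep[OF R], unfolded yspace_incl] by blast+

lemma rep_object_inclusion: "representation X R \<Longrightarrow> rep_object (rep_inclusion X R)"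
  using rep_inclusion_parts[of R] by (auto simp: rep_object_def rep_inclusion_def Let_def intro!:
      restrict_ext ext)

text \<open>
  The splitting of the action and the coaction inverts \<^const>\<open>rep_inclusion\<close>.
\<close>

lemma rep_object_representation:
  assumes M: "rep_object M"
  defines "R \<equiv> \<lparr>rspace = yspace M, ract = gact M, rcoact = coact0 M\<rparr>"
  shows "representation X R" "rep_inclusion X R = M"
proof -
  have ob: "yd_object M" using M by (simp add: rep_object_def)
  interpret g: split_coaction X M "gact M" "coact0 M" "coeff1 M" by (rule split_object[OF ob])
  have coeff1: "coeff1 M m = m" if "m \<in> carrier (yspace M)" for m using M that by (simp add:
      rep_object_def)
  have leib: "gact M m (gbr x y) = gact M (gact M m x) y \<ominus>\<^bsub>yspace M\<^esub> gact M (gact M m y) x"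
    if "m \<in> carrier (yspace M)" "x \<in> carrier gL" "y \<in> carrier gL" for m x y
  proof -
    have "gact M (gact M m x) y = gact M (gact M m y) x \<oplus>\<^bsub>yspace M\<^esub> gact M m (gbr x y)"
      using obj_leib[OF ob that(1,3,2)] .
    then show ?thesis using vs_diff_eq[OF obj_vs[OF ob]] ob that by simp
  qed
  have dd: "tensor_map KK (yspace M \<otimes>\<^sub>s kL) kL (coact0 M) id (coact0 M m) = \<zero>\<^bsub>(yspace M \<otimes>\<^sub>s kL) \<otimes>\<^sub>s kL\<^esub>"
    if m: "m \<in> carrier (yspace M)" for m
    using obj_coact0_square_tensor[OF ob m] ob m by (simp add: tensor_map_def sweedler_tsum[of
        "yspace M" kL])
  have da: "coact0 M (gact M m x) = sweedler (yspace M \<otimes>\<^sub>s kL) (coact0 M m)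
      (\<lambda>m0 m1. pt (yspace M) kL m0 (xact X m1 x) \<oplus>\<^bsub>yspace M \<otimes>\<^sub>s kL\<^esub> pt (yspace M) kL (gact M m0 x) m1)"
    if "m \<in> carrier (yspace M)" "x \<in> carrier gL" for m x
    using ob that by (simp add: sweedler_tsum[of "yspace M" kL])
  show "representation X R"
    unfolding representation_def R_def Let_def leibniz_action_def
    using obj_vs[OF ob] g.bil_a g.lin_d leib dd da by (simp only: rep.simps) blast
  have a: "yact (rep_inclusion X R) = yact M"
  proof -
    have "yact (rep_inclusion X R) = (\<lambda>m\<in>carrier (yspace M). \<lambda>q\<in>carrier G. yact M m q)"
      by (auto simp: rep_inclusion_def R_def Let_def g.act_eq intro!: restrict_ext)
    then show ?thesis using M by (simp add: rep_object_def)
  qed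
  have c: "ycoact (rep_inclusion X R) = ycoact M"
  proof -
    have "ycoact (rep_inclusion X R) = (\<lambda>m\<in>carrier (yspace M). ycoact M m)"
      using ob by (auto simp: rep_inclusion_def R_def Let_def g.coact_eq coeff1 tensor_map_def
          sweedler_tsum[of "yspace M" kL] intro!: restrict_ext)
    then show ?thesis using M by (simp add: rep_object_def)
  qed
  show "rep_inclusion X R = M" using a c by (intro yd.equality) (simp_all add: R_def)
qed

text \<open>
  As \<open>p = id\<close> on both sides, the inclusion is fully faithful.
\<close>

lemma rep_hom_iff:
  assumes R: "representation X R" and Q: "representation X Q"
  shows "rep_hom X R Q f \<longleftrightarrow> yd_hom X (rep_inclusion X R) (rep_inclusion X Q) f"
proof (cases "lin (rspace R) (rspace Q) f")
  case f: True
  note fc = linD(1)[OF f] and rc = linD(1)[OF rep_facts(3)[OF R]]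
  show ?thesis unfolding yd_hom_iff[OF rep_inclusion_parts(1)[OF R] rep_inclusion_parts(1)[OF Q]]
      rep_hom_def
    using f R Q bil_closed[OF rep_facts(2)[OF R]]
    by (auto simp: rep_inclusion_parts fc rc tensor_map_def sweedler_tsum[of "rspace R" kL]
        rep_facts(1) simp del: bil_iff)
qed (auto simp: rep_hom_def yd_hom_def)

lemma obj_D [simp]: "M \<in> obj \<D> \<longleftrightarrow> rep_object M"
proof -
  have "obj \<D> = {rep_inclusion X R | R. representation X R}" by (simp add: rep_category_def)
  moreover have "\<exists>R. M = rep_inclusion X R \<and> representation X R" if "rep_object M"
    using rep_object_representation(1)[OF that] rep_object_representation(2)[OF that, symmetric] by
        (intro exI conjI)
  ultimately show ?thesis by (auto simp: rep_object_inclusion)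
qed

lemma arr_D: "f \<in> arr \<D> \<longleftrightarrow> f \<in> arr \<C> \<and> rep_object (dom_of f) \<and> rep_object (cod_of f)"
proof
  assume "f \<in> arr \<D>"
  then obtain R Q h where "f = Arrow (rep_inclusion X R) (rep_inclusion X Q) h"
    "representation X R" "representation X Q" "rep_hom X R Q h" by (auto simp: rep_category_def)
  then show "f \<in> arr \<C> \<and> rep_object (dom_of f) \<and> rep_object (cod_of f)"
    using rep_hom_iff rep_object_inclusion rep_inclusion_parts(1) by (auto simp: arr_C)
next
  assume *: "f \<in> arr \<C> \<and> rep_object (dom_of f) \<and> rep_object (cod_of f)"
  then obtain M N h where f: "f = Arrow M N h" "rep_object M" "rep_object N" "yd_hom X M N h" by
      (auto simp: arr_C)
  obtain R Q where "representation X R" "rep_inclusion X R = M" "representation X Q" "rep_inclusion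
      X Q = N"
    using rep_object_representation[OF f(2)] rep_object_representation[OF f(3)] by blast
  then show "f \<in> arr \<D>" using f rep_hom_iff[of R Q h] unfolding rep_category_def by auto
qed

lemma rep_object_tensor:
  assumes M: "rep_object M" and N: "rep_object N"
  shows "rep_object (M \<otimes>\<^sub>y N)"
proof -
  have ob: "yd_object M" "yd_object N" and coeff1: "\<And>m. m \<in> carrier (yspace M) \<Longrightarrow> coeff1 M m = m"
      "\<And>m. m \<in> carrier (yspace N) \<Longrightarrow> coeff1 N m = m"
    using M N by (auto simp: rep_object_def)
  have "\<forall>t\<in>carrier (yspace M \<otimes>\<^sub>s yspace N). coeff1 (M \<otimes>\<^sub>y N) t = t"
    by (rule tensor_ball_ext[of _ _ "yspace M \<otimes>\<^sub>s yspace N"]) (use ob in \<open>simp_all add: coeff1\<close>)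
  then show ?thesis using ob by (simp add: rep_object_def) (simp add: yd_tensor_def Let_def cong:
      restrict_cong)
qed

lemma rep_object_unit: "rep_object I"
  by (simp add: rep_object_def del: scalar_simps) (simp add: yd_unit_def Let_def cong: restrict_cong)

lemma cancel_neg:
  assumes "vs Z" "x \<in> carrier Z"
  shows "x \<oplus>\<^bsub>Z\<^esub> (\<ominus>\<^bsub>KK\<^esub> \<one>\<^bsub>KK\<^esub>) \<odot>\<^bsub>Z\<^esub> x = \<zero>\<^bsub>Z\<^esub>" "(\<ominus>\<^bsub>KK\<^esub> \<one>\<^bsub>KK\<^esub>) \<odot>\<^bsub>Z\<^esub> x \<oplus>\<^bsub>Z\<^esub> x = \<zero>\<^bsub>Z\<^esub>"
  using assms by (simp_all flip: neg_smult)

text \<open>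
  The associator with the opposite sign in its second summand.
\<close>

definition assoc_inverse where
  "assoc_inverse L M N t = (let A = yspace L; B = yspace M; C = yspace N; T = (A \<otimes>\<^sub>s B) \<otimes>\<^sub>s C in
     tsum A (B \<otimes>\<^sub>s C) T t (\<lambda>l s. tsum B C T s (\<lambda>m n. pt (A \<otimes>\<^sub>s B) C (pt A B l m) n \<oplus>\<^bsub>T\<^esub>
       (\<ominus>\<^bsub>KK\<^esub> \<one>\<^bsub>KK\<^esub>) \<odot>\<^bsub>T\<^esub> tsum C kL T (coact0 N n) (\<lambda>n0 k. pt (A \<otimes>\<^sub>s B) C (pt A B (gact L l (pi_map X k))
           m) n0))))"

text \<open>
  Let \<open>E\<close> denote the second summand of the associator. If \<open>p = id\<close> on the last factor then, up to flat
  rebracketing, the associator is \<open>id + E\<close>. Applying \<open>E\<close> twice uses \<open>\<delta>\<^sub>0\<close> twice on that factor,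
  hence \<open>E\<close> squares to zero and \<open>id - E\<close> is the inverse.
\<close>

lemma assoc_iso:
  assumes L: "yd_object L" and M: "yd_object M" and N: "yd_object N"
    and coeff1: "\<And>n. n \<in> carrier (yspace N) \<Longrightarrow> coeff1 N n = n"
  shows "iso_arrow \<C> (yd_assoc X L M N)"
  unfolding yd_assoc_eq[OF L M N]
proof (rule iso_arrowI[where g = "assoc_inverse L M N"], unfold yspace_tensor)
  let ?A = "yspace L" and ?B = "yspace M" and ?C = "yspace N"
  note obs = L M N
  show il: "lin (?A \<otimes>\<^sub>s ?B \<otimes>\<^sub>s ?C) ((?A \<otimes>\<^sub>s ?B) \<otimes>\<^sub>s ?C) (assoc_inverse L M N)"
    unfolding assoc_inverse_def[abs_def] Let_def using obs by simp
  note ip = lin_comp[OF il] lin_push[OF il] linD(1)[OF il]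
  have ipt: "assoc_inverse L M N (pt ?A (?B \<otimes>\<^sub>s ?C) l (pt ?B ?C m n)) = pt (?A \<otimes>\<^sub>s ?B) ?C (pt ?A ?B l
      m) n \<oplus>\<^bsub>(?A \<otimes>\<^sub>s ?B) \<otimes>\<^sub>s ?C\<^esub>
       (\<ominus>\<^bsub>KK\<^esub> \<one>\<^bsub>KK\<^esub>) \<odot>\<^bsub>(?A \<otimes>\<^sub>s ?B) \<otimes>\<^sub>s ?C\<^esub> tsum ?C kL ((?A \<otimes>\<^sub>s ?B) \<otimes>\<^sub>s ?C) (coact0 N n) (\<lambda>n0 k. pt (?A \<otimes>\<^sub>s ?B)
           ?C (pt ?A ?B (gact L l (pi_map X k)) m) n0)"
    if "l \<in> carrier ?A" "m \<in> carrier ?B" "n \<in> carrier ?C" for l m n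
    unfolding assoc_inverse_def Let_def using obs that by simp
  have "\<forall>t\<in>carrier ((?A \<otimes>\<^sub>s ?B) \<otimes>\<^sub>s ?C). assoc_inverse L M N (assoc_map L M N t) = t"
    by (rule tensor_ball_ext3[of _ _ _ "(?A \<otimes>\<^sub>s ?B) \<otimes>\<^sub>s ?C"]) (use obs in \<open>simp_all add: coeff1 ipt ip
        vs_ac cancel_neg\<close>)
  then show "assoc_inverse L M N (restrict (assoc_map L M N) (carrier ((?A \<otimes>\<^sub>s ?B) \<otimes>\<^sub>s ?C)) t) = t"
    if "t \<in> carrier ((?A \<otimes>\<^sub>s ?B) \<otimes>\<^sub>s ?C)" for t using that by simp
  have al: "assoc_map L M N (a \<odot>\<^bsub>(?A \<otimes>\<^sub>s ?B) \<otimes>\<^sub>s ?C\<^esub> t) = a \<odot>\<^bsub>?A \<otimes>\<^sub>s ?B \<otimes>\<^sub>s ?C\<^esub> assoc_map L M N t"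
    if "a \<in> carrier KK" "t \<in> carrier ((?A \<otimes>\<^sub>s ?B) \<otimes>\<^sub>s ?C)" for a t
    using linD(3)[OF assoc_map_lin[OF obs]] that by simp
  have "\<forall>t\<in>carrier (?A \<otimes>\<^sub>s ?B \<otimes>\<^sub>s ?C). assoc_map L M N (assoc_inverse L M N t) = t"
  proof (rule tensor_ball_ext[of _ _ "?A \<otimes>\<^sub>s ?B \<otimes>\<^sub>s ?C"])
    fix s assume s: "s \<in> carrier (?B \<otimes>\<^sub>s ?C)"
    show "\<forall>l\<in>carrier ?A. assoc_map L M N (assoc_inverse L M N (pt ?A (?B \<otimes>\<^sub>s ?C) l s)) = pt ?A (?B \<otimes>\<^sub>s
        ?C) l s"
    proof
      fix l assume l: "l \<in> carrier ?A"
      have "\<forall>s\<in>carrier (?B \<otimes>\<^sub>s ?C). assoc_map L M N (assoc_inverse L M N (pt ?A (?B \<otimes>\<^sub>s ?C) l s)) = pt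
          ?A (?B \<otimes>\<^sub>s ?C) l s"
        by (rule tensor_ball_ext[of _ _ "?A \<otimes>\<^sub>s ?B \<otimes>\<^sub>s ?C"])
          (use obs l in \<open>simp_all add: coeff1 ipt ip al vs_ac cancel_neg\<close>)
      with s show "assoc_map L M N (assoc_inverse L M N (pt ?A (?B \<otimes>\<^sub>s ?C) l s)) = pt ?A (?B \<otimes>\<^sub>s ?C) l
          s" by blast
    qed
  qed (use obs in \<open>simp_all add: ip\<close>)
  then show "restrict (assoc_map L M N) (carrier ((?A \<otimes>\<^sub>s ?B) \<otimes>\<^sub>s ?C)) (assoc_inverse L M N t) = t"
    if "t \<in> carrier (?A \<otimes>\<^sub>s ?B \<otimes>\<^sub>s ?C)" for t using that obs by (simp add: ip)
qed (use L M N assoc_map_hom[OF L M N] in simp_all)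

lemma closed_full_rep: "closed_full_subcategory \<C> (yd_tensor X) (yd_tensor_arrow X) (yd_assoc X) \<D>"
proof (intro closed_full_subcategory.intro closed_full_subcategory_axioms.intro yd_almost_pre_tensor)
  show "src \<D> = src \<C>" "tgt \<D> = tgt \<C>" "ident \<D> = ident \<C>" "comp \<D> = comp \<C>"
    by (simp_all add: rep_category_def)
  show "obj \<D> \<subseteq> obj \<C>" by (auto simp: rep_object_def)
  show "arr \<D> = {f \<in> arr \<C>. src \<C> f \<in> obj \<D> \<and> tgt \<C> f \<in> obj \<D>}" by (auto simp: arr_D)
qed (simp add: rep_object_tensor)

lemma rep_pre_tensor: "pre_tensor_category \<D> (yd_tensor X) (yd_tensor_arrow X) (yd_assoc X)"
proof -
  interpret D: closed_full_subcategory \<C> "yd_tensor X" "yd_tensor_arrow X" "yd_assoc X" \<D> by (rule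
      closed_full_rep)
  show ?thesis
  proof (intro pre_tensor_category.intro pre_tensor_category_axioms.intro D.tensor_D)
    fix U V W assume *: "U \<in> obj \<D>" "V \<in> obj \<D>" "W \<in> obj \<D>"
    then have ob: "yd_object U" "yd_object V" "yd_object W" and coeff1: "\<And>n. n \<in> carrier (yspace W)
        \<Longrightarrow> coeff1 W n = n" by (auto simp: rep_object_def)
    show "iso_arrow \<D> (yd_assoc X U V W)"
      using assoc_iso[OF ob coeff1] * by (intro D.iso_D) (simp_all add: yd_assoc_eq[OF ob]
          rep_object_tensor)
  qed
qed

end

theorem theorem5:
  fixes X :: "('a, 'k) xmod"
  assumes "leibniz_crossed_module X"
  shows
    "almost_pre_tensor_category (yd_category X)
       (yd_tensor X) (yd_tensor_arrow X) (yd_assoc X) \<and>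
     right_unit (yd_category X)
       (yd_tensor X) (yd_tensor_arrow X) (yd_assoc X) (yd_unit X) (yd_right_unitor X) \<and>
     subcategory (rep_category X) (yd_category X) \<and>
     pre_tensor_category (rep_category X)
       (yd_tensor X) (yd_tensor_arrow X) (yd_assoc X) \<and>
     right_unit (rep_category X)
       (yd_tensor X) (yd_tensor_arrow X) (yd_assoc X) (yd_unit X) (yd_right_unitor X)"
proof -
  interpret leibniz_xmod X using assms by (rule leibniz_xmod.intro)
  interpret D: closed_full_subcategory "yd_category X" "yd_tensor X" "yd_tensor_arrow X" "yd_assoc
      X" "rep_category X"
    by (rule closed_full_rep)
  show ?thesis
    using yd_almost_pre_tensor yd_right_unit D.subcategory_D rep_pre_tensor D.right_unit_D[OF
        yd_right_unit] rep_object_unit by simp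
qed

end
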